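(* Let a weak quasi-contact metric manifold $M^{2n+1}(f,Q,\xi,\eta,g)$ satisfy the condition $$(\nabla_X\,Q)\,Y=0\qquad (X,Y\in\ker\eta).$$ If $h$ is self-adjoint, then $\eta$ is a contact form and $d\Phi=0$.
   Context: $\mathfrak{X}_M$ denotes the Lie algebra of smooth vector fields on a smooth manifold $M$ of dimension $2n+1$, and $\nabla$ is the Levi-Civita connection of $g$. A weak almost-contact metric structure $(f,Q,\xi,\eta,g)$ on $M^{2n+1}$ consists of a $(1,1)$-tensor $f$, a nonsingular $(1,1)$-tensor $Q$, a vector field $\xi$, a 1-form $\eta$ and a Riemannian metric $g$ such that $f^2=-Q+\eta\otimes\xi$, $\eta(\xi)=1$, $g(fX,fY)=g(X,QY)-\eta(X)\eta(Y)$, $\eta(X)=g(\xi,X)$ for all $X,Y\in\mathfrak{X}_M$. (Then $f\xi=0$, $\eta\circ f=0$, $\eta\circ Q=\eta$, $Q\xi=\xi$, $Qf=fQ$, $f$ is skew-symmetric, $Q$ is self-adjoint and positive definite, and ${\rm rank}\,f=2n$.) The $(1,1)$-tensor $h$ is $h=\frac12\,\mathcal{L}_\xi f$, where $(\mathcal{L}_Z f)X=[Z,fX]-f[Z,X]$; self-adjointness is with respect to $g$. A weak quasi-contact metric manifold is one with a weak almost-contact metric structure satisfying, for all $X,Y\in\mathfrak{X}_M$, $$(\nabla_X f)Y+(\nabla_{fX}f)fY=2\,g(X,Y)\,\xi-\eta(Y)\big(X+hX+\eta(X)\,\xi\big).$$ The 2-form $\Phi$ is $\Phi(X,Y)=g(X,fY)$,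 with exterior derivative $$d\Phi(X,Y,Z)=\tfrac13\big\{X\,\Phi(Y,Z)+Y\,\Phi(Z,X)+Z\,\Phi(X,Y)-\Phi([X,Y],Z)-\Phi([Z,X],Y)-\Phi([Y,Z],X)\big\}.$$ A 1-form $\eta$ on $M^{2n+1}$ is called contact if $\eta\wedge(d\eta)^n\ne0$ everywhere, where $2\,d\eta(X,Y)=X(\eta(Y))-Y(\eta(X))-\eta([X,Y])$. *)

theory Defs
  imports "HOL-Analysis.Analysis" "HOL-Library.Function_Algebras"
begin

instantiation "fun" :: (type, real_vector) real_vector
begin

definition scaleR_fun :: "real \<Rightarrow> ('a \<Rightarrow> 'b) \<Rightarrow> 'a \<Rightarrow> 'b"
  where "scaleR_fun c u = (\<lambda>x. c *\<^sub>R u x)"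

instance
  by standard (auto simp: scaleR_fun_def fun_eq_iff scaleR_add_right scaleR_add_left)

end


section \<open>Smooth manifolds\<close>

text \<open>These are used for open sets \<open>S\<close> only.\<close>

fun Ck_on :: "nat \<Rightarrow> 'e::real_normed_vector set \<Rightarrow> ('e \<Rightarrow> 'f::real_normed_vector) \<Rightarrow> bool"
where
  "Ck_on 0 S u \<longleftrightarrow> continuous_on S u"
| "Ck_on (Suc k) S u \<longleftrightarrow>
     (\<forall>x\<in>S. u differentiable (at x)) \<and>
     (\<forall>v. Ck_on k S (\<lambda>x. frechet_derivative u (at x) v))"

definition smooth_on :: "'e::real_normed_vector set \<Rightarrow> ('e \<Rightarrow> 'f::real_normed_vector) \<Rightarrow> bool"
  where "smooth_on S u \<longleftrightarrow> (\<forall>k. Ck_on k S u)"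

text \<open>The points of the manifold are all elements of the type \<open>'m\<close>, whose topology is Hausdorff
  and second countable by its type classes; the dimension is \<open>DIM('e)\<close>.
  A chart is a pair of its domain and its coordinate map. The atlas need not be maximal.\<close>

type_synonym ('m, 'e) atlas = "('m set \<times> ('m \<Rightarrow> 'e)) set"

definition smooth_manifold ::
  "('m::{t2_space, second_countable_topology}, 'e::euclidean_space) atlas \<Rightarrow> bool"
where
  "smooth_manifold A \<longleftrightarrow>
     (\<Union>(U, \<phi>)\<in>A. U) = UNIV \<and>
     (\<forall>(U, \<phi>)\<in>A. open U \<and> open (\<phi> ` U) \<and> homeomorphism U (\<phi> ` U) \<phi> (inv_into U \<phi>)) \<and>
     (\<forall>(U, \<phi>)\<in>A. \<forall>(V, \<psi>)\<in>A. smooth_on (\<phi> ` (U \<inter> V)) (\<psi> \<circ> inv_into U \<phi>))"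

definition smooth_fun :: "('m, 'e::euclidean_space) atlas \<Rightarrow> ('m \<Rightarrow> real) \<Rightarrow> bool"
  where "smooth_fun A u \<longleftrightarrow> (\<forall>(U, \<phi>)\<in>A. smooth_on (\<phi> ` U) (u \<circ> inv_into U \<phi>))"


section \<open>Tangent vectors and vector fields\<close>

text \<open>A tangent vector at \<open>p\<close> is a derivation at \<open>p\<close> of the algebra of smooth functions.
  As functions are total in HOL, it is required to vanish on non-smooth arguments, so that equality
  of tangent vectors is equality of their values on smooth functions.\<close>

type_synonym 'm tangent = "('m \<Rightarrow> real) \<Rightarrow> real"
type_synonym 'm vfield = "'m \<Rightarrow> 'm tangent"

definition tangent_space :: "('m, 'e::euclidean_space) atlas \<Rightarrow> 'm \<Rightarrow> 'm tangent set" where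
  "tangent_space A p = {v.
     (\<forall>u w. smooth_fun A u \<longrightarrow> smooth_fun A w \<longrightarrow> v (u + w) = v u + v w) \<and>
     (\<forall>c u. smooth_fun A u \<longrightarrow> v (c *\<^sub>R u) = c * v u) \<and>
     (\<forall>u w. smooth_fun A u \<longrightarrow> smooth_fun A w \<longrightarrow> v (u * w) = u p * v w + w p * v u) \<and>
     (\<forall>u. \<not> smooth_fun A u \<longrightarrow> v u = 0)}"

definition deriv_along :: "'m vfield \<Rightarrow> ('m \<Rightarrow> real) \<Rightarrow> 'm \<Rightarrow> real"
  where "deriv_along X u = (\<lambda>p. X p u)"

definition vfields :: "('m, 'e::euclidean_space) atlas \<Rightarrow> 'm vfield set" where
  "vfields A = {X. (\<forall>p. X p \<in> tangent_space A p) \<and>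
                   (\<forall>u. smooth_fun A u \<longrightarrow> smooth_fun A (deriv_along X u))}"

definition fscale :: "('m \<Rightarrow> real) \<Rightarrow> 'm vfield \<Rightarrow> 'm vfield"
  where "fscale u X = (\<lambda>p. u p *\<^sub>R X p)"

definition lie_bracket :: "'m vfield \<Rightarrow> 'm vfield \<Rightarrow> 'm vfield"
  where "lie_bracket X Y = (\<lambda>p u. X p (deriv_along Y u) - Y p (deriv_along X u))"


section \<open>Tensor fields\<close>

type_synonym 'm tensor11 = "'m \<Rightarrow> 'm tangent \<Rightarrow> 'm tangent"
type_synonym 'm covector = "'m \<Rightarrow> 'm tangent \<Rightarrow> real"
type_synonym 'm tensor02 = "'m \<Rightarrow> 'm tangent \<Rightarrow> 'm tangent \<Rightarrow> real"

definition app11 :: "'m tensor11 \<Rightarrow> 'm vfield \<Rightarrow> 'm vfield"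
  where "app11 F X = (\<lambda>p. F p (X p))"

definition app1 :: "'m covector \<Rightarrow> 'm vfield \<Rightarrow> 'm \<Rightarrow> real"
  where "app1 \<eta> X = (\<lambda>p. \<eta> p (X p))"

definition app2 :: "'m tensor02 \<Rightarrow> 'm vfield \<Rightarrow> 'm vfield \<Rightarrow> 'm \<Rightarrow> real"
  where "app2 g X Y = (\<lambda>p. g p (X p) (Y p))"

definition tensor11 :: "('m, 'e::euclidean_space) atlas \<Rightarrow> 'm tensor11 \<Rightarrow> bool" where
  "tensor11 A F \<longleftrightarrow>
     (\<forall>p. \<forall>v\<in>tangent_space A p. F p v \<in> tangent_space A p) \<and>
     (\<forall>p. \<forall>v\<in>tangent_space A p. \<forall>w\<in>tangent_space A p. F p (v + w) = F p v + F p w) \<and>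
     (\<forall>p c. \<forall>v\<in>tangent_space A p. F p (c *\<^sub>R v) = c *\<^sub>R F p v) \<and>
     (\<forall>X\<in>vfields A. app11 F X \<in> vfields A)"

definition nonsingular :: "('m, 'e::euclidean_space) atlas \<Rightarrow> 'm tensor11 \<Rightarrow> bool" where
  "nonsingular A F \<longleftrightarrow> (\<forall>p. bij_betw (F p) (tangent_space A p) (tangent_space A p))"

definition one_form :: "('m, 'e::euclidean_space) atlas \<Rightarrow> 'm covector \<Rightarrow> bool" where
  "one_form A \<eta> \<longleftrightarrow>
     (\<forall>p. \<forall>v\<in>tangent_space A p. \<forall>w\<in>tangent_space A p. \<eta> p (v + w) = \<eta> p v + \<eta> p w) \<and>
     (\<forall>p c. \<forall>v\<in>tangent_space A p. \<eta> p (c *\<^sub>R v) = c * \<eta> p v) \<and>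
     (\<forall>X\<in>vfields A. smooth_fun A (app1 \<eta> X))"

definition riemannian_metric :: "('m, 'e::euclidean_space) atlas \<Rightarrow> 'm tensor02 \<Rightarrow> bool" where
  "riemannian_metric A g \<longleftrightarrow>
     (\<forall>p. \<forall>v\<in>tangent_space A p. \<forall>w\<in>tangent_space A p. \<forall>z\<in>tangent_space A p.
        g p (v + w) z = g p v z + g p w z) \<and>
     (\<forall>p c. \<forall>v\<in>tangent_space A p. \<forall>w\<in>tangent_space A p. g p (c *\<^sub>R v) w = c * g p v w) \<and>
     (\<forall>p. \<forall>v\<in>tangent_space A p. \<forall>w\<in>tangent_space A p. g p v w = g p w v) \<and>
     (\<forall>p. \<forall>v\<in>tangent_space A p. v \<noteq> 0 \<longrightarrow> g p v v > 0) \<and>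
     (\<forall>X\<in>vfields A. \<forall>Y\<in>vfields A. smooth_fun A (app2 g X Y))"


section \<open>Connections\<close>

text \<open>\<open>D X Y\<close> is \<open>\<nabla>\<^sub>X Y\<close>.\<close>

type_synonym 'm connection = "'m vfield \<Rightarrow> 'm vfield \<Rightarrow> 'm vfield"

definition affine_connection :: "('m, 'e::euclidean_space) atlas \<Rightarrow> 'm connection \<Rightarrow> bool" where
  "affine_connection A D \<longleftrightarrow>
     (\<forall>X\<in>vfields A. \<forall>Y\<in>vfields A. D X Y \<in> vfields A) \<and>
     (\<forall>X\<in>vfields A. \<forall>Y\<in>vfields A. \<forall>Z\<in>vfields A.
        D (X + Y) Z = D X Z + D Y Z \<and> D X (Y + Z) = D X Y + D X Z) \<and>
     (\<forall>u. smooth_fun A u \<longrightarrow> (\<forall>X\<in>vfields A. \<forall>Y\<in>vfields A.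
        D (fscale u X) Y = fscale u (D X Y) \<and>
        D X (fscale u Y) = fscale (deriv_along X u) Y + fscale u (D X Y)))"

definition levi_civita ::
  "('m, 'e::euclidean_space) atlas \<Rightarrow> 'm tensor02 \<Rightarrow> 'm connection \<Rightarrow> bool"
where
  "levi_civita A g D \<longleftrightarrow>
     affine_connection A D \<and>
     (\<forall>X\<in>vfields A. \<forall>Y\<in>vfields A. D X Y - D Y X = lie_bracket X Y) \<and>
     (\<forall>X\<in>vfields A. \<forall>Y\<in>vfields A. \<forall>Z\<in>vfields A.
        deriv_along X (app2 g Y Z) = app2 g (D X Y) Z + app2 g Y (D X Z))"

text \<open>\<open>(\<nabla>\<^sub>X F) Y\<close> for a (1,1)-tensor field \<open>F\<close>\<close>

definition cov_deriv11 ::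
  "'m connection \<Rightarrow> 'm vfield \<Rightarrow> 'm tensor11 \<Rightarrow> 'm vfield \<Rightarrow> 'm vfield"
  where "cov_deriv11 D X F Y = D X (app11 F Y) - app11 F (D X Y)"

definition lie_deriv11 :: "'m vfield \<Rightarrow> 'm tensor11 \<Rightarrow> 'm vfield \<Rightarrow> 'm vfield"
  where "lie_deriv11 Z F X = lie_bracket Z (app11 F X) - app11 F (lie_bracket Z X)"


section \<open>Differential forms\<close>

text \<open>A \<open>k\<close>-form is given by its values on \<open>k\<close> vector fields, namely the first \<open>k\<close> members of a
  sequence; further members are ignored. The normalisation of the wedge product is the one
  belonging to the exterior derivative with the factors \<open>1/2\<close> and \<open>1/3\<close>.\<close>

type_synonym 'm form = "(nat \<Rightarrow> 'm vfield) \<Rightarrow> 'm \<Rightarrow> real"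

definition wedge :: "nat \<Rightarrow> nat \<Rightarrow> 'm form \<Rightarrow> 'm form \<Rightarrow> 'm form" where
  "wedge k l \<alpha> \<beta> = (\<lambda>X p.
     (\<Sum>\<sigma> | \<sigma> permutes {..<k + l}.
        of_int (sign \<sigma>) * \<alpha> (\<lambda>i. X (\<sigma> i)) p * \<beta> (\<lambda>i. X (\<sigma> (k + i))) p) / fact (k + l))"

text \<open>The \<open>j\<close>-fold wedge power of a 2-form\<close>

fun wedge_power2 :: "'m form \<Rightarrow> nat \<Rightarrow> 'm form" where
  "wedge_power2 \<omega> 0 = (\<lambda>X p. 1)"
| "wedge_power2 \<omega> (Suc j) = wedge 2 (2 * j) \<omega> (wedge_power2 \<omega> j)"

definition ext_deriv1 :: "'m covector \<Rightarrow> 'm vfield \<Rightarrow> 'm vfield \<Rightarrow> 'm \<Rightarrow> real" where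
  "ext_deriv1 \<eta> X Y =
     (1/2) *\<^sub>R (deriv_along X (app1 \<eta> Y) - deriv_along Y (app1 \<eta> X) - app1 \<eta> (lie_bracket X Y))"

definition ext_deriv2 ::
  "('m vfield \<Rightarrow> 'm vfield \<Rightarrow> 'm \<Rightarrow> real) \<Rightarrow> 'm vfield \<Rightarrow> 'm vfield \<Rightarrow> 'm vfield \<Rightarrow> 'm \<Rightarrow> real"
where
  "ext_deriv2 \<Phi> X Y Z =
     (1/3) *\<^sub>R (deriv_along X (\<Phi> Y Z) + deriv_along Y (\<Phi> Z X) + deriv_along Z (\<Phi> X Y)
       - \<Phi> (lie_bracket X Y) Z - \<Phi> (lie_bracket Z X) Y - \<Phi> (lie_bracket Y Z) X)"

definition contact_form :: "('m, 'e::euclidean_space) atlas \<Rightarrow> nat \<Rightarrow> 'm covector \<Rightarrow> bool" where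
  "contact_form A n \<eta> \<longleftrightarrow>
     one_form A \<eta> \<and>
     (\<forall>p. \<exists>X. (\<forall>i. X i \<in> vfields A) \<and>
        wedge 1 (2 * n) (\<lambda>X. app1 \<eta> (X 0))
          (wedge_power2 (\<lambda>X. ext_deriv1 \<eta> (X 0) (X 1)) n) X p \<noteq> 0)"


section \<open>Weak almost-contact and weak quasi-contact metric structures\<close>

definition weak_almost_contact_metric ::
  "('m, 'e::euclidean_space) atlas \<Rightarrow> 'm tensor11 \<Rightarrow> 'm tensor11 \<Rightarrow> 'm vfield \<Rightarrow> 'm covector
     \<Rightarrow> 'm tensor02 \<Rightarrow> bool"
where
  "weak_almost_contact_metric A f Q \<xi> \<eta> g \<longleftrightarrow>
     tensor11 A f \<and> tensor11 A Q \<and> nonsingular A Q \<and> \<xi> \<in> vfields A \<and> one_form A \<eta> \<and>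
     riemannian_metric A g \<and>
     (\<forall>X\<in>vfields A. app11 f (app11 f X) = - app11 Q X + fscale (app1 \<eta> X) \<xi>) \<and>
     app1 \<eta> \<xi> = 1 \<and>
     (\<forall>X\<in>vfields A. \<forall>Y\<in>vfields A.
        app2 g (app11 f X) (app11 f Y) = app2 g X (app11 Q Y) - app1 \<eta> X * app1 \<eta> Y) \<and>
     (\<forall>X\<in>vfields A. app1 \<eta> X = app2 g \<xi> X)"

definition tensor_h :: "'m tensor11 \<Rightarrow> 'm vfield \<Rightarrow> 'm vfield \<Rightarrow> 'm vfield"
  where "tensor_h f \<xi> X = (1/2) *\<^sub>R lie_deriv11 \<xi> f X"

definition weak_quasi_contact_metric ::
  "('m, 'e::euclidean_space) atlas \<Rightarrow> 'm tensor11 \<Rightarrow> 'm tensor11 \<Rightarrow> 'm vfield \<Rightarrow> 'm covector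
     \<Rightarrow> 'm tensor02 \<Rightarrow> 'm connection \<Rightarrow> bool"
where
  "weak_quasi_contact_metric A f Q \<xi> \<eta> g D \<longleftrightarrow>
     weak_almost_contact_metric A f Q \<xi> \<eta> g \<and>
     levi_civita A g D \<and>
     (\<forall>X\<in>vfields A. \<forall>Y\<in>vfields A.
        cov_deriv11 D X f Y + cov_deriv11 D (app11 f X) f (app11 f Y)
        = fscale (2 * app2 g X Y) \<xi>
          - fscale (app1 \<eta> Y) (X + tensor_h f \<xi> X + fscale (app1 \<eta> X) \<xi>))"

definition fund_form :: "'m tensor11 \<Rightarrow> 'm tensor02 \<Rightarrow> 'm vfield \<Rightarrow> 'm vfield \<Rightarrow> 'm \<Rightarrow> real"
  where "fund_form f g X Y = app2 g X (app11 f Y)"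

end

theory Submission
  imports Defs
begin

text \<open>Write \<open>f, Q, h\<close> for the tensors of the structure, \<open>g\<close> for the metric and \<open>B X = \<nabla>\<^sub>X \<xi>\<close>.

  The first step is \<open>f \<xi> = 0\<close>. The algebraic axioms give \<open>g(f X, f Y) = - g(X, f (f Y))\<close>, which
  forces \<open>f\<close> to be skew; in odd dimension a skew map has a kernel vector \<open>\<zeta>\<close>, and after scaling
  \<open>\<eta>(\<zeta>) = 1\<close>. At \<open>X = Y = \<zeta>\<close> the quasi-contact identity, paired with \<open>\<zeta>\<close>, says \<open>|\<zeta>| = 1\<close>, and
  a unit vector with \<open>g(\<xi>, \<zeta>) = 1\<close> is \<open>\<xi>\<close>. From here the identity yields \<open>\<nabla>\<^sub>\<xi> f = 0\<close>,
  \<open>\<nabla>\<^sub>\<xi> \<xi> = 0\<close> and, comparing its value at \<open>Y = \<xi>\<close> with the definition of \<open>h\<close>,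
  \<open>Q B X = B Q X = - f X - f h X\<close> and \<open>h f = - f h\<close> (\<open>Q_nabla_xi\<close>, \<open>nabla_Q_xi\<close>, \<open>H_F\<close>). If \<open>h\<close> is
  self-adjoint then \<open>f h\<close> is symmetric, so only \<open>- f\<close> survives in the skew part, and
  \<open>d\<eta>(X, Q Y) = g(X, f Y) = \<Phi>(X, Y)\<close> (\<open>ext_deriv1_eta_Q\<close>). As \<open>Q\<close> is bijective and the kernel of \<open>f\<close> is
  spanned by \<open>\<xi>\<close>, the radical of \<open>d\<eta>\<close> is spanned by \<open>\<xi>\<close>: hence \<open>\<eta>\<close> is contact, which is seen by
  evaluating \<open>\<eta> \<and> (d\<eta>)\<^sup>n\<close> on \<open>\<xi>\<close> followed by a symplectic basis (\<open>wedge_nonzero_of_symplectic_frame\<close>).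

  For \<open>d\<Phi> = 0\<close>, put \<open>w(X, Y, Z) = (\<nabla>\<^sub>X d\<eta>)(Y, Z)\<close>. The cyclic sum of \<open>w\<close> is a multiple of
  \<open>d(d\<eta>) = 0\<close>. Where \<open>\<nabla> Q\<close> vanishes, that is on \<open>ker \<eta>\<close>, the relation \<open>\<Phi> = d\<eta>(\<cdot>, Q \<cdot>)\<close> gives
  \<open>(\<nabla>\<^sub>X \<Phi>)(Y, Z) = w(X, Y, Q Z) = w(X, Q Y, Z)\<close>. If \<open>Q\<close> is diagonalised, this means that \<open>w\<close>
  vanishes unless its last two arguments belong to the same eigenvalue; cyclicity then leaves only
  the case of three equal eigenvalues, where \<open>d\<Phi>\<close> is a multiple of the cyclic sum of \<open>w\<close>. The proof
  below uses an equivalent argument without eigenvectors (\<open>trilinear_cyclic\<close>). The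
  components of \<open>d\<Phi>\<close> along \<open>\<xi>\<close> vanish because \<open>(\<nabla>\<^sub>X \<Phi>)(Y, \<xi>)\<close> is symmetric in \<open>X\<close> and \<open>Y\<close>.

  These arguments are linear algebra in one tangent space, whereas the tensors are given by their
  action on vector fields. The bridge consists of three facts: the derivations at a point form a
  space of the dimension of the manifold (\<open>tangent_space_iso\<close>), every tangent vector extends to a
  vector field (\<open>tangent_extension\<close>), and a map on vector fields that is linear over the smooth
  functions depends at a point on the value of the field there only (\<open>tensorial_eq\<close>). They rest on bump
  functions and on Hadamard's lemma.\<close>

section \<open>Calculus of smooth functions on open sets\<close>

lemma Ck_on_cong:
  assumes "open S" "\<And>x. x \<in> S \<Longrightarrow> u x = w x"
  shows "Ck_on k S u \<longleftrightarrow> Ck_on k S w"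
  using assms(2)
proof (induction k arbitrary: u w)
  case 0
  then show ?case by (simp cong: continuous_on_cong)
next
  case (Suc k)
  have imp: "Ck_on (Suc k) S b" if ab: "\<And>x. x \<in> S \<Longrightarrow> a x = b x" and a: "Ck_on (Suc k) S a" for a b :: "'a \<Rightarrow> 'b"
  proof -
    have da: "a differentiable (at x)" if "x \<in> S" for x using a that by auto
    have eq: "frechet_derivative a (at x) = frechet_derivative b (at x)" if "x \<in> S" for x
      by (rule frechet_derivative_transform_within_open[OF da[OF that] assms(1) that ab])
    have "b differentiable (at x)" if "x \<in> S" for x
    proof -
      have "(a has_derivative frechet_derivative a (at x)) (at x)"
        using da[OF that] by (simp add: frechet_derivative_works)
      then have "(b has_derivative frechet_derivative a (at x)) (at x)"
        by (rule has_derivative_transform_within_open[OF _ assms(1) that ab])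
      then show ?thesis by (auto simp: differentiable_def)
    qed
    moreover have "Ck_on k S (\<lambda>x. frechet_derivative b (at x) v)" for v
      using a Suc.IH[of "\<lambda>x. frechet_derivative a (at x) v" "\<lambda>x. frechet_derivative b (at x) v"] eq
      by auto
    ultimately show ?thesis by simp
  qed
  show ?case using imp[of u w] imp[of w u] Suc.prems by metis
qed

lemma Ck_on_subset: "Ck_on k S u \<Longrightarrow> T \<subseteq> S \<Longrightarrow> Ck_on k T u"
  by (induction k arbitrary: u) (auto intro: continuous_on_subset)

lemma Ck_on_SucD: "Ck_on (Suc k) S u \<Longrightarrow> Ck_on k S u"
proof (induction k arbitrary: u)
  case 0
  then show ?case
    by (auto intro!: continuous_at_imp_continuous_on differentiable_imp_continuous_within)
next
  case (Suc k)
  then show ?case by (metis Ck_on.simps(2))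
qed

lemma Ck_on_imp_continuous_on: "Ck_on k S u \<Longrightarrow> continuous_on S u"
proof (induction k)
  case (Suc k)
  then show ?case using Ck_on_SucD by blast
qed simp

text \<open>Differentiability classes are defined through \<open>frechet_derivative\<close>, which is awkward to compute.
  With this rule any explicitly known derivative can be used instead.\<close>

lemma Ck_on_SucI:
  assumes "\<And>x. x \<in> S \<Longrightarrow> (u has_derivative u' x) (at x)" "open S"
    and "\<And>v. Ck_on k S (\<lambda>x. u' x v)"
  shows "Ck_on (Suc k) S u"
proof -
  have "frechet_derivative u (at x) = u' x" if "x \<in> S" for x
    using frechet_derivative_at[OF assms(1)[OF that]] by simp
  then have "Ck_on k S (\<lambda>x. frechet_derivative u (at x) v)" for v
    using Ck_on_cong[OF assms(2), of "\<lambda>x. frechet_derivative u (at x) v" "\<lambda>x. u' x v" k] assms(3) by auto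
  with assms(1) show ?thesis by (auto simp: differentiable_def)
qed

lemma Ck_on_derivative:
  assumes "Ck_on (Suc k) S u" "x \<in> S"
  shows "(u has_derivative frechet_derivative u (at x)) (at x)"
  using assms by (simp add: frechet_derivative_works)

lemma Ck_on_frechet_derivative:
  "Ck_on (Suc k) S u \<Longrightarrow> Ck_on k S (\<lambda>x. frechet_derivative u (at x) v)"
  by simp

lemma Ck_on_locally:
  assumes "open S" "\<And>x. x \<in> S \<Longrightarrow> \<exists>T. open T \<and> x \<in> T \<and> Ck_on k T u"
  shows "Ck_on k S u"
  using assms(2)
proof (induction k arbitrary: u)
  case 0
  have "isCont u x" if "x \<in> S" for x
    using 0[OF that] by (auto simp: continuous_on_eq_continuous_at)
  then show ?case by (simp add: continuous_at_imp_continuous_on)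
next
  case (Suc k)
  then show ?case by (metis Ck_on.simps(2))
qed

lemma Ck_on_const [simp]: "Ck_on k S (\<lambda>x. c)"
  by (induction k arbitrary: c) auto

lemma Ck_on_add:
  assumes "open S" "Ck_on k S u" "Ck_on k S w"
  shows "Ck_on k S (\<lambda>x. u x + w x)"
  using assms(2,3)
proof (induction k arbitrary: u w)
  case 0
  then show ?case by (auto intro: continuous_on_add)
next
  case (Suc k)
  show ?case
    by (rule Ck_on_SucI[OF has_derivative_add[OF Ck_on_derivative[OF Suc.prems(1)]
        Ck_on_derivative[OF Suc.prems(2)]] assms(1)])
      (auto intro!: Suc.IH Suc.prems[THEN Ck_on_frechet_derivative] simp del: Ck_on.simps)
qed

lemma Ck_on_mult:
  fixes u w :: "'e::real_normed_vector \<Rightarrow> real"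
  assumes "open S" "Ck_on k S u" "Ck_on k S w"
  shows "Ck_on k S (\<lambda>x. u x * w x)"
  using assms(2,3)
proof (induction k arbitrary: u w)
  case 0
  then show ?case by (auto intro: continuous_on_mult)
next
  case (Suc k)
  show ?case
    by (rule Ck_on_SucI[OF has_derivative_mult[OF Ck_on_derivative[OF Suc.prems(1)]
        Ck_on_derivative[OF Suc.prems(2)]] assms(1)])
      (auto intro!: Ck_on_add[OF assms(1)] Suc.IH Suc.prems[THEN Ck_on_frechet_derivative]
        Suc.prems[THEN Ck_on_SucD] simp del: Ck_on.simps)
qed

lemma Ck_on_bounded_linear:
  assumes "open S" "bounded_linear l" "Ck_on k S u"
  shows "Ck_on k S (\<lambda>x. l (u x))"
  using assms(3)
proof (induction k arbitrary: u)
  case 0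
  then show ?case using assms(2) by (auto intro: bounded_linear.continuous_on)
next
  case (Suc k)
  show ?case
    by (rule Ck_on_SucI[OF bounded_linear.has_derivative[OF assms(2) Ck_on_derivative[OF Suc.prems]] assms(1)])
      (auto intro: Suc.IH Ck_on_frechet_derivative[OF Suc.prems])
qed

lemma Ck_on_id: "open S \<Longrightarrow> Ck_on k S (\<lambda>x. x)"
  by (cases k) (auto intro: Ck_on_SucI[where u' = "\<lambda>x v. v", OF has_derivative_ident] simp del: Ck_on.simps(2))

lemma Ck_on_sum:
  assumes "open S" "\<And>i. i \<in> I \<Longrightarrow> Ck_on k S (u i)"
  shows "Ck_on k S (\<lambda>x. \<Sum>i\<in>I. u i x)"
proof (cases "finite I")
  case True
  then show ?thesis using assms(2)
    by (induction I) (auto intro: Ck_on_add assms(1))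
qed auto

lemma Ck_on_inverse:
  fixes u :: "'e::real_normed_vector \<Rightarrow> real"
  assumes "open S" "Ck_on k S u" "\<And>x. x \<in> S \<Longrightarrow> u x \<noteq> 0"
  shows "Ck_on k S (\<lambda>x. inverse (u x))"
  using assms(2,3)
proof (induction k arbitrary: u)
  case 0
  then show ?case by (auto intro: continuous_on_inverse)
next
  case (Suc k)
  show ?case
  proof (rule Ck_on_SucI[OF _ assms(1)])
    show "((\<lambda>x. inverse (u x)) has_derivative
        (\<lambda>v. (-1) * (inverse (u x) * frechet_derivative u (at x) v * inverse (u x)))) (at x)"
      if "x \<in> S" for x
      by (rule has_derivative_eq_rhs[OF Deriv.has_derivative_inverse[OF Suc.prems(2)[OF that] Ck_on_derivative[OF Suc.prems(1) that]]])
        (simp add: fun_eq_iff)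
    show "Ck_on k S (\<lambda>x. (-1) * (inverse (u x) * frechet_derivative u (at x) v * inverse (u x)))" for v
      by (intro Ck_on_mult Suc.IH assms(1) Ck_on_const Suc.prems(2) Ck_on_SucD[OF Suc.prems(1)]
        Ck_on_frechet_derivative[OF Suc.prems(1)])
  qed
qed

text \<open>By the chain rule \<open>D (w \<circ> T) v = (\<Sum>b. (D T v \<bullet> b) * (D w b \<circ> T))\<close>. Each summand is a product of
  a derivative of \<open>T\<close> and a composition of lower order, so that induction on the order applies. This is why
  \<open>w\<close> is arbitrary in the induction.\<close>

lemma Ck_on_compose:
  fixes T :: "'e::real_normed_vector \<Rightarrow> 'd::euclidean_space" and w :: "'d \<Rightarrow> real"
  assumes "open S" "open S'" "Ck_on k S T" "Ck_on k S' w" "T ` S \<subseteq> S'"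
  shows "Ck_on k S (\<lambda>x. w (T x))"
  using assms(3,4)
proof (induction k arbitrary: w)
  case 0
  then show ?case using assms(5) by (auto intro: continuous_on_compose2[of S' w S T])
next
  case (Suc k)
  show ?case
  proof (rule Ck_on_SucI[OF _ assms(1)])
    fix x assume x: "x \<in> S"
    then have Tx: "T x \<in> S'" using assms(5) by auto
    define w' where "w' = frechet_derivative w (at (T x))"
    have w': "(w has_derivative w') (at (T x))"
      unfolding w'_def using Suc.prems(2) Tx by (rule Ck_on_derivative)
    then have lin: "linear w'" by (rule has_derivative_linear)
    have w'_expand: "w' z = (\<Sum>b\<in>Basis. (z \<bullet> b) * w' b)" for z
    proof -
      have "w' z = w' (\<Sum>b\<in>Basis. (z \<bullet> b) *\<^sub>R b)" by (simp add: euclidean_representation)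
      also have "\<dots> = (\<Sum>b\<in>Basis. (z \<bullet> b) * w' b)"
        unfolding linear_sum[OF lin] by (simp add: linear_cmul[OF lin])
      finally show ?thesis .
    qed
    have eq: "(\<lambda>v. w' (frechet_derivative T (at x) v))
        = (\<lambda>v. \<Sum>b\<in>Basis. (frechet_derivative T (at x) v \<bullet> b) * frechet_derivative w (at (T x)) b)"
      by (rule ext, subst w'_expand) (simp add: w'_def)
    show "((\<lambda>x. w (T x)) has_derivative
        (\<lambda>v. \<Sum>b\<in>Basis. (frechet_derivative T (at x) v \<bullet> b) * frechet_derivative w (at (T x)) b)) (at x)"
      unfolding eq[symmetric]
      using diff_chain_at[OF Ck_on_derivative[OF Suc.prems(1) x] w'] by (simp add: o_def)
  next
    fix v
    have "Ck_on k S (\<lambda>x. frechet_derivative T (at x) v \<bullet> b)" for b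
      by (rule Ck_on_bounded_linear[OF assms(1) bounded_linear_inner_left])
        (rule Ck_on_frechet_derivative[OF Suc.prems(1)])
    moreover have "Ck_on k S (\<lambda>x. frechet_derivative w (at (T x)) b)" for b
      by (rule Suc.IH[OF Ck_on_SucD[OF Suc.prems(1)] Ck_on_frechet_derivative[OF Suc.prems(2)]])
    ultimately show "Ck_on k S (\<lambda>x. \<Sum>b\<in>Basis. (frechet_derivative T (at x) v \<bullet> b) * frechet_derivative w (at (T x)) b)"
      by (intro Ck_on_sum[OF assms(1)] Ck_on_mult[OF assms(1)])
  qed
qed

lemma smooth_on_cong:
  "open S \<Longrightarrow> (\<And>x. x \<in> S \<Longrightarrow> u x = w x) \<Longrightarrow> smooth_on S u \<longleftrightarrow> smooth_on S w"
  by (simp add: smooth_on_def Ck_on_cong[of S u w])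

lemma smooth_on_subset: "smooth_on S u \<Longrightarrow> T \<subseteq> S \<Longrightarrow> smooth_on T u"
  unfolding smooth_on_def using Ck_on_subset by blast

lemma smooth_on_locally:
  assumes "open S" "\<And>x. x \<in> S \<Longrightarrow> \<exists>T. open T \<and> x \<in> T \<and> smooth_on T u"
  shows "smooth_on S u"
  unfolding smooth_on_def
proof
  fix k
  show "Ck_on k S u"
    by (rule Ck_on_locally[OF assms(1)]) (meson assms(2) smooth_on_def)
qed

lemma smooth_on_const [simp]: "smooth_on S (\<lambda>x. c)"
  by (simp add: smooth_on_def)

lemma smooth_on_add: "open S \<Longrightarrow> smooth_on S u \<Longrightarrow> smooth_on S w \<Longrightarrow> smooth_on S (\<lambda>x. u x + w x)"
  by (simp add: smooth_on_def Ck_on_add)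

lemma smooth_on_mult:
  fixes u w :: "'e::real_normed_vector \<Rightarrow> real"
  shows "open S \<Longrightarrow> smooth_on S u \<Longrightarrow> smooth_on S w \<Longrightarrow> smooth_on S (\<lambda>x. u x * w x)"
  by (simp add: smooth_on_def Ck_on_mult)

lemma smooth_on_inverse:
  fixes u :: "'e::real_normed_vector \<Rightarrow> real"
  shows "open S \<Longrightarrow> smooth_on S u \<Longrightarrow> (\<And>x. x \<in> S \<Longrightarrow> u x \<noteq> 0) \<Longrightarrow> smooth_on S (\<lambda>x. inverse (u x))"
  by (simp add: smooth_on_def Ck_on_inverse)

lemma smooth_on_bounded_linear: "open S \<Longrightarrow> bounded_linear l \<Longrightarrow> smooth_on S l"
  using Ck_on_bounded_linear[OF _ _ Ck_on_id] by (auto simp: smooth_on_def)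

lemma smooth_on_compose:
  fixes T :: "'e::real_normed_vector \<Rightarrow> 'd::euclidean_space" and w :: "'d \<Rightarrow> real"
  shows "open S \<Longrightarrow> open S' \<Longrightarrow> smooth_on S T \<Longrightarrow> smooth_on S' w \<Longrightarrow> T ` S \<subseteq> S' \<Longrightarrow>
    smooth_on S (\<lambda>x. w (T x))"
  by (simp add: smooth_on_def Ck_on_compose)

lemma smooth_on_frechet_derivative:
  assumes "smooth_on S u"
  shows "smooth_on S (\<lambda>x. frechet_derivative u (at x) v)"
  using assms unfolding smooth_on_def by (metis Ck_on.simps(2))

lemma smooth_on_has_derivative:
  assumes "smooth_on S u" "x \<in> S"
  shows "(u has_derivative frechet_derivative u (at x)) (at x)"
  using assms Ck_on_derivative unfolding smooth_on_def by blast

section \<open>Bump functions\<close>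

text \<open>The class of functions \<open>t\<^sup>-\<^sup>k exp(-1/t)\<close>, extended by zero to \<open>t \<le> 0\<close>, is closed under
  differentiation up to linear combinations. This gives smoothness of \<open>exp(-1/t)\<close> in one induction.\<close>

definition flat_exp :: "nat \<Rightarrow> real \<Rightarrow> real"
  where "flat_exp k t = (if t > 0 then inverse t ^ k * exp (- inverse t) else 0)"

lemma flat_exp_tendsto_0: "(flat_exp k \<longlongrightarrow> 0) (at 0)"
proof -
  have "((\<lambda>t. inverse t ^ k / exp (inverse t)) \<longlongrightarrow> (0::real)) (at_right 0)"
    by (rule filterlim_compose[OF tendsto_power_div_exp_0 filterlim_inverse_at_top_right])
  moreover have "eventually (\<lambda>t. flat_exp k t = inverse t ^ k / exp (inverse t)) (at_right 0)"
    unfolding eventually_at_filter by (rule always_eventually) (auto simp: flat_exp_def exp_minus divide_inverse)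
  ultimately have right: "(flat_exp k \<longlongrightarrow> 0) (at_right 0)"
    using tendsto_cong by fastforce
  have "eventually (\<lambda>t. flat_exp k t = 0) (at_left 0)"
    unfolding eventually_at_filter by (rule always_eventually) (auto simp: flat_exp_def)
  then have left: "(flat_exp k \<longlongrightarrow> 0) (at_left 0)"
    by (rule tendsto_eventually)
  show ?thesis using left right by (simp add: filterlim_split_at)
qed

lemma flat_exp_has_derivative:
  "(flat_exp k has_real_derivative (flat_exp (k + 2) t - real k * flat_exp (k + 1) t)) (at t)"
proof (cases t "0::real" rule: linorder_cases)
  case less
  have "((\<lambda>_. 0) has_real_derivative (flat_exp (k + 2) t - real k * flat_exp (k + 1) t)) (at t)"
    using less by (auto simp: flat_exp_def)
  then show ?thesis
    by (rule has_field_derivative_transform_within_open[of _ _ _ "{..<0}"])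
      (use less in \<open>auto simp: flat_exp_def\<close>)
next
  case equal
  have "(\<lambda>h. (flat_exp k (0 + h) - flat_exp k 0) / h) = flat_exp (Suc k)"
    by (auto simp: fun_eq_iff flat_exp_def field_simps)
  then have "(flat_exp k has_real_derivative 0) (at 0)"
    unfolding DERIV_def using flat_exp_tendsto_0[of "Suc k"] by simp
  then show ?thesis using equal by (simp add: flat_exp_def)
next
  case greater
  have D: "((\<lambda>t. inverse t) has_real_derivative - (inverse t * inverse t)) (at t)"
    using DERIV_inverse[of t UNIV] greater by (simp add: power2_eq_square)
  have "((\<lambda>t. exp (- inverse t)) has_real_derivative exp (- inverse t) * (inverse t * inverse t)) (at t)"
    using DERIV_fun_exp[OF DERIV_minus[OF D]] by simp
  from DERIV_mult'[OF DERIV_power[OF D, of k] this]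
  have "((\<lambda>t. inverse t ^ k * exp (- inverse t)) has_real_derivative
      (flat_exp (k + 2) t - real k * flat_exp (k + 1) t)) (at t)"
    using greater
    by (cases k) (simp_all add: flat_exp_def algebra_simps)
  then show ?thesis
    by (rule has_field_derivative_transform_within_open[of _ _ _ "{0<..}"])
      (use greater in \<open>auto simp: flat_exp_def\<close>)
qed

lemma smooth_on_flat_exp: "smooth_on S (flat_exp k)"
proof -
  have "Ck_on j UNIV (flat_exp k)" for j
  proof (induction j arbitrary: k)
    case 0
    then show ?case using flat_exp_has_derivative
      by (auto intro!: continuous_at_imp_continuous_on DERIV_isCont)
  next
    case (Suc j)
    show ?case
    proof (rule Ck_on_SucI)
      show "(flat_exp k has_derivative
          (\<lambda>v. (flat_exp (k + 2) t + (- real k) * flat_exp (k + 1) t) * v)) (at t)" for t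
        using flat_exp_has_derivative[of k t] by (simp add: has_field_derivative_def)
      show "Ck_on j UNIV (\<lambda>t. (flat_exp (k + 2) t + (- real k) * flat_exp (k + 1) t) * v)" for v
        by (intro Ck_on_mult Ck_on_add Suc.IH Ck_on_const open_UNIV)
    qed auto
  qed
  then show ?thesis using smooth_on_subset[of UNIV _ S] by (auto simp: smooth_on_def)
qed

text \<open>The quotient \<open>N / (N + K)\<close>, where \<open>N\<close> vanishes at distance at least \<open>2 * r\<close> from \<open>a\<close> and \<open>K\<close> at
  distance at most \<open>r\<close>, both being positive elsewhere, is a plateau function;
  the denominator has no zeros since \<open>r < 2 * r\<close>.\<close>

lemma exists_bump_function:
  fixes a :: "'e::euclidean_space"
  assumes "0 < r"
  obtains B :: "'e \<Rightarrow> real" where "smooth_on UNIV B"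
    "\<And>x. x \<in> cball a r \<Longrightarrow> B x = 1" "\<And>x. x \<notin> cball a (2 * r) \<Longrightarrow> B x = 0"
proof -
  define n where "n x = (x - a) \<bullet> (x - a)" for x
  define N where "N x = flat_exp 0 ((2 * r)\<^sup>2 - n x)" for x
  define K where "K x = flat_exp 0 (n x - r\<^sup>2)" for x
  define B where "B x = N x * inverse (N x + K x)" for x
  have n: "n x = (dist a x)\<^sup>2" for x
    by (simp add: n_def dist_norm power2_norm_eq_inner inner_diff_left inner_diff_right inner_commute)
  have pos: "flat_exp 0 t > 0 \<longleftrightarrow> t > 0" "flat_exp 0 t \<ge> 0" "flat_exp 0 t = 0 \<longleftrightarrow> t \<le> 0" for t
    by (auto simp: flat_exp_def)
  have comp: "smooth_on UNIV (\<lambda>x. (x - a) \<bullet> b)" for b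
    using smooth_on_add[OF open_UNIV smooth_on_bounded_linear[OF open_UNIV bounded_linear_inner_left[of b]]
      smooth_on_const[of UNIV "- (a \<bullet> b)"]] by (simp add: inner_diff_left)
  have "n = (\<lambda>x. \<Sum>b\<in>Basis. ((x - a) \<bullet> b) * ((x - a) \<bullet> b))"
    unfolding n_def by (subst euclidean_inner) simp
  moreover have "smooth_on UNIV (\<lambda>x. \<Sum>b\<in>Basis. ((x - a) \<bullet> b) * ((x - a) \<bullet> b))"
    using comp by (auto simp: smooth_on_def intro!: Ck_on_sum Ck_on_mult)
  ultimately have sn: "smooth_on UNIV n" by simp
  have cn: "smooth_on UNIV (\<lambda>x. flat_exp 0 (c * n x + d))" for c d
    by (rule smooth_on_compose[OF open_UNIV open_UNIV _ smooth_on_flat_exp])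
      (auto intro!: smooth_on_add smooth_on_mult sn)
  have sN: "smooth_on UNIV N" using cn[of "-1" "(2 * r)\<^sup>2"] by (simp add: N_def[abs_def] algebra_simps)
  have sK: "smooth_on UNIV K" using cn[of 1 "- r\<^sup>2"] by (simp add: K_def[abs_def] algebra_simps)
  have "N x + K x \<noteq> 0" for x
  proof -
    have "r\<^sup>2 < (2 * r)\<^sup>2" using assms by (simp add: power_mult_distrib)
    then have "(2 * r)\<^sup>2 - n x > 0 \<or> n x - r\<^sup>2 > 0" by linarith
    then have "N x > 0 \<or> K x > 0" unfolding N_def K_def pos(1) .
    moreover have "N x \<ge> 0" "K x \<ge> 0" unfolding N_def K_def by (rule pos(2))+
    ultimately show ?thesis by linarith
  qed
  then have "smooth_on UNIV B" unfolding B_def[abs_def]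
    by (intro smooth_on_mult smooth_on_inverse smooth_on_add sN sK) auto
  moreover have "B x = 1" if "x \<in> cball a r" for x
  proof -
    have "n x \<le> r\<^sup>2" using that by (auto simp: n intro: power_mono)
    moreover have "r\<^sup>2 < (2 * r)\<^sup>2" using assms by (simp add: power_mult_distrib)
    ultimately have "n x - r\<^sup>2 \<le> 0" "(2 * r)\<^sup>2 - n x > 0" by linarith+
    then have "K x = 0" "N x > 0" unfolding K_def N_def pos .
    then show ?thesis by (simp add: B_def)
  qed
  moreover have "B x = 0" if "x \<notin> cball a (2 * r)" for x
  proof -
    have "(2 * r)\<^sup>2 \<le> n x" unfolding n using that assms by (intro power_mono) auto
    then have "N x = 0" by (auto simp: N_def pos)
    then show ?thesis by (simp add: B_def)
  qed
  ultimately show thesis by (rule that)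
qed

section \<open>Hadamard's lemma\<close>

text \<open>Differentiation under the integral sign: the derivative in direction \<open>v\<close> has the same form with
  \<open>t\<^sup>m\<^sup>+\<^sup>1\<close> and \<open>D u v\<close> in place of \<open>t\<^sup>m\<close> and \<open>u\<close>. The weight \<open>t\<^sup>m\<close> is there to make the
  induction on \<open>k\<close> possible.\<close>

lemma Ck_on_integral_ray:
  fixes u :: "'e::euclidean_space \<Rightarrow> real"
  assumes "open S" "convex S" "a \<in> S" "Ck_on k S u"
  shows "Ck_on k S (\<lambda>x. integral {0..1} (\<lambda>t. t ^ m * u (a + t *\<^sub>R (x - a))))"
proof -
  have ray: "a + t *\<^sub>R (x - a) \<in> S" if "x \<in> S" "0 \<le> t" "t \<le> 1" for x t
    using convexD[OF assms(2) assms(3) that(1), of "1 - t" t] that by (simp add: algebra_simps)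
  have cray: "continuous_on (S \<times> cbox 0 1) (\<lambda>z. snd z ^ j * w (a + snd z *\<^sub>R (fst z - a)))"
    if "continuous_on S w" for w :: "'e \<Rightarrow> real" and j
  proof -
    have "continuous_on (S \<times> cbox 0 1) (\<lambda>z. a + snd z *\<^sub>R (fst z - a))"
      by (intro continuous_intros)
    then have "continuous_on (S \<times> cbox 0 1) (\<lambda>z. w (a + snd z *\<^sub>R (fst z - a)))"
      by (rule continuous_on_compose2[OF that]) (auto simp: ray)
    then show ?thesis by (intro continuous_on_mult continuous_on_power continuous_on_snd continuous_on_id)
  qed
  show ?thesis using assms(4)
proof (induction k arbitrary: u m)
  case 0
  have "continuous_on (S \<times> cbox 0 1) (\<lambda>(x, t). t ^ m * u (a + t *\<^sub>R (x - a)))"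
    using cray[of u m] 0 by (simp add: split_beta)
  from integral_continuous_on_param[OF this] show ?case by simp
next
  case (Suc k)
  define F where "F x t = t ^ m * u (a + t *\<^sub>R (x - a))" for x t
  define u' where "u' x = frechet_derivative u (at x)" for x
  define F' where "F' x t = Blinfun (\<lambda>v. t ^ (Suc m) * u' (a + t *\<^sub>R (x - a)) v)" for x t
  have du: "(u has_derivative u' x) (at x)" if "x \<in> S" for x
    unfolding u'_def using Suc.prems that by (rule Ck_on_derivative)
  have F': "blinfun_apply (F' x t) = (\<lambda>v. t ^ (Suc m) * u' (a + t *\<^sub>R (x - a)) v)"
    if "x \<in> S" "t \<in> {0..1}" for x t
  proof -
    have "bounded_linear (u' (a + t *\<^sub>R (x - a)))"
      using du[OF ray] that by (auto intro: has_derivative_bounded_linear)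
    then have "bounded_linear (\<lambda>v. t ^ (Suc m) * u' (a + t *\<^sub>R (x - a)) v)"
      by (intro bounded_linear_intros)
    then show ?thesis unfolding F'_def by (rule bounded_linear_Blinfun_apply)
  qed
  have cu: "continuous_on S u" "\<And>v. continuous_on S (\<lambda>x. u' x v)"
    unfolding u'_def
    by (rule Ck_on_imp_continuous_on[OF Suc.prems])
      (rule Ck_on_imp_continuous_on[OF Ck_on_frechet_derivative[OF Suc.prems]])
  have cF: "continuous_on (S \<times> cbox 0 1) (\<lambda>(x, t). F' x t)"
  proof (rule continuous_on_blinfun_componentwise)
    fix v :: 'e
    have "continuous_on (S \<times> cbox 0 1) (\<lambda>z. snd z ^ Suc m * u' (a + snd z *\<^sub>R (fst z - a)) v)"
      by (rule cray[OF cu(2)])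
    then show "continuous_on (S \<times> cbox 0 1) (\<lambda>z. blinfun_apply (case z of (x, t) \<Rightarrow> F' x t) v)"
      by (rule continuous_on_eq) (auto simp: F')
  qed
  have int: "F x integrable_on cbox 0 1" if "x \<in> S" for x
  proof (rule integrable_continuous)
    have "continuous_on (cbox 0 1) (\<lambda>t. (x, t))" by (intro continuous_intros)
    from continuous_on_compose2[OF cray[OF cu(1), of m] this] show "continuous_on (cbox 0 1) (F x)"
      using that by (auto simp: F_def[abs_def])
  qed
  have DF: "((\<lambda>x. F x t) has_derivative blinfun_apply (F' x t)) (at x within S)"
    if "x \<in> S" "t \<in> cbox 0 1" for x t
  proof -
    have d: "((\<lambda>x. u (a + t *\<^sub>R (x - a))) has_derivative (\<lambda>v. u' (a + t *\<^sub>R (x - a)) (t *\<^sub>R v))) (at x)"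
      using ray[of x t] that
      by (intro has_derivative_compose[of "\<lambda>x. a + t *\<^sub>R (x - a)" "\<lambda>v. t *\<^sub>R v", OF _ du])
        (auto intro!: derivative_eq_intros)
    have "linear (u' (a + t *\<^sub>R (x - a)))"
      using du[OF ray] that by (auto intro: has_derivative_linear)
    note cmul = linear_cmul[OF this]
    from has_derivative_mult_right[OF d, of "t ^ m"]
    have "((\<lambda>x. F x t) has_derivative blinfun_apply (F' x t)) (at x)"
      using that by (simp add: F_def F' cmul mult_ac)
    then show ?thesis by (rule has_derivative_at_withinI)
  qed
  have deriv: "((\<lambda>x. integral {0..1} (F x)) has_derivative
      (\<lambda>v. integral {0..1} (\<lambda>t. t ^ Suc m * u' (a + t *\<^sub>R (x - a)) v))) (at x)" if x: "x \<in> S" for x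
  proof -
    have "((\<lambda>x. integral (cbox 0 1) (F x)) has_derivative integral (cbox 0 1) (F' x)) (at x within S)"
      by (rule leibniz_rule[OF DF int cF x assms(2)])
    moreover have "F' x integrable_on cbox 0 1"
    proof (rule integrable_continuous)
      have "continuous_on (cbox 0 1) (\<lambda>t. (x, t))" by (intro continuous_intros)
      from continuous_on_compose2[OF cF this] show "continuous_on (cbox 0 1) (F' x)"
        using x by auto
    qed
    from blinfun_apply_integral[OF this]
    have "blinfun_apply (integral (cbox 0 1) (F' x)) v = integral {0..1} (\<lambda>t. t ^ Suc m * u' (a + t *\<^sub>R (x - a)) v)" for v
      using x by (auto simp: F' intro!: integral_cong)
    then have "blinfun_apply (integral (cbox 0 1) (F' x))
        = (\<lambda>v. integral {0..1} (\<lambda>t. t ^ Suc m * u' (a + t *\<^sub>R (x - a)) v))" ..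
    ultimately show ?thesis using at_within_open[OF x assms(1)] by simp
  qed
  have "Ck_on (Suc k) S (\<lambda>x. integral {0..1} (F x))"
  proof (rule Ck_on_SucI[OF deriv assms(1)])
    show "Ck_on k S (\<lambda>x. integral {0..1} (\<lambda>t. t ^ Suc m * u' (a + t *\<^sub>R (x - a)) v))" for v
      unfolding u'_def by (rule Suc.IH[OF Ck_on_frechet_derivative[OF Suc.prems]])
  qed
  then show ?case unfolding F_def .
qed
qed

text \<open>The fundamental theorem of calculus along the ray from \<open>a\<close> to \<open>x\<close>. The coefficients are the
  averages of the partial derivatives over this ray, hence smooth.\<close>

lemma Hadamard:
  fixes u :: "'e::euclidean_space \<Rightarrow> real"
  assumes "open S" "convex S" "a \<in> S" "smooth_on S u"
  obtains G where "\<And>b. smooth_on S (G b)"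
    "\<And>x. x \<in> S \<Longrightarrow> u x = u a + (\<Sum>b\<in>Basis. ((x - a) \<bullet> b) * G b x)"
    "\<And>b. G b a = frechet_derivative u (at a) b"
proof -
  define u' where "u' x = frechet_derivative u (at x)" for x
  define G where "G b x = integral {0..1} (\<lambda>t. t ^ 0 * u' (a + t *\<^sub>R (x - a)) b)" for b x
  have du: "(u has_derivative u' x) (at x)" if "x \<in> S" for x
    unfolding u'_def using assms(4) that by (rule smooth_on_has_derivative)
  have cu: "continuous_on S (\<lambda>x. u' x v)" for v
    by (rule Ck_on_imp_continuous_on[of 0])
      (use smooth_on_frechet_derivative[OF assms(4), of v] in \<open>auto simp: u'_def smooth_on_def simp del: Ck_on.simps\<close>)
  have ray: "a + t *\<^sub>R (x - a) \<in> S" if "x \<in> S" "0 \<le> t" "t \<le> 1" for x t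
    using convexD[OF assms(2) assms(3) that(1), of "1 - t" t] that by (simp add: algebra_simps)
  have 1: "smooth_on S (G b)" for b
    unfolding smooth_on_def G_def[abs_def]
    using Ck_on_integral_ray[OF assms(1-3)] smooth_on_frechet_derivative[OF assms(4), of b]
    unfolding smooth_on_def u'_def by blast
  have 2: "u x = u a + (\<Sum>b\<in>Basis. ((x - a) \<bullet> b) * G b x)" if x: "x \<in> S" for x
  proof -
    have lin: "u' (a + t *\<^sub>R (x - a)) (x - a) = (\<Sum>b\<in>Basis. ((x - a) \<bullet> b) * u' (a + t *\<^sub>R (x - a)) b)"
      if "t \<in> {0..1}" for t
    proof -
      have "linear (u' (a + t *\<^sub>R (x - a)))"
        using du[OF ray] that x by (auto intro: has_derivative_linear)
      note L = this
      have "u' (a + t *\<^sub>R (x - a)) (x - a)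
          = u' (a + t *\<^sub>R (x - a)) (\<Sum>b\<in>Basis. ((x - a) \<bullet> b) *\<^sub>R b)"
        by (simp add: euclidean_representation)
      also have "\<dots> = (\<Sum>b\<in>Basis. ((x - a) \<bullet> b) * u' (a + t *\<^sub>R (x - a)) b)"
        unfolding linear_sum[OF L] by (simp add: linear_cmul[OF L])
      finally show ?thesis .
    qed
    have "((\<lambda>t. u' (a + t *\<^sub>R (x - a)) (x - a)) has_integral (u (a + 1 *\<^sub>R (x - a)) - u (a + 0 *\<^sub>R (x - a)))) {0..1}"
    proof (rule fundamental_theorem_of_calculus)
      fix t :: real assume t: "t \<in> {0..1}"
      have "((\<lambda>t. u (a + t *\<^sub>R (x - a))) has_derivative (\<lambda>s. u' (a + t *\<^sub>R (x - a)) (s *\<^sub>R (x - a)))) (at t)"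
        using ray[of x t] t x
        by (intro has_derivative_compose[of "\<lambda>t. a + t *\<^sub>R (x - a)" "\<lambda>s. s *\<^sub>R (x - a)", OF _ du])
          (auto intro!: derivative_eq_intros)
      moreover have "linear (u' (a + t *\<^sub>R (x - a)))"
        using du[OF ray] t x by (auto intro: has_derivative_linear)
      ultimately show "((\<lambda>t. u (a + t *\<^sub>R (x - a))) has_vector_derivative u' (a + t *\<^sub>R (x - a)) (x - a)) (at t within {0..1})"
        by (simp add: has_vector_derivative_def linear_cmul has_derivative_at_withinI)
    qed simp
    then have "u x - u a = integral {0..1} (\<lambda>t. u' (a + t *\<^sub>R (x - a)) (x - a))"
      by (simp add: integral_unique)
    also have "\<dots> = integral {0..1} (\<lambda>t. \<Sum>b\<in>Basis. ((x - a) \<bullet> b) * u' (a + t *\<^sub>R (x - a)) b)"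
      by (rule integral_cong) (rule lin)
    also have "\<dots> = (\<Sum>b\<in>Basis. ((x - a) \<bullet> b) * G b x)"
    proof -
      have "(\<lambda>t. u' (a + t *\<^sub>R (x - a)) b) integrable_on {0..1}" for b
      proof (rule integrable_continuous_real)
        have "continuous_on {0..1} (\<lambda>t. a + t *\<^sub>R (x - a))" by (intro continuous_intros)
        then show "continuous_on {0..1} (\<lambda>t. u' (a + t *\<^sub>R (x - a)) b)"
          by (rule continuous_on_compose2[OF cu]) (use ray x in auto)
      qed
      then show ?thesis
        by (subst integral_sum) (auto simp: G_def intro!: integrable_on_mult_right)
    qed
    finally show ?thesis by simp
  qed
  have 3: "G b a = u' a b" for b by (simp add: G_def)
  show thesis using that[of G] 1 2 3 by (simp add: u'_def)
qed

section \<open>Smooth functions, tangent vectors and vector fields on a manifold\<close>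

lemma smooth_on_mult_cutoff:
  fixes B w :: "'e::euclidean_space \<Rightarrow> real"
  assumes "smooth_on UNIV B" "open S" "smooth_on S w" "closed K" "K \<subseteq> S" "\<And>x. x \<notin> K \<Longrightarrow> B x = 0"
  shows "smooth_on UNIV (\<lambda>x. B x * w x)"
proof (rule smooth_on_locally[OF open_UNIV])
  fix x :: 'e
  show "\<exists>T. open T \<and> x \<in> T \<and> smooth_on T (\<lambda>x. B x * w x)"
  proof (cases "x \<in> S")
    case True
    then show ?thesis
      using smooth_on_mult[OF assms(2) smooth_on_subset[OF assms(1) subset_UNIV] assms(3)] assms(2) by blast
  next
    case False
    have "smooth_on (- K) (\<lambda>x. B x * w x)"
      by (rule smooth_on_cong[OF open_Compl[OF assms(4)], THEN iffD2, OF _ smooth_on_const[of _ 0]])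
        (simp add: assms(6))
    moreover have "x \<in> - K" using False assms(5) by blast
    ultimately show ?thesis using open_Compl[OF assms(4)] by (intro exI[of _ "- K"] conjI)
  qed
qed

lemma scaleR_fun_apply [simp]: "(c *\<^sub>R u) x = c *\<^sub>R u x"
  by (simp add: scaleR_fun_def)

locale smooth_atlas =
  fixes A :: "('m::{t2_space, second_countable_topology}, 'e::euclidean_space) atlas"
  assumes smooth_manifold: "smooth_manifold A"
begin

abbreviation "TM \<equiv> tangent_space A"
abbreviation "VF \<equiv> vfields A"
abbreviation "smooth \<equiv> smooth_fun A"

lemma chart_at: obtains U \<phi> where "(U, \<phi>) \<in> A" "p \<in> U"
proof -
  have "p \<in> (\<Union>(U, \<phi>)\<in>A. U)" using smooth_manifold unfolding smooth_manifold_def by simp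
  then show thesis using that by blast
qed

lemma chart_open: "(U, \<phi>) \<in> A \<Longrightarrow> open U" "(U, \<phi>) \<in> A \<Longrightarrow> open (\<phi> ` U)"
  and chart_homeomorphism: "(U, \<phi>) \<in> A \<Longrightarrow> homeomorphism U (\<phi> ` U) \<phi> (inv_into U \<phi>)"
  using smooth_manifold[unfolded smooth_manifold_def, THEN conjunct2, THEN conjunct1] by auto

lemma chart_inv [simp]: "(U, \<phi>) \<in> A \<Longrightarrow> q \<in> U \<Longrightarrow> inv_into U \<phi> (\<phi> q) = q"
  using chart_homeomorphism homeomorphism_apply1 by blast

lemma transition_smooth:
  "(U, \<phi>) \<in> A \<Longrightarrow> (V, \<psi>) \<in> A \<Longrightarrow> smooth_on (\<phi> ` (U \<inter> V)) (\<psi> \<circ> inv_into U \<phi>)"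
  using smooth_manifold[unfolded smooth_manifold_def, THEN conjunct2, THEN conjunct2] by fastforce

lemma chart_image_open:
  assumes "(U, \<phi>) \<in> A" "open W" "W \<subseteq> U"
  shows "open (\<phi> ` W)"
proof -
  have "openin (top_of_set U) W" using assms chart_open by (simp add: openin_open_eq)
  then have "openin (top_of_set (\<phi> ` U)) (\<phi> ` W)"
    using homeomorphism_imp_open_map[OF chart_homeomorphism[OF assms(1)]] by blast
  then show ?thesis using chart_open(2)[OF assms(1)] openin_open_eq by blast
qed

lemma smooth_funI:
  "(\<And>U \<phi>. (U, \<phi>) \<in> A \<Longrightarrow> smooth_on (\<phi> ` U) (u \<circ> inv_into U \<phi>)) \<Longrightarrow> smooth u"
  unfolding smooth_fun_def by blast

lemma smooth_funD: "smooth u \<Longrightarrow> (U, \<phi>) \<in> A \<Longrightarrow> smooth_on (\<phi> ` U) (u \<circ> inv_into U \<phi>)"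
  unfolding smooth_fun_def by blast

lemma smooth_const [simp]: "smooth (\<lambda>p. c)" "smooth 0" "smooth 1"
proof -
  show 1: "smooth (\<lambda>p. c)" for c by (rule smooth_funI) (simp add: o_def)
  show "smooth 0" using 1[of 0] by (simp add: zero_fun_def)
  show "smooth 1" using 1[of 1] by (simp add: one_fun_def)
qed

lemma smooth_add [simp]:
  assumes "smooth u" "smooth w" shows "smooth (u + w)"
proof (rule smooth_funI)
  fix U \<phi> assume c: "(U, \<phi>) \<in> A"
  from smooth_on_add[OF chart_open(2)[OF c] smooth_funD[OF assms(1) c] smooth_funD[OF assms(2) c]]
  show "smooth_on (\<phi> ` U) ((u + w) \<circ> inv_into U \<phi>)" by (simp add: o_def)
qed

lemma smooth_mult [simp]:
  assumes "smooth u" "smooth w" shows "smooth (u * w)"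
proof (rule smooth_funI)
  fix U \<phi> assume c: "(U, \<phi>) \<in> A"
  from smooth_on_mult[OF chart_open(2)[OF c] smooth_funD[OF assms(1) c] smooth_funD[OF assms(2) c]]
  show "smooth_on (\<phi> ` U) ((u * w) \<circ> inv_into U \<phi>)" by (simp add: o_def)
qed

lemma smooth_scaleR [simp]: "smooth u \<Longrightarrow> smooth (c *\<^sub>R u)"
  using smooth_mult[OF smooth_const(1)[of c], of u] by (simp add: times_fun_def scaleR_fun_def)

lemma smooth_uminus [simp]: "smooth u \<Longrightarrow> smooth (- u)"
  using smooth_scaleR[of u "-1"] by simp

lemma smooth_diff [simp]: "smooth u \<Longrightarrow> smooth w \<Longrightarrow> smooth (u - w)"
  using smooth_add[of u "- w"] by simp

lemma smooth_sum: "(\<And>i. i \<in> I \<Longrightarrow> smooth (u i)) \<Longrightarrow> smooth (sum u I)"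
  by (induction I rule: infinite_finite_induct) auto

text \<open>Functions with compact support in the image of one chart are smooth in every other chart: near
  points of \<open>U\<close> this is smoothness of the transition maps, and away from \<open>U\<close> the function vanishes on
  the open complement of the support, which is closed in the Hausdorff space \<open>'m\<close>.\<close>

lemma smooth_fun_of_chart:
  assumes A: "(U, \<phi>) \<in> A" and K: "compact K" "K \<subseteq> \<phi> ` U"
    and w: "smooth_on (\<phi> ` U) w" "\<And>x. x \<in> \<phi> ` U \<Longrightarrow> x \<notin> K \<Longrightarrow> w x = 0"
  shows "smooth (\<lambda>q. if q \<in> U then w (\<phi> q) else 0)" (is "smooth ?h")
proof (rule smooth_funI)
  fix V \<psi> assume B: "(V, \<psi>) \<in> A"
  let ?K = "inv_into U \<phi> ` K"
  have "continuous_on (\<phi> ` U) (inv_into U \<phi>)"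
    using chart_homeomorphism[OF A] by (rule homeomorphism_cont2)
  from compact_continuous_image[OF continuous_on_subset[OF this K(2)] K(1)]
  have clK: "closed ?K" by (rule compact_imp_closed)
  have KU: "?K \<subseteq> U" using K(2) by (auto intro: inv_into_into)
  show "smooth_on (\<psi> ` V) (?h \<circ> inv_into V \<psi>)"
  proof (rule smooth_on_locally[OF chart_open(2)[OF B]])
    fix x assume "x \<in> \<psi> ` V"
    then obtain q where q: "q \<in> V" "x = \<psi> q" by blast
    show "\<exists>T. open T \<and> x \<in> T \<and> smooth_on T (?h \<circ> inv_into V \<psi>)"
    proof (cases "q \<in> U")
      case True
      let ?T = "\<psi> ` (V \<inter> U)"
      have T: "open ?T" using chart_image_open[OF B, of "V \<inter> U"] chart_open A B by blast
      have "(\<phi> \<circ> inv_into V \<psi>) ` ?T \<subseteq> \<phi> ` U" using B by auto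
      from smooth_on_compose[OF T chart_open(2)[OF A] transition_smooth[OF B A] w(1) this]
      have "smooth_on ?T (\<lambda>x. w ((\<phi> \<circ> inv_into V \<psi>) x))" .
      moreover have "smooth_on ?T (\<lambda>x. w ((\<phi> \<circ> inv_into V \<psi>) x)) \<longleftrightarrow> smooth_on ?T (?h \<circ> inv_into V \<psi>)"
        by (rule smooth_on_cong[OF T]) (use B in auto)
      ultimately show ?thesis using T True q by blast
    next
      case False
      let ?T = "\<psi> ` (V - ?K)"
      have T: "open ?T" using chart_image_open[OF B, of "V - ?K"] chart_open B clK by (auto simp: open_Diff)
      have "smooth_on ?T (?h \<circ> inv_into V \<psi>) \<longleftrightarrow> smooth_on ?T (\<lambda>x. 0 :: real)"
      proof (rule smooth_on_cong[OF T])
        fix x assume "x \<in> ?T"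
        then obtain q where q: "q \<in> V" "q \<notin> ?K" "x = \<psi> q" by blast
        have "w (\<phi> q) = 0" if "q \<in> U"
        proof (rule w(2))
          show "\<phi> q \<notin> K" using q(2) A that chart_inv by (metis image_eqI)
        qed (use that in auto)
        then show "(?h \<circ> inv_into V \<psi>) x = 0" using q B by auto
      qed
      then have "smooth_on ?T (?h \<circ> inv_into V \<psi>)" by simp
      moreover have "x \<in> ?T" using False q KU by blast
      ultimately show ?thesis using T by (intro exI[of _ ?T] conjI)
    qed
  qed
qed

lemma tangent_add: "v \<in> TM p \<Longrightarrow> smooth u \<Longrightarrow> smooth w \<Longrightarrow> v (u + w) = v u + v w"
  and tangent_scaleR: "v \<in> TM p \<Longrightarrow> smooth u \<Longrightarrow> v (c *\<^sub>R u) = c * v u"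
  and tangent_mult: "v \<in> TM p \<Longrightarrow> smooth u \<Longrightarrow> smooth w \<Longrightarrow> v (u * w) = u p * v w + w p * v u"
  and tangent_not_smooth: "v \<in> TM p \<Longrightarrow> \<not> smooth u \<Longrightarrow> v u = 0"
  unfolding tangent_space_def by blast+

lemma tangent_zero: "v \<in> TM p \<Longrightarrow> v 0 = 0"
  using tangent_scaleR[of v p 0 0] by simp

lemma tangent_uminus: "v \<in> TM p \<Longrightarrow> smooth u \<Longrightarrow> v (- u) = - v u"
  using tangent_scaleR[of v p u "-1"] by simp

lemma tangent_diff: "v \<in> TM p \<Longrightarrow> smooth u \<Longrightarrow> smooth w \<Longrightarrow> v (u - w) = v u - v w"
  using tangent_add[of v p u "- w"] by (simp add: tangent_uminus)

lemma tangent_one: "v \<in> TM p \<Longrightarrow> v 1 = 0"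
  using tangent_mult[of v p 1 1] by simp

lemma tangent_const: "v \<in> TM p \<Longrightarrow> v (\<lambda>q. c) = 0"
  using tangent_scaleR[of v p 1 c] tangent_one[of v p] by (simp add: scaleR_fun_def)

lemma tangent_sum:
  assumes "v \<in> TM p" "\<And>i. i \<in> I \<Longrightarrow> smooth (u i)"
  shows "v (sum u I) = (\<Sum>i\<in>I. v (u i))"
  using assms(2) by (induction I rule: infinite_finite_induct)
    (auto simp: tangent_zero[OF assms(1)] tangent_add[OF assms(1)] smooth_sum)

lemma tangent_spaceI:
  assumes "\<And>u w. smooth u \<Longrightarrow> smooth w \<Longrightarrow> v (u + w) = v u + v w"
    "\<And>c u. smooth u \<Longrightarrow> v (c *\<^sub>R u) = c * v u"
    "\<And>u w. smooth u \<Longrightarrow> smooth w \<Longrightarrow> v (u * w) = u p * v w + w p * v u"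
    "\<And>u. \<not> smooth u \<Longrightarrow> v u = 0"
  shows "v \<in> TM p"
  using assms unfolding tangent_space_def by blast

lemma TM_zero [simp]: "0 \<in> TM p"
  by (rule tangent_spaceI) auto

lemma TM_add [simp]: "v \<in> TM p \<Longrightarrow> w \<in> TM p \<Longrightarrow> v + w \<in> TM p"
  by (rule tangent_spaceI)
    (auto simp: tangent_add tangent_scaleR tangent_mult tangent_not_smooth algebra_simps)

lemma TM_scaleR [simp]: "v \<in> TM p \<Longrightarrow> c *\<^sub>R v \<in> TM p"
  by (rule tangent_spaceI)
    (auto simp: tangent_add tangent_scaleR tangent_mult tangent_not_smooth algebra_simps)

lemma VF_TM: "X \<in> VF \<Longrightarrow> X p \<in> TM p"
  and VF_smooth [simp]: "X \<in> VF \<Longrightarrow> smooth u \<Longrightarrow> smooth (deriv_along X u)"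
  by (auto simp: vfields_def)

lemma VF_I: "(\<And>p. X p \<in> TM p) \<Longrightarrow> (\<And>u. smooth u \<Longrightarrow> smooth (deriv_along X u)) \<Longrightarrow> X \<in> VF"
  unfolding vfields_def by blast

lemma VF_zero [simp]: "0 \<in> VF"
proof (rule VF_I)
  show "smooth (deriv_along 0 u)" for u
    using smooth_const(2) by (simp add: deriv_along_def zero_fun_def)
qed simp

lemma VF_add [simp]:
  assumes "X \<in> VF" "Y \<in> VF" shows "X + Y \<in> VF"
proof (rule VF_I)
  show "(X + Y) p \<in> TM p" for p
    using TM_add[OF VF_TM[OF assms(1)] VF_TM[OF assms(2)]] by simp
  have "deriv_along (X + Y) u = deriv_along X u + deriv_along Y u" for u
    by (simp add: deriv_along_def fun_eq_iff)
  then show "smooth (deriv_along (X + Y) u)" if "smooth u" for u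
    using assms that by simp
qed

lemma VF_fscale [simp]:
  assumes "X \<in> VF" "smooth w" shows "fscale w X \<in> VF"
proof (rule VF_I)
  show "fscale w X p \<in> TM p" for p
    using TM_scaleR[OF VF_TM[OF assms(1)]] by (simp add: fscale_def)
  have "deriv_along (fscale w X) u = w * deriv_along X u" for u
    by (simp add: deriv_along_def fscale_def fun_eq_iff)
  then show "smooth (deriv_along (fscale w X) u)" if "smooth u" for u
    using assms that by simp
qed

lemma VF_scaleR [simp]: "X \<in> VF \<Longrightarrow> c *\<^sub>R X \<in> VF"
  using VF_fscale[of X "\<lambda>p. c"] smooth_const(1)[of c] by (simp add: fscale_def scaleR_fun_def)

lemma VF_uminus [simp]: "X \<in> VF \<Longrightarrow> - X \<in> VF"
  using VF_scaleR[of X "-1"] by simp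

lemma VF_diff [simp]: "X \<in> VF \<Longrightarrow> Y \<in> VF \<Longrightarrow> X - Y \<in> VF"
  using VF_add[of X "- Y"] by simp

lemma VF_sum: "(\<And>i. i \<in> I \<Longrightarrow> X i \<in> VF) \<Longrightarrow> sum X I \<in> VF"
  by (induction I rule: infinite_finite_induct) auto

end

section \<open>Coordinates on tangent spaces and tensoriality\<close>

context smooth_atlas begin

text \<open>With a plateau function \<open>B\<close> supported in \<open>W\<close>, any smooth \<open>w\<close> on \<open>W\<close> becomes a
  globally smooth function that agrees with \<open>w\<close> near the chosen point.\<close>

lemma chart_cutoff:
  assumes A: "(U, \<phi>) \<in> A" and W: "open W" "W \<subseteq> \<phi> ` U" "x \<in> W"
  obtains B r where "r > 0" "cball x (2 * r) \<subseteq> W" "smooth_on UNIV B"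
    "\<And>y. y \<in> cball x r \<Longrightarrow> B y = 1" "\<And>y. y \<notin> cball x (2 * r) \<Longrightarrow> B y = 0"
    "\<And>w. smooth_on W w \<Longrightarrow> smooth (\<lambda>q. if q \<in> U then B (\<phi> q) * w (\<phi> q) else 0)"
proof -
  obtain e where e: "e > 0" "cball x e \<subseteq> W"
    using W(1,3) open_contains_cball by blast
  define r where "r = e / 2"
  have r: "r > 0" "cball x (2 * r) \<subseteq> W" using e by (auto simp: r_def)
  obtain B where B: "smooth_on UNIV B" "\<And>y. y \<in> cball x r \<Longrightarrow> B y = 1"
    "\<And>y. y \<notin> cball x (2 * r) \<Longrightarrow> B y = (0::real)"
    using exists_bump_function[OF r(1)] by metis
  show thesis
  proof (rule that[OF r B])
    fix w :: "'e \<Rightarrow> real" assume w: "smooth_on W w"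
    have "smooth_on UNIV (\<lambda>y. B y * w y)"
      by (rule smooth_on_mult_cutoff[OF B(1) W(1) w closed_cball r(2) B(3)])
    from smooth_fun_of_chart[OF A compact_cball subset_trans[OF r(2) W(2)]
        smooth_on_subset[OF this subset_UNIV]]
    show "smooth (\<lambda>q. if q \<in> U then B (\<phi> q) * w (\<phi> q) else 0)"
      using B(3) by simp
  qed
qed

text \<open>Derivations are local: multiply \<open>u - w\<close> by a cutoff \<open>h\<close> inside \<open>W\<close> with \<open>h p = 1\<close>. The product
  is zero, and the Leibniz rule turns this into \<open>v (u - w) = 0\<close>.\<close>

lemma tangent_local:
  assumes v: "v \<in> TM p" and W: "open W" "p \<in> W" and u: "smooth u" "smooth w"
    and eq: "\<And>q. q \<in> W \<Longrightarrow> u q = w q"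
  shows "v u = v w"
proof -
  obtain U \<phi> where c: "(U, \<phi>) \<in> A" "p \<in> U" by (rule chart_at)
  have o: "open (\<phi> ` (U \<inter> W))"
    by (rule chart_image_open[OF c(1) open_Int[OF chart_open(1)[OF c(1)] W(1)]]) blast
  obtain B r where B: "r > 0" "cball (\<phi> p) (2 * r) \<subseteq> \<phi> ` (U \<inter> W)"
    "\<And>y. y \<in> cball (\<phi> p) r \<Longrightarrow> B y = (1::real)" "\<And>y. y \<notin> cball (\<phi> p) (2 * r) \<Longrightarrow> B y = 0"
    "\<And>w. smooth_on (\<phi> ` (U \<inter> W)) w \<Longrightarrow> smooth (\<lambda>q. if q \<in> U then B (\<phi> q) * w (\<phi> q) else 0)"
    by (rule chart_cutoff[OF c(1) o]) (use c W in auto)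
  define h where "h = (\<lambda>q. if q \<in> U then B (\<phi> q) * 1 else 0)"
  have h: "smooth h" unfolding h_def by (rule B(5)) simp
  have hp: "h p = 1" using c B(1) by (simp add: h_def B(3))
  have "h q * (u - w) q = 0" for q
  proof (cases "q \<in> W \<or> h q = 0")
    case False
    then have q: "q \<in> U" "B (\<phi> q) \<noteq> 0" by (auto simp: h_def split: if_splits)
    then have "\<phi> q \<in> \<phi> ` (U \<inter> W)" using B(2,4) by blast
    then obtain q' where q': "q' \<in> U" "q' \<in> W" "\<phi> q = \<phi> q'" by blast
    have "q = q'" using chart_inv[OF c(1) q(1)] chart_inv[OF c(1) q'(1)] q'(3) by metis
    then show ?thesis using False q' by simp
  qed (auto simp: eq)
  then have "h * (u - w) = 0" by (simp add: fun_eq_iff)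
  then have "0 = v (h * (u - w))" by (simp add: tangent_zero[OF v])
  also have "\<dots> = h p * v (u - w) + (u - w) p * v h"
    by (rule tangent_mult[OF v h smooth_diff[OF u]])
  also have "\<dots> = v u - v w" by (simp add: hp eq[OF W(2)] tangent_diff[OF v u])
  finally show ?thesis by simp
qed

definition chart_tangent :: "'m set \<Rightarrow> ('m \<Rightarrow> 'e) \<Rightarrow> 'm \<Rightarrow> 'e \<Rightarrow> 'm tangent" where
  "chart_tangent U \<phi> q x u =
     (if smooth u then frechet_derivative (u \<circ> inv_into U \<phi>) (at (\<phi> q)) x else 0)"

lemma chart_has_derivative:
  assumes "(U, \<phi>) \<in> A" "q \<in> U" "smooth u"
  shows "((u \<circ> inv_into U \<phi>) has_derivative (\<lambda>x. chart_tangent U \<phi> q x u)) (at (\<phi> q))"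
proof -
  have "((u \<circ> inv_into U \<phi>) has_derivative frechet_derivative (u \<circ> inv_into U \<phi>) (at (\<phi> q))) (at (\<phi> q))"
    by (rule smooth_on_has_derivative[OF smooth_funD[OF assms(3,1)] imageI[OF assms(2)]])
  then show ?thesis by (simp add: chart_tangent_def assms(3))
qed

lemma chart_tangent_unique:
  assumes "(U, \<phi>) \<in> A" "q \<in> U" "smooth u" "((u \<circ> inv_into U \<phi>) has_derivative u') (at (\<phi> q))"
  shows "chart_tangent U \<phi> q x u = u' x"
  using has_derivative_unique[OF chart_has_derivative[OF assms(1-3)] assms(4)] by (rule fun_cong)

lemma chart_tangent_linear:
  assumes "(U, \<phi>) \<in> A" "q \<in> U"
  shows "linear (chart_tangent U \<phi> q)"
proof -
  have l: "linear (\<lambda>x. chart_tangent U \<phi> q x u)" if "smooth u" for u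
    by (rule has_derivative_linear[OF chart_has_derivative[OF assms that]])
  have n: "chart_tangent U \<phi> q x u = 0" if "\<not> smooth u" for u x
    using that by (simp add: chart_tangent_def)
  show ?thesis
  proof (rule linearI)
    show "chart_tangent U \<phi> q (x + y) = chart_tangent U \<phi> q x + chart_tangent U \<phi> q y" for x y
    proof
      show "chart_tangent U \<phi> q (x + y) u = (chart_tangent U \<phi> q x + chart_tangent U \<phi> q y) u" for u
        using linear_add[OF l, of u x y] n[of u] by (cases "smooth u") simp_all
    qed
    show "chart_tangent U \<phi> q (c *\<^sub>R x) = c *\<^sub>R chart_tangent U \<phi> q x" for c x
    proof
      show "chart_tangent U \<phi> q (c *\<^sub>R x) u = (c *\<^sub>R chart_tangent U \<phi> q x) u" for u
        using linear_cmul[OF l, of u c x] n[of u] by (cases "smooth u") simp_all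
    qed
  qed
qed

lemma chart_tangent_in_TM:
  assumes c: "(U, \<phi>) \<in> A" "q \<in> U"
  shows "chart_tangent U \<phi> q x \<in> TM q"
proof (rule tangent_spaceI)
  note d = chart_has_derivative[OF c]
  show "chart_tangent U \<phi> q x (u + w) = chart_tangent U \<phi> q x u + chart_tangent U \<phi> q x w"
    if "smooth u" "smooth w" for u w
  proof (rule chart_tangent_unique[OF c smooth_add[OF that]])
    show "((u + w \<circ> inv_into U \<phi>) has_derivative
        (\<lambda>x. chart_tangent U \<phi> q x u + chart_tangent U \<phi> q x w)) (at (\<phi> q))"
      using has_derivative_add[OF d[OF that(1)] d[OF that(2)]] by (simp add: o_def)
  qed
  show "chart_tangent U \<phi> q x (k *\<^sub>R u) = k * chart_tangent U \<phi> q x u" if "smooth u" for u k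
  proof (rule chart_tangent_unique[OF c smooth_scaleR[OF that]])
    show "((k *\<^sub>R u \<circ> inv_into U \<phi>) has_derivative (\<lambda>x. k * chart_tangent U \<phi> q x u)) (at (\<phi> q))"
      using has_derivative_mult_right[OF d[OF that], of k] by (simp add: o_def)
  qed
  show "chart_tangent U \<phi> q x (u * w) = u q * chart_tangent U \<phi> q x w + w q * chart_tangent U \<phi> q x u"
    if "smooth u" "smooth w" for u w
  proof (rule chart_tangent_unique[OF c smooth_mult[OF that]])
    show "((u * w \<circ> inv_into U \<phi>) has_derivative
        (\<lambda>x. u q * chart_tangent U \<phi> q x w + w q * chart_tangent U \<phi> q x u)) (at (\<phi> q))"
      using has_derivative_mult[OF d[OF that(1)] d[OF that(2)]] chart_inv[OF c]
      by (simp add: o_def mult.commute)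
  qed
qed (simp add: chart_tangent_def)

text \<open>Every derivation at \<open>q\<close> is a directional derivative in the chart, with the values on the
  coordinate functions as components. By Hadamard's lemma \<open>u\<close> agrees near \<open>q\<close> with
  \<open>u q + (\<Sum>b. (t b - t b q) * g b)\<close>, and the Leibniz rule leaves \<open>g b q * v (t b)\<close> of each summand.

  The functions \<open>t b\<close> are coordinates on the whole of \<open>S\<close> because the same functions are used at
  all points near a given one.\<close>

lemma tangent_expansion:
  assumes c: "(U, \<phi>) \<in> A" "q \<in> U" and S: "open S" "S \<subseteq> \<phi> ` U" "\<phi> q \<in> S"
    and t: "\<And>b. smooth (t b)" "\<And>b q'. q' \<in> U \<Longrightarrow> \<phi> q' \<in> S \<Longrightarrow> t b q' = \<phi> q' \<bullet> b"
    and v: "v \<in> TM q"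
  shows "v = chart_tangent U \<phi> q (\<Sum>b\<in>Basis. v (t b) *\<^sub>R b)"
proof
  fix u
  show "v u = chart_tangent U \<phi> q (\<Sum>b\<in>Basis. v (t b) *\<^sub>R b) u"
  proof (cases "smooth u")
    case False
    then show ?thesis using tangent_not_smooth[OF v] by (simp add: chart_tangent_def)
  next
    case u: True
    define a where "a = \<phi> q"
    obtain e where e: "e > 0" "ball a e \<subseteq> S" using S(1,3) openE a_def by blast
    have su: "smooth_on (ball a e) (u \<circ> inv_into U \<phi>)"
      by (rule smooth_on_subset[OF smooth_funD[OF u c(1)]]) (use e S in blast)
    have ae: "a \<in> ball a e" and be: "ball a e \<subseteq> \<phi> ` U" using e S by auto
    obtain G where G: "\<And>b. smooth_on (ball a e) (G b)"
      "\<And>x. x \<in> ball a e \<Longrightarrow> (u \<circ> inv_into U \<phi>) x = (u \<circ> inv_into U \<phi>) a + (\<Sum>b\<in>Basis. ((x - a) \<bullet> b) * G b x)"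
      "\<And>b. G b a = frechet_derivative (u \<circ> inv_into U \<phi>) (at a) b"
      by (rule Hadamard[OF open_ball convex_ball ae su], rule that)
    obtain B r where B: "r > 0" "cball a (2 * r) \<subseteq> ball a e"
      "\<And>y. y \<in> cball a r \<Longrightarrow> B y = (1::real)"
      "\<And>w. smooth_on (ball a e) w \<Longrightarrow> smooth (\<lambda>q. if q \<in> U then B (\<phi> q) * w (\<phi> q) else 0)"
      by (rule chart_cutoff[OF c(1) open_ball be ae], rule that)
    define g where "g b = (\<lambda>q. if q \<in> U then B (\<phi> q) * G b (\<phi> q) else 0)" for b
    have g: "smooth (g b)" for b unfolding g_def by (rule B(4)[OF G(1)])
    define w where "w = (\<lambda>_. u q) + (\<Sum>b\<in>Basis. (t b + (\<lambda>_. - (a \<bullet> b))) * g b)"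
    have w: "smooth w" unfolding w_def
      by (intro smooth_add smooth_sum smooth_mult t g smooth_const)
    let ?W = "{q' \<in> U. \<phi> q' \<in> ball a r}"
    have oW: "open ?W"
    proof -
      have "continuous_on U \<phi>" using homeomorphism_cont1[OF chart_homeomorphism[OF c(1)]] .
      from continuous_open_preimage[OF this chart_open(1)[OF c(1)] open_ball[of a r]]
      show ?thesis by (simp add: vimage_def Int_def)
    qed
    have "u q' = w q'" if "q' \<in> ?W" for q'
    proof -
      have q': "q' \<in> U" "\<phi> q' \<in> cball a r" using that by auto
      have be: "\<phi> q' \<in> ball a e" using q'(2) B(1,2) by (auto simp: subset_iff)
      have "u q' = (u \<circ> inv_into U \<phi>) (\<phi> q')" using chart_inv[OF c(1) q'(1)] by simp
      also have "\<dots> = u q + (\<Sum>b\<in>Basis. ((\<phi> q' - a) \<bullet> b) * G b (\<phi> q'))"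
        using G(2)[OF be] chart_inv[OF c] by (simp add: a_def)
      also have "\<dots> = w q'"
      proof -
        have sf: "(\<Sum>b\<in>I. h b) q' = (\<Sum>b\<in>I. h b q')" for h :: "'e \<Rightarrow> 'm \<Rightarrow> real" and I
          by (induction I rule: infinite_finite_induct) auto
        have "((\<phi> q' - a) \<bullet> b) * G b (\<phi> q') = ((t b + (\<lambda>_. - (a \<bullet> b))) * g b) q'" for b
          using q' be e(2) t(2)[of q' b] B(3)[OF q'(2)] by (auto simp: g_def inner_diff_left)
        then show ?thesis by (simp add: w_def sf)
      qed
      finally show ?thesis .
    qed
    from tangent_local[OF v oW _ u w this]
    have "v u = v w" using c B(1) a_def by simp
    also have "\<dots> = v (\<lambda>_. u q) + v (\<Sum>b\<in>Basis. (t b + (\<lambda>_. - (a \<bullet> b))) * g b)"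
      unfolding w_def by (rule tangent_add[OF v]) (intro smooth_add smooth_sum smooth_mult t g smooth_const)+
    also have "\<dots> = (\<Sum>b\<in>Basis. v ((t b + (\<lambda>_. - (a \<bullet> b))) * g b))"
      unfolding tangent_const[OF v] by (subst tangent_sum[OF v]) (intro smooth_add smooth_mult t g smooth_const, simp)
    also have "\<dots> = (\<Sum>b\<in>Basis. v (t b) * chart_tangent U \<phi> q b u)"
    proof (rule sum.cong[OF refl])
      fix b :: 'e assume "b \<in> Basis"
      have tb: "t b q = a \<bullet> b" using t(2)[OF c(2) S(3)] by (simp add: a_def)
      have gb: "g b q = chart_tangent U \<phi> q b u"
        using c(2) B(1) G(3)[of b] B(3)[of a] u by (simp add: g_def chart_tangent_def a_def)
      have "v ((t b + (\<lambda>_. - (a \<bullet> b))) * g b) = (t b + (\<lambda>_. - (a \<bullet> b))) q * v (g b) + g b q * v (t b + (\<lambda>_. - (a \<bullet> b)))"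
        by (rule tangent_mult[OF v smooth_add[OF t(1) smooth_const(1)] g])
      also have "\<dots> = v (t b) * chart_tangent U \<phi> q b u"
        by (simp add: tb gb tangent_add[OF v t(1) smooth_const(1)] tangent_const[OF v])
      finally show "v ((t b + (\<lambda>_. - (a \<bullet> b))) * g b) = v (t b) * chart_tangent U \<phi> q b u" .
    qed
    also have "\<dots> = chart_tangent U \<phi> q (\<Sum>b\<in>Basis. v (t b) *\<^sub>R b) u"
    proof -
      have L: "linear (\<lambda>x. chart_tangent U \<phi> q x u)"
        by (rule has_derivative_linear[OF chart_has_derivative[OF c u]])
      show ?thesis unfolding linear_sum[OF L] by (simp add: linear_cmul[OF L])
    qed
    finally show ?thesis .
  qed
qed

text \<open>Two nested cutoffs: the functions \<open>t b\<close> equal the coordinates on \<open>S\<close>, and \<open>\<rho>\<close> is supported where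
  this is the case.\<close>

lemma local_coordinates:
  obtains U \<phi> S t \<rho> where "(U, \<phi>) \<in> A" "p \<in> U" "open S" "S \<subseteq> \<phi> ` U" "\<phi> p \<in> S"
    "\<And>b. smooth (t b)" "\<And>b q. q \<in> U \<Longrightarrow> \<phi> q \<in> S \<Longrightarrow> t b q = \<phi> q \<bullet> b"
    "smooth \<rho>" "\<rho> p = 1" "\<And>q. \<rho> q \<noteq> 0 \<Longrightarrow> q \<in> U \<and> \<phi> q \<in> S"
    "\<And>w. smooth_on S w \<Longrightarrow> smooth (\<lambda>q. if q \<in> U then \<rho> q * w (\<phi> q) else 0)"
proof -
  obtain U \<phi> where c: "(U, \<phi>) \<in> A" "p \<in> U" by (rule chart_at)
  obtain B r where B: "r > 0" "cball (\<phi> p) (2 * r) \<subseteq> \<phi> ` U"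
    "\<And>y. y \<in> cball (\<phi> p) r \<Longrightarrow> B y = (1::real)"
    "\<And>w. smooth_on (\<phi> ` U) w \<Longrightarrow> smooth (\<lambda>q. if q \<in> U then B (\<phi> q) * w (\<phi> q) else 0)"
    by (rule chart_cutoff[OF c(1) chart_open(2)[OF c(1)] order_refl imageI[OF c(2)]], rule that)
  define S where "S = ball (\<phi> p) r"
  have S: "open S" "S \<subseteq> \<phi> ` U" "\<phi> p \<in> S" using B(1,2) by (auto simp: S_def subset_iff)
  obtain B' r' where B': "r' > 0" "cball (\<phi> p) (2 * r') \<subseteq> S"
    "\<And>y. y \<in> cball (\<phi> p) r' \<Longrightarrow> B' y = (1::real)" "\<And>y. y \<notin> cball (\<phi> p) (2 * r') \<Longrightarrow> B' y = 0"
    "\<And>w. smooth_on S w \<Longrightarrow> smooth (\<lambda>q. if q \<in> U then B' (\<phi> q) * w (\<phi> q) else 0)"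
    by (rule chart_cutoff[OF c(1) S], rule that)
  define t where "t b = (\<lambda>q. if q \<in> U then B (\<phi> q) * (\<phi> q \<bullet> b) else 0)" for b
  define \<rho> where "\<rho> = (\<lambda>q. if q \<in> U then B' (\<phi> q) * 1 else 0)"
  show thesis
  proof (rule that[OF c S, of t \<rho>])
    show "smooth (t b)" for b unfolding t_def
      by (rule B(4)[OF smooth_on_bounded_linear[OF chart_open(2)[OF c(1)] bounded_linear_inner_left]])
    show "t b q = \<phi> q \<bullet> b" if "q \<in> U" "\<phi> q \<in> S" for b q
      using that B(3)[of "\<phi> q"] by (simp add: t_def S_def)
    show "smooth \<rho>" unfolding \<rho>_def by (rule B'(5)) simp
    show "\<rho> p = 1" using c B'(1,3) by (simp add: \<rho>_def)
    show "q \<in> U \<and> \<phi> q \<in> S" if "\<rho> q \<noteq> 0" for q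
    proof -
      have "q \<in> U" "B' (\<phi> q) \<noteq> 0" using that unfolding \<rho>_def by (auto split: if_splits)
      then show ?thesis using B'(2,4) by blast
    qed
    show "smooth (\<lambda>q. if q \<in> U then \<rho> q * w (\<phi> q) else 0)" if "smooth_on S w" for w
      using B'(5)[OF that] by (simp add: \<rho>_def cong: if_cong)
  qed
qed

lemma local_frame:
  obtains U \<phi> t \<rho> where "(U, \<phi>) \<in> A" "p \<in> U" "\<And>b. smooth (t b)" "smooth \<rho>" "\<rho> p = 1"
    "\<And>q. \<rho> q \<noteq> 0 \<Longrightarrow> q \<in> U"
    "\<And>q v. \<rho> q \<noteq> 0 \<Longrightarrow> v \<in> TM q \<Longrightarrow> v = chart_tangent U \<phi> q (\<Sum>b\<in>Basis. v (t b) *\<^sub>R b)"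
    "\<And>x b. b \<in> Basis \<Longrightarrow> chart_tangent U \<phi> p x (t b) = x \<bullet> b"
    "\<And>x. (\<lambda>q. if q \<in> U then \<rho> q *\<^sub>R chart_tangent U \<phi> q x else 0) \<in> VF"
proof -
  obtain U \<phi> S t \<rho> where L: "(U, \<phi>) \<in> A" "p \<in> U" "open S" "S \<subseteq> \<phi> ` U" "\<phi> p \<in> S"
    "\<And>b. smooth (t b)" "\<And>b q. q \<in> U \<Longrightarrow> \<phi> q \<in> S \<Longrightarrow> t b q = \<phi> q \<bullet> b"
    "smooth \<rho>" "\<rho> p = 1" "\<And>q. \<rho> q \<noteq> 0 \<Longrightarrow> q \<in> U \<and> \<phi> q \<in> S"
    "\<And>w. smooth_on S w \<Longrightarrow> smooth (\<lambda>q. if q \<in> U then \<rho> q * w (\<phi> q) else 0)"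
    by (rule local_coordinates[of p], rule that)
  show thesis
  proof (rule that[OF L(1,2,6,8,9)])
    show "q \<in> U" if "\<rho> q \<noteq> 0" for q using L(10)[OF that] by simp
    show "v = chart_tangent U \<phi> q (\<Sum>b\<in>Basis. v (t b) *\<^sub>R b)" if "\<rho> q \<noteq> 0" "v \<in> TM q" for q v
      by (rule tangent_expansion[OF L(1) _ L(3,4) _ L(6,7) that(2)]) (use L(10)[OF that(1)] in simp_all)
    show "chart_tangent U \<phi> p x (t b) = x \<bullet> b" if "b \<in> Basis" for x b
    proof (rule chart_tangent_unique[OF L(1,2,6)])
      have d: "((\<lambda>y. y \<bullet> b) has_derivative (\<lambda>x. x \<bullet> b)) (at (\<phi> p))"
        by (rule bounded_linear.has_derivative[OF bounded_linear_inner_left has_derivative_ident])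
      show "((t b \<circ> inv_into U \<phi>) has_derivative (\<lambda>x. x \<bullet> b)) (at (\<phi> p))"
      proof (rule has_derivative_transform_within_open[OF d L(3,5)])
        fix y assume y: "y \<in> S"
        then obtain q where q: "q \<in> U" "y = \<phi> q" using L(4) by blast
        show "y \<bullet> b = (t b \<circ> inv_into U \<phi>) y"
          using L(7)[OF q(1)] y chart_inv[OF L(1) q(1)] q(2) by simp
      qed
    qed
    show "(\<lambda>q. if q \<in> U then \<rho> q *\<^sub>R chart_tangent U \<phi> q x else 0) \<in> VF" (is "?X \<in> VF") for x
    proof (rule VF_I)
      show "?X q \<in> TM q" for q
      proof (cases "q \<in> U")
        case True
        show ?thesis using TM_scaleR[OF chart_tangent_in_TM[OF L(1) True], of "\<rho> q" x] True by simp
      qed simp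
      show "smooth (deriv_along ?X u)" if u: "smooth u" for u
      proof -
        have "smooth_on S (\<lambda>y. frechet_derivative (u \<circ> inv_into U \<phi>) (at y) x)"
          by (rule smooth_on_frechet_derivative[OF smooth_on_subset[OF smooth_funD[OF u L(1)] L(4)]])
        from L(11)[OF this]
        have "smooth (\<lambda>q. if q \<in> U then \<rho> q * frechet_derivative (u \<circ> inv_into U \<phi>) (at (\<phi> q)) x else 0)" .
        moreover have "deriv_along ?X u = (\<lambda>q. if q \<in> U then \<rho> q * frechet_derivative (u \<circ> inv_into U \<phi>) (at (\<phi> q)) x else 0)"
        proof
          show "deriv_along ?X u q = (if q \<in> U then \<rho> q * frechet_derivative (u \<circ> inv_into U \<phi>) (at (\<phi> q)) x else 0)" for q
            by (cases "q \<in> U") (simp_all add: deriv_along_def chart_tangent_def u)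
        qed
        ultimately show ?thesis by simp
      qed
    qed
  qed
qed

lemma tangent_space_iso: "\<exists>L :: 'e \<Rightarrow> 'm tangent. linear L \<and> bij_betw L UNIV (TM p)"
proof -
  obtain U \<phi> t \<rho> where F: "(U, \<phi>) \<in> A" "p \<in> U" "\<And>b. smooth (t b)" "smooth \<rho>" "\<rho> p = 1"
    "\<And>q v. \<rho> q \<noteq> 0 \<Longrightarrow> v \<in> TM q \<Longrightarrow> v = chart_tangent U \<phi> q (\<Sum>b\<in>Basis. v (t b) *\<^sub>R b)"
    "\<And>x b. b \<in> Basis \<Longrightarrow> chart_tangent U \<phi> p x (t b) = x \<bullet> b"
    by (rule local_frame[of p], rule that)
  have "inj (chart_tangent U \<phi> p)"
  proof (rule injI)
    fix x y :: 'e assume eq: "chart_tangent U \<phi> p x = chart_tangent U \<phi> p y"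
    show "x = y"
    proof (rule euclidean_eqI)
      fix b :: 'e assume b: "b \<in> Basis"
      show "x \<bullet> b = y \<bullet> b" using F(7)[OF b, of x] F(7)[OF b, of y] eq by simp
    qed
  qed
  moreover have "range (chart_tangent U \<phi> p) = TM p"
  proof
    show "range (chart_tangent U \<phi> p) \<subseteq> TM p" using chart_tangent_in_TM[OF F(1,2)] by blast
    show "TM p \<subseteq> range (chart_tangent U \<phi> p)"
    proof
      fix v assume "v \<in> TM p"
      then have "v = chart_tangent U \<phi> p (\<Sum>b\<in>Basis. v (t b) *\<^sub>R b)"
        using F(6)[of p v] F(5) by (metis zero_neq_one)
      then show "v \<in> range (chart_tangent U \<phi> p)" by (rule range_eqI)
    qed
  qed
  ultimately show ?thesis
    using chart_tangent_linear[OF F(1,2)] unfolding bij_betw_def by blast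
qed

lemma tangent_extension:
  assumes "v \<in> TM p" obtains X where "X \<in> VF" "X p = v"
proof -
  obtain U \<phi> t \<rho> where F: "(U, \<phi>) \<in> A" "p \<in> U" "\<rho> p = 1"
    "\<And>q v. \<rho> q \<noteq> 0 \<Longrightarrow> v \<in> TM q \<Longrightarrow> v = chart_tangent U \<phi> q (\<Sum>b\<in>Basis. v (t b) *\<^sub>R b)"
    "\<And>x. (\<lambda>q. if q \<in> U then \<rho> q *\<^sub>R chart_tangent U \<phi> q x else 0) \<in> VF"
    by (rule local_frame[of p], rule that)
  have v: "v = chart_tangent U \<phi> p (\<Sum>b\<in>Basis. v (t b) *\<^sub>R b)"
    by (rule F(4)) (use F(3) assms in simp_all)
  show thesis
    by (rule that[OF F(5)[of "\<Sum>b\<in>Basis. v (t b) *\<^sub>R b"]]) (subst (2) v, simp add: F(2,3))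
qed

text \<open>A field that vanishes at \<open>p\<close> is a combination of global fields with smooth coefficients
  vanishing at \<open>p\<close>: on the support of \<open>\<rho>\<close>, \<open>\<rho>\<^sup>2 X = (\<Sum>b. (\<rho> * X (t b)) (\<rho> \<partial>\<^sub>b))\<close>, and the
  remainder is \<open>(1 - \<rho>\<^sup>2) X\<close>, where \<open>\<rho> p = 1\<close>.\<close>

lemma tensorial_zero:
  fixes T :: "'m vfield \<Rightarrow> real"
  assumes add: "\<And>X Y. X \<in> VF \<Longrightarrow> Y \<in> VF \<Longrightarrow> T (X + Y) = T X + T Y"
    and scale: "\<And>u X. smooth u \<Longrightarrow> X \<in> VF \<Longrightarrow> T (fscale u X) = u p * T X"
    and X: "X \<in> VF" "X p = 0"
  shows "T X = 0"
proof -
  obtain U \<phi> t \<rho> where F: "(U, \<phi>) \<in> A" "p \<in> U" "\<And>b. smooth (t b)" "smooth \<rho>" "\<rho> p = 1"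
    "\<And>q. \<rho> q \<noteq> 0 \<Longrightarrow> q \<in> U"
    "\<And>q v. \<rho> q \<noteq> 0 \<Longrightarrow> v \<in> TM q \<Longrightarrow> v = chart_tangent U \<phi> q (\<Sum>b\<in>Basis. v (t b) *\<^sub>R b)"
    "\<And>x. (\<lambda>q. if q \<in> U then \<rho> q *\<^sub>R chart_tangent U \<phi> q x else 0) \<in> VF"
    by (rule local_frame[of p], rule that)
  define E where "E b = (\<lambda>q. if q \<in> U then \<rho> q *\<^sub>R chart_tangent U \<phi> q b else 0)" for b
  define c where "c b = \<rho> * deriv_along X (t b)" for b
  have E: "E b \<in> VF" for b unfolding E_def by (rule F(8))
  have c: "smooth (c b)" for b unfolding c_def using F(3,4) X(1) by simp
  have cp: "c b p = 0" for b using X(2) by (simp add: c_def deriv_along_def)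
  have T0: "T 0 = 0" using add[OF VF_zero VF_zero] by simp
  have Tsum: "T (\<Sum>b\<in>I. fscale (c b) (E b)) = (\<Sum>b\<in>I. T (fscale (c b) (E b)))" for I
  proof (induction I rule: infinite_finite_induct)
    case (insert b I)
    have "T (fscale (c b) (E b) + (\<Sum>b\<in>I. fscale (c b) (E b))) = T (fscale (c b) (E b)) + T (\<Sum>b\<in>I. fscale (c b) (E b))"
      by (intro add VF_fscale VF_sum c E)
    then show ?case by (simp only: sum.insert[OF insert.hyps] insert.IH)
  qed (simp_all only: sum.empty sum.infinite T0 simp_thms)
  have "X = (\<Sum>b\<in>Basis. fscale (c b) (E b)) + fscale (1 - \<rho> * \<rho>) X"
  proof
    fix q
    have sf: "(\<Sum>b\<in>I. h b) q = (\<Sum>b\<in>I. h b q)" for h :: "'e \<Rightarrow> 'm vfield" and I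
      by (induction I rule: infinite_finite_induct) auto
    have "(\<Sum>b\<in>Basis. fscale (c b) (E b) q) = (\<rho> q * \<rho> q) *\<^sub>R X q"
    proof (cases "\<rho> q = 0")
      case True
      then show ?thesis by (simp add: fscale_def c_def)
    next
      case False
      note q = F(6)[OF False]
      note L = chart_tangent_linear[OF F(1) q]
      have "fscale (c b) (E b) q = (\<rho> q * \<rho> q) *\<^sub>R (X q (t b) *\<^sub>R chart_tangent U \<phi> q b)" for b
        by (simp only: fscale_def c_def E_def deriv_along_def q if_True times_fun_apply scaleR_scaleR mult_ac)
      then have "(\<Sum>b\<in>Basis. fscale (c b) (E b) q) = (\<rho> q * \<rho> q) *\<^sub>R (\<Sum>b\<in>Basis. X q (t b) *\<^sub>R chart_tangent U \<phi> q b)"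
        by (simp only: scaleR_sum_right)
      also have "(\<Sum>b\<in>Basis. X q (t b) *\<^sub>R chart_tangent U \<phi> q b) = chart_tangent U \<phi> q (\<Sum>b\<in>Basis. X q (t b) *\<^sub>R b)"
        by (simp only: linear_sum[OF L] linear_cmul[OF L])
      also have "\<dots> = X q" by (rule F(7)[OF False VF_TM[OF X(1)], symmetric])
      finally show ?thesis .
    qed
    then show "X q = ((\<Sum>b\<in>Basis. fscale (c b) (E b)) + fscale (1 - \<rho> * \<rho>) X) q"
      by (simp add: sf fscale_def scaleR_left_diff_distrib)
  qed
  then have "T X = T ((\<Sum>b\<in>Basis. fscale (c b) (E b)) + fscale (1 - \<rho> * \<rho>) X)" by (rule arg_cong)
  also have "\<dots> = T (\<Sum>b\<in>Basis. fscale (c b) (E b)) + T (fscale (1 - \<rho> * \<rho>) X)"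
    by (intro add VF_sum VF_fscale c E X smooth_diff smooth_mult F(4) smooth_const)
  also have "T (fscale (1 - \<rho> * \<rho>) X) = (1 - \<rho> * \<rho>) p * T X"
    by (intro scale X smooth_diff smooth_mult F(4) smooth_const)
  also have "T (\<Sum>b\<in>Basis. fscale (c b) (E b)) = 0"
    unfolding Tsum using scale[OF c E] by (simp add: cp)
  finally show ?thesis by (simp add: F(5))
qed

lemma tensorial_eq:
  fixes T :: "'m vfield \<Rightarrow> real"
  assumes add: "\<And>X Y. X \<in> VF \<Longrightarrow> Y \<in> VF \<Longrightarrow> T (X + Y) = T X + T Y"
    and scale: "\<And>u X. smooth u \<Longrightarrow> X \<in> VF \<Longrightarrow> T (fscale u X) = u p * T X"
    and X: "X \<in> VF" "Y \<in> VF" "X p = Y p"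
  shows "T X = T Y"
proof -
  have "T (X - Y) = 0"
    by (rule tensorial_zero[of T p, OF add scale VF_diff[OF X(1,2)]]) (simp_all add: X(3))
  moreover have "T X = T (X - Y) + T Y"
    using add[OF VF_diff[OF X(1,2)] X(2)] by simp
  ultimately show ?thesis by simp
qed

end

section \<open>Operators and bilinear forms on an inner product space\<close>

definition inner_form :: "('e::real_vector \<Rightarrow> 'e \<Rightarrow> real) \<Rightarrow> bool" where
  "inner_form g \<longleftrightarrow> bilinear g \<and> (\<forall>x y. g x y = g y x) \<and> (\<forall>x. x \<noteq> 0 \<longrightarrow> g x x > 0)"

lemma bilinear_zero_on_span:
  fixes c :: "'e::real_vector \<Rightarrow> 'e \<Rightarrow> real"
  assumes c: "bilinear c" and B: "span B = UNIV" and z: "\<And>e k. e \<in> B \<Longrightarrow> k \<in> B \<Longrightarrow> c e k = 0"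
  shows "c x y = 0"
proof -
  have l: "linear (c x)" "linear (\<lambda>x. c x y)" for x y using c by (auto simp: bilinear_def)
  have 1: "c e y = 0" if "e \<in> B" for e y
    by (rule linear_eq_0_on_span[OF l(1)[of e], of B]) (use z that B in auto)
  show ?thesis by (rule linear_eq_0_on_span[OF l(2)[of y], of B]) (use 1 B in auto)
qed

text \<open>Gram-Schmidt with respect to \<open>g\<close>, applied to the standard basis.\<close>

lemma exists_orthonormal_frame:
  fixes g :: "'e::euclidean_space \<Rightarrow> 'e \<Rightarrow> real"
  assumes "inner_form g"
  obtains B where "finite B" "span B = UNIV"
    "\<And>e k. e \<in> B \<Longrightarrow> k \<in> B \<Longrightarrow> g e k = (if e = k then 1 else 0)"
    "\<And>x. x = (\<Sum>e\<in>B. g x e *\<^sub>R e)"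
proof -
  have g: "bilinear g" and sym: "g x y = g y x" and pos: "x \<noteq> 0 \<Longrightarrow> g x x > 0" for x y
    using assms by (auto simp: inner_form_def)
  have lin: "linear (\<lambda>x. g x y)" for y using g by (auto simp: bilinear_def)
  have gsum: "g (\<Sum>e\<in>B. f e *\<^sub>R e) y = (\<Sum>e\<in>B. f e * g e y)" for f B y
    by (simp add: linear_sum[OF lin] linear_cmul[OF lin])
  have proj: "g (x - (\<Sum>e\<in>B. g x e *\<^sub>R e)) k = 0"
    if "finite B" "k \<in> B" "\<And>e k. e \<in> B \<Longrightarrow> k \<in> B \<Longrightarrow> g e k = (if e = k then 1 else 0)" for B x k
  proof -
    have "(\<Sum>e\<in>B. g x e * g e k) = (\<Sum>e\<in>B. if e = k then g x k else 0)"
      by (rule sum.cong) (use that in auto)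
    then show ?thesis using that(1,2) by (simp add: bilinear_lsub[OF g] gsum)
  qed
  have "\<exists>B. finite B \<and> (\<forall>e\<in>B. \<forall>k\<in>B. g e k = (if e = k then 1 else 0)) \<and> span B = span S"
    if "finite S" for S :: "'e set"
    using that
  proof (induction S rule: finite_induct)
    case empty
    show ?case by (intro exI[of _ "{}"]) simp
  next
    case (insert a S)
    then obtain B where B: "finite B" "\<And>e k. e \<in> B \<Longrightarrow> k \<in> B \<Longrightarrow> g e k = (if e = k then 1 else 0)"
      "span B = span S" by blast
    define s where "s = (\<Sum>e\<in>B. g a e *\<^sub>R e)"
    have s: "s \<in> span B" unfolding s_def by (intro span_sum span_scale span_base)
    have orth: "g (a - s) k = 0" if "k \<in> B" for k
      unfolding s_def by (rule proj[OF B(1) that B(2)])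
    have ins: "span (insert a S) = span (insert a B)"
      using B(3) by (simp add: span_insert)
    show ?case
    proof (cases "a = s")
      case True
      then have "span (insert a B) = span B" using s by (simp add: span_redundant)
      then show ?thesis using B ins by (intro exI[of _ B]) auto
    next
      case False
      define r where "r = sqrt (g (a - s) (a - s))"
      have r: "r > 0" "r * r = g (a - s) (a - s)" using pos[of "a - s"] False by (auto simp: r_def)
      define a' where "a' = (1 / r) *\<^sub>R (a - s)"
      have a'k: "g a' k = 0" "g k a' = 0" if "k \<in> B" for k
        using orth[OF that] sym[of k a'] by (simp_all add: a'_def bilinear_lmul[OF g])
      have "g a' a' = (1 / r) * ((1 / r) * g (a - s) (a - s))"
        by (simp only: a'_def bilinear_lmul[OF g] bilinear_rmul[OF g] real_scaleR_def)
      also have "\<dots> = (1 / r) * ((1 / r) * (r * r))" by (simp only: r(2))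
      finally have a'a': "g a' a' = 1" using r(1) by simp
      have a: "a = r *\<^sub>R a' + s" using r by (simp add: a'_def)
      have "span (insert a' B) = span (insert a B)"
      proof (subst span_eq, intro conjI)
        have s': "s \<in> span (insert c B)" for c using s span_mono[of B "insert c B"] by blast
        have "a - s \<in> span (insert a B)" by (rule span_diff[OF span_base[OF insertI1] s'])
        then show "insert a' B \<subseteq> span (insert a B)"
          unfolding a'_def by (auto intro: span_scale span_base)
        have "r *\<^sub>R a' + s \<in> span (insert a' B)"
          by (rule span_add[OF span_scale[OF span_base[OF insertI1]] s'])
        then show "insert a B \<subseteq> span (insert a' B)" using a by (auto intro: span_base)
      qed
      then have "span (insert a' B) = span (insert a S)" using ins by simp
      moreover have "\<forall>e\<in>insert a' B. \<forall>k\<in>insert a' B. g e k = (if e = k then 1 else 0)"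
        using a'k a'a' B(2) by (metis insert_iff zero_neq_one)
      ultimately show ?thesis using B(1) by (intro exI[of _ "insert a' B"]) simp
    qed
  qed
  from this[OF finite_Basis] obtain B :: "'e set" where
    B: "finite B" "\<And>e k. e \<in> B \<Longrightarrow> k \<in> B \<Longrightarrow> g e k = (if e = k then 1 else 0)" "span B = UNIV"
    by (metis span_Basis)
  have "x = (\<Sum>e\<in>B. g x e *\<^sub>R e)" for x
  proof -
    define d where "d = x - (\<Sum>e\<in>B. g x e *\<^sub>R e)"
    have "linear (g d)" using g by (simp add: bilinear_def)
    then have "g d d = 0"
      by (rule linear_eq_0_on_span[of _ B]) (use proj[OF B(1) _ B(2)] B(3) in \<open>auto simp: d_def\<close>)
    then have "d = 0" using pos[of d] by (cases "d = 0") auto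
    then show ?thesis by (simp add: d_def)
  qed
  then show thesis using that B by metis
qed

text \<open>If \<open>Q\<close> acts on the first and on the second argument of \<open>b\<close>, the difference \<open>c\<close> of the two actions
  is a self-adjoint operation on bilinear forms, with respect to the sum of products over an
  orthonormal frame. Hence its square can kill \<open>b\<close> only if it kills \<open>b\<close> itself:
  \<open>\<langle>c, c\<rangle> = \<langle>b, c (Q \<cdot>, \<cdot>) - c (\<cdot>, Q \<cdot>)\<rangle> = 0\<close>.\<close>

lemma double_commutator_zero:
  fixes g :: "'e::euclidean_space \<Rightarrow> 'e \<Rightarrow> real"
  assumes g: "inner_form g" and Q: "linear Q" "\<And>x y. g (Q x) y = g x (Q y)" and b: "bilinear b"
    and dc: "\<And>x y. b (Q (Q x)) y - 2 * b (Q x) (Q y) + b x (Q (Q y)) = (0::real)"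
  shows "b (Q x) y = b x (Q y)"
proof -
  obtain B where B: "finite B" "span B = UNIV"
    "\<And>e k. e \<in> B \<Longrightarrow> k \<in> B \<Longrightarrow> g e k = (if e = k then 1 else 0)"
    "\<And>x. x = (\<Sum>e\<in>B. g x e *\<^sub>R e)"
    by (rule exists_orthonormal_frame[OF g], rule that)
  have sym: "g x y = g y x" for x y using g by (auto simp: inner_form_def)
  have adj: "(\<Sum>e\<in>B. p (Q e) * q e) = (\<Sum>e\<in>B. p e * q (Q e))"
    if p: "linear p" and q: "linear q" for p q :: "'e \<Rightarrow> real"
  proof -
    have ex: "l (Q e) = (\<Sum>k\<in>B. g (Q e) k * l k)" if l: "linear l" for l :: "'e \<Rightarrow> real" and e
    proof -
      have "l (Q e) = l (\<Sum>k\<in>B. g (Q e) k *\<^sub>R k)" using B(4)[of "Q e"] by simp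
      also have "\<dots> = (\<Sum>k\<in>B. g (Q e) k * l k)" by (simp add: linear_sum[OF l] linear_cmul[OF l])
      finally show ?thesis .
    qed
    have gQ: "g (Q e) k = g (Q k) e" for e k by (metis Q(2) sym)
    have "(\<Sum>e\<in>B. p (Q e) * q e) = (\<Sum>e\<in>B. \<Sum>k\<in>B. g (Q e) k * p k * q e)"
      by (simp add: ex[OF p] sum_distrib_right)
    also have "\<dots> = (\<Sum>k\<in>B. \<Sum>e\<in>B. g (Q e) k * p k * q e)" by (rule sum.swap)
    also have "\<dots> = (\<Sum>k\<in>B. p k * (\<Sum>e\<in>B. g (Q k) e * q e))"
      unfolding sum_distrib_left
      by (intro sum.cong refl, subst gQ) simp
    also have "\<dots> = (\<Sum>k\<in>B. p k * q (Q k))" by (simp add: ex[OF q])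
    finally show ?thesis .
  qed
  define c where "c x y = b (Q x) y - b x (Q y)" for x y
  have l: "linear (b x)" "linear (\<lambda>x. b x y)" for x y using b by (auto simp: bilinear_def)
  note Qa = linear_add[OF Q(1)] linear_cmul[OF Q(1)]
  have bc: "bilinear c" unfolding bilinear_def c_def
    by (intro conjI allI linearI)
      (simp_all add: Qa bilinear_ladd[OF b] bilinear_radd[OF b] bilinear_lmul[OF b] bilinear_rmul[OF b] algebra_simps)
  have lc: "linear (c x)" "linear (\<lambda>x. c x y)" for x y using bc by (auto simp: bilinear_def)
  have cc: "c (Q x) y - c x (Q y) = 0" for x y using dc[of x y] by (simp add: c_def)
  have 1: "(\<Sum>e\<in>B. b (Q e) k * c e k) = (\<Sum>e\<in>B. b e k * c (Q e) k)" for k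
    by (rule adj[OF l(2) lc(2)])
  have 2: "(\<Sum>k\<in>B. b e (Q k) * c e k) = (\<Sum>k\<in>B. b e k * c e (Q k))" for e
    by (rule adj[OF l(1) lc(1)])
  have "(\<Sum>e\<in>B. \<Sum>k\<in>B. c e k * c e k) =
      (\<Sum>e\<in>B. \<Sum>k\<in>B. b (Q e) k * c e k) - (\<Sum>e\<in>B. \<Sum>k\<in>B. b e (Q k) * c e k)"
    by (subst (1) c_def) (simp add: left_diff_distrib sum_subtractf)
  also have "(\<Sum>e\<in>B. \<Sum>k\<in>B. b (Q e) k * c e k) = (\<Sum>k\<in>B. \<Sum>e\<in>B. b (Q e) k * c e k)"
    by (rule sum.swap)
  also have "\<dots> = (\<Sum>k\<in>B. \<Sum>e\<in>B. b e k * c (Q e) k)" by (simp only: 1)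
  also have "\<dots> = (\<Sum>e\<in>B. \<Sum>k\<in>B. b e k * c (Q e) k)" by (rule sum.swap)
  also have "(\<Sum>e\<in>B. \<Sum>k\<in>B. b e (Q k) * c e k) = (\<Sum>e\<in>B. \<Sum>k\<in>B. b e k * c e (Q k))"
    by (simp only: 2)
  also have "(\<Sum>e\<in>B. \<Sum>k\<in>B. b e k * c (Q e) k) - (\<Sum>e\<in>B. \<Sum>k\<in>B. b e k * c e (Q k))
      = (\<Sum>e\<in>B. \<Sum>k\<in>B. b e k * (c (Q e) k - c e (Q k)))"
    by (simp only: sum_subtractf right_diff_distrib)
  also have "\<dots> = 0" by (simp only: cc mult_zero_right sum.neutral_const)
  finally have s: "(\<Sum>e\<in>B. \<Sum>k\<in>B. c e k * c e k) = 0" .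
  have "c e k = 0" if "e \<in> B" "k \<in> B" for e k
  proof -
    have "(\<Sum>k\<in>B. c e k * c e k) = 0"
      using s that(1) B(1) by (subst (asm) sum_nonneg_eq_0_iff) (auto intro: sum_nonneg)
    then have "c e k * c e k = 0"
      using that(2) B(1) by (subst (asm) sum_nonneg_eq_0_iff) auto
    then show ?thesis by simp
  qed
  then have "c x y = 0" by (rule bilinear_zero_on_span[OF bc B(2)])
  then show ?thesis by (simp add: c_def)
qed

text \<open>Let \<open>Q\<^sub>1, Q\<^sub>2, Q\<^sub>3\<close> be \<open>Q\<close> acting on the three arguments \<open>x, y, z\<close> of a function of them.
  On the three summands of \<open>cyc\<close> one has \<open>Q\<^sub>2 = Q\<^sub>3\<close>, \<open>Q\<^sub>3 = Q\<^sub>1\<close> and \<open>Q\<^sub>1 = Q\<^sub>2\<close>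
  respectively, by \<open>Qw\<close>. So \<open>(Q\<^sub>1 - Q\<^sub>2) (Q\<^sub>1 - Q\<^sub>3)\<close> applied to \<open>cyc\<close> kills the last two summands and acts as
  \<open>(Q\<^sub>1 - Q\<^sub>2)\<^sup>2\<close> on the first. By \<open>double_commutator_zero\<close> all of \<open>Q\<^sub>1, Q\<^sub>2, Q\<^sub>3\<close> agree on \<open>w\<close>, and
  the claim is \<open>Q\<^sub>1\<close> applied to \<open>cyc\<close>.\<close>

lemma trilinear_cyclic:
  fixes g :: "'e::euclidean_space \<Rightarrow> 'e \<Rightarrow> real"
  assumes g: "inner_form g" and Q: "linear Q" "\<And>x y. g (Q x) y = g x (Q y)"
    and w: "\<And>z. bilinear (\<lambda>x y. w x y z)"
    and Qw: "\<And>x y z. w x (Q y) z = w x y (Q z)"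
    and cyc: "\<And>x y z. w x y z + w y z x + w z x y = (0::real)"
  shows "w x y (Q z) + w y z (Q x) + w z x (Q y) = 0"
proof -
  have "w (Q x) y z = w x (Q y) z" for x y z
  proof (rule double_commutator_zero[where b = "\<lambda>x y. w x y z", OF g Q w])
    fix x y
    show "w (Q (Q x)) y z - 2 * w (Q x) (Q y) z + w x (Q (Q y)) z = 0"
      using cyc[of "Q (Q x)" y z] cyc[of "Q x" "Q y" z] cyc[of "Q x" y "Q z"] cyc[of x "Q y" "Q z"]
      by (simp add: Qw)
  qed
  then show ?thesis using cyc[of "Q x" y z] by (simp add: Qw[symmetric])
qed

text \<open>The hypothesis says that the symmetric form \<open>g (f x) y + g x (f y)\<close> vanishes when one argument
  lies in the range of \<open>f\<close>; it vanishes trivially when both lie in the kernel. As \<open>f (f y) = 0\<close>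
  implies \<open>|f y|\<^sup>2 = 0\<close>, the range and the kernel meet only in zero and span the space.\<close>

lemma skew_of_norm_identity:
  fixes g :: "'e::euclidean_space \<Rightarrow> 'e \<Rightarrow> real"
  assumes g: "inner_form g" and f: "linear f" and gf: "\<And>x y. g (f x) (f y) = - g x (f (f y))"
  shows "g (f x) y = - g x (f y)"
proof -
  have b: "bilinear g" and sym: "g x y = g y x" and pos: "x \<noteq> 0 \<Longrightarrow> g x x > 0" for x y
    using g by (auto simp: inner_form_def)
  have ker: "f y = 0" if "f (f y) = 0" for y
    using gf[of y y] that pos[of "f y"] by (auto simp: bilinear_rzero[OF b])
  have sub: "subspace (range f)" by (rule linear_subspace_image[OF f subspace_UNIV])
  have inj: "inj_on f (span (range f))"
  proof (rule inj_onI)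
    fix u v assume "u \<in> span (range f)" "v \<in> span (range f)" and eq: "f u = f v"
    then obtain y where y: "u - v = f y"
      using subspace_diff[OF sub, of u v] sub span_eq_iff by blast
    have "f (f y) = 0" using eq by (simp add: y[symmetric] linear_diff[OF f])
    then show "u = v" using ker y by (metis eq_iff_diff_eq_0)
  qed
  have "f ` range f = range f"
  proof (rule subspace_dim_equal)
    show "subspace (f ` range f)" by (rule linear_subspace_image[OF f sub])
    show "dim (range f) \<le> dim (f ` range f)" using dim_image_eq[OF f inj] by simp
  qed (use sub in auto)
  then have split: "\<exists>k w. u = k + f w \<and> f k = 0" for u
  proof -
    have "f u \<in> f ` range f" using \<open>f ` range f = range f\<close> by blast
    then obtain w where "f u = f (f w)" by blast
    then have "f (u - f w) = 0" by (simp add: linear_diff[OF f])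
    then show ?thesis by (intro exI[of _ "u - f w"] exI[of _ w]) simp
  qed
  obtain k w where x: "x = k + f w" "f k = 0" using split by blast
  obtain k' w' where y: "y = k' + f w'" "f k' = 0" using split by blast
  have a: "g (f (f w)) k' = 0" using gf[of k' w] y(2) sym by (simp add: bilinear_lzero[OF b])
  have c: "g k (f (f w')) = 0" using gf[of k w'] x(2) by (simp add: bilinear_lzero[OF b])
  show ?thesis
    using gf[of "f w" w'] a c
    by (simp add: x y linear_add[OF f] bilinear_ladd[OF b] bilinear_radd[OF b])
qed

section \<open>Symplectic families of vectors\<close>

text \<open>The matrix of a symplectic basis, with the basis vectors at the positions \<open>1, 2, 3, \<dots>\<close> and paired
  as \<open>(1,2), (3,4), \<dots>\<close>. Row and column zero vanish: this position is reserved for a vector in the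
  radical, so that indices are those of the arguments of \<open>\<eta> \<and> (d\<eta>)\<^sup>n\<close>.\<close>

definition symplectic_unit :: "nat \<Rightarrow> nat \<Rightarrow> real" where
  "symplectic_unit i j = (if odd i \<and> j = Suc i then 1 else if odd j \<and> i = Suc j then - 1 else 0)"

definition partner :: "nat \<Rightarrow> nat" where
  "partner i = (if odd i then Suc i else i - 1)"

lemma symplectic_unit_skew: "symplectic_unit i j = - symplectic_unit j i"
  by (auto simp: symplectic_unit_def)

lemma symplectic_unit_partner: "symplectic_unit i j \<noteq> 0 \<longleftrightarrow> i \<noteq> 0 \<and> j = partner i"
  by (auto simp: symplectic_unit_def partner_def elim: oddE)

lemma partner_involution: "i \<noteq> 0 \<Longrightarrow> partner (partner i) = i \<and> partner i \<noteq> 0"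
  by (auto simp: partner_def elim: oddE evenE)

lemma partner_le: "1 \<le> i \<Longrightarrow> i \<le> 2 * k \<Longrightarrow> 1 \<le> partner i \<and> partner i \<le> 2 * k"
  unfolding partner_def by (cases "odd i"; simp; presburger)

lemma symplectic_unit_square:
  "i \<noteq> 0 \<Longrightarrow> symplectic_unit (partner i) i * symplectic_unit (partner i) i = 1"
  using partner_involution[of i] symplectic_unit_partner[of "partner i" i]
  by (auto simp: symplectic_unit_def split: if_splits)

definition symplectic_family :: "('e \<Rightarrow> 'e \<Rightarrow> real) \<Rightarrow> nat \<Rightarrow> (nat \<Rightarrow> 'e) \<Rightarrow> bool" where
  "symplectic_family \<Omega> k x \<longleftrightarrow> (\<forall>i\<le>2 * k. \<forall>j\<le>2 * k. \<Omega> (x i) (x j) = symplectic_unit i j)"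

text \<open>Symplectic Gram-Schmidt. Subtracting \<open>P\<close> makes any vector orthogonal to the family; a vector
  outside the span stays nonzero modulo the radical and therefore has a dual vector.\<close>

lemma symplectic_family_extend:
  fixes \<Omega> :: "'e::real_vector \<Rightarrow> 'e \<Rightarrow> real"
  assumes b: "bilinear \<Omega>" and skew: "\<And>x y. \<Omega> x y = - \<Omega> y x"
    and r: "\<And>y. \<Omega> r y = 0" and rad: "\<And>x. (\<And>y. \<Omega> x y = 0) \<Longrightarrow> x \<in> span {r}"
    and x: "symplectic_family \<Omega> k x" "x 0 = r" and sp: "span (x ` {..2 * k}) \<noteq> UNIV"
  shows "\<exists>x'. symplectic_family \<Omega> (Suc k) x' \<and> x' 0 = r"
proof -
  let ?J = symplectic_unit
  have J: "\<Omega> (x i) (x j) = ?J i j" if "i \<le> 2 * k" "j \<le> 2 * k" for i j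
    using x(1) that by (auto simp: symplectic_family_def)
  \<comment> \<open>the projection to the span of the family; the dual vector of \<open>x i\<close> is its partner, up to the sign \<open>?J i (partner i)\<close>\<close>
  define P where "P u = (\<Sum>i\<in>{1..2*k}. (?J i (partner i) * \<Omega> u (x (partner i))) *\<^sub>R x i)" for u
  have P: "P u \<in> span (x ` {..2 * k})" for u
    unfolding P_def by (intro span_sum span_scale span_base) auto
  have lin: "linear (\<lambda>u. \<Omega> u y)" for y using b by (auto simp: bilinear_def)
  have orth: "\<Omega> (u - P u) (x j) = 0" if j: "j \<le> 2 * k" for u j
  proof (cases "j = 0")
    case True
    then show ?thesis using r skew[of _ r] x(2) by simp
  next
    case False
    have "\<Omega> (P u) (x j) = (\<Sum>i\<in>{1..2*k}. (?J i (partner i) * \<Omega> u (x (partner i))) * \<Omega> (x i) (x j))"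
      unfolding P_def by (simp add: linear_sum[OF lin] linear_cmul[OF lin])
    also have "\<dots> = (\<Sum>i\<in>{1..2*k}. if i = partner j then \<Omega> u (x j) else 0)"
    proof (rule sum.cong[OF refl])
      fix i assume i: "i \<in> {1..2*k}"
      show "(?J i (partner i) * \<Omega> u (x (partner i))) * \<Omega> (x i) (x j) = (if i = partner j then \<Omega> u (x j) else 0)"
      proof (cases "i = partner j")
        case True
        have "partner i = j" using partner_involution[OF False] True by simp
        then show ?thesis using True J[of i j] i j symplectic_unit_square[OF False] by simp
      next
        case ne: False
        have "j \<noteq> partner i" using partner_involution[of i] i ne by force
        then have "?J i j = 0" using symplectic_unit_partner[of i j] by blast
        then show ?thesis using ne J[of i j] i j by simp
      qed
    qed
    also have "\<dots> = \<Omega> u (x j)" using partner_le[of j k] False j by simp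
    finally show ?thesis by (simp add: bilinear_lsub[OF b])
  qed
  obtain v where v: "v \<notin> span (x ` {..2 * k})" using sp by blast
  define v' where "v' = v - P v"
  have "v' \<notin> span (x ` {..2 * k})"
    using v P[of v] span_add_eq2[of "P v" _ "v'"] by (metis diff_add_cancel span_add v'_def)
  moreover have "span {r} \<subseteq> span (x ` {..2 * k})" using x(2) by (intro span_mono) auto
  ultimately obtain w where w: "\<Omega> v' w \<noteq> 0" using rad by blast
  define w' where "w' = (1 / \<Omega> v' w) *\<^sub>R (w - P w)"
  have v'x: "\<Omega> v' (x j) = 0" if "j \<le> 2 * k" for j unfolding v'_def by (rule orth[OF that])
  have w'x: "\<Omega> w' (x j) = 0" if "j \<le> 2 * k" for j
    unfolding w'_def by (simp add: bilinear_lmul[OF b] orth[OF that])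
  have "\<Omega> v' (P w) = 0"
  proof -
    have "linear (\<Omega> v')" using b by (auto simp: bilinear_def)
    then show ?thesis by (rule linear_eq_0_on_span[OF _ _ P]) (use v'x in auto)
  qed
  then have v'w': "\<Omega> v' w' = 1"
    unfolding w'_def using w by (simp add: bilinear_rmul[OF b] bilinear_rsub[OF b])
  have w'v': "\<Omega> w' v' = - 1" using skew[of w' v'] v'w' by simp
  have xv: "\<Omega> (x j) v' = 0" and xw: "\<Omega> (x j) w' = 0" if "j \<le> 2 * k" for j
    using skew[of "x j" v'] skew[of "x j" w'] v'x[OF that] w'x[OF that] by simp_all
  have vv: "\<Omega> u u = 0" for u using skew[of u u] by simp
  define x' where "x' = x(2 * k + 1 := v', 2 * k + 2 := w')"
  have "\<Omega> (x' i) (x' j) = ?J i j" if ij: "i \<le> 2 * k + 2" "j \<le> 2 * k + 2" for i j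
  proof -
    have x': "x' i = x i" if "i \<le> 2 * k" for i using that by (simp add: x'_def)
    have x1: "x' (2 * k + 1) = v'" "x' (2 * k + 2) = w'" by (simp_all add: x'_def)
    have z: "?J i (2 * k + 1) = 0" "?J i (2 * k + 2) = 0" "?J (2 * k + 1) i = 0" "?J (2 * k + 2) i = 0"
      if "i \<le> 2 * k" for i using that by (auto simp: symplectic_unit_def elim: oddE)
    have o: "?J (2 * k + 1) (2 * k + 2) = 1" "?J (2 * k + 2) (2 * k + 1) = - 1"
      "?J (2 * k + 1) (2 * k + 1) = 0" "?J (2 * k + 2) (2 * k + 2) = 0"
      by (auto simp: symplectic_unit_def)
    consider "i \<le> 2 * k" | "i = 2 * k + 1" | "i = 2 * k + 2" using ij(1) by linarith
    then show ?thesis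
    proof cases
      case 1
      consider "j \<le> 2 * k" | "j = 2 * k + 1" | "j = 2 * k + 2" using ij(2) by linarith
      then show ?thesis
        by cases (simp_all only: 1 J xv xw x' x1 z)
    next
      case 2
      consider "j \<le> 2 * k" | "j = 2 * k + 1" | "j = 2 * k + 2" using ij(2) by linarith
      then show ?thesis
        by cases (simp_all only: 2 v'x v'w' x' x1 z o vv)
    next
      case 3
      consider "j \<le> 2 * k" | "j = 2 * k + 1" | "j = 2 * k + 2" using ij(2) by linarith
      then show ?thesis
        by cases (simp_all only: 3 w'x w'v' x' x1 z o vv)
    qed
  qed
  then have "symplectic_family \<Omega> (Suc k) x'" by (simp add: symplectic_family_def)
  moreover have "x' 0 = r" using x(2) by (simp add: x'_def)
  ultimately show ?thesis by blast
qed

text \<open>The family spans at most \<open>2 * k + 1\<close> dimensions, or \<open>2 * k\<close> if the radical is zero, so it can be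
  extended as long as this is less than the dimension.\<close>

lemma exists_symplectic_family:
  fixes \<Omega> :: "'e::euclidean_space \<Rightarrow> 'e \<Rightarrow> real"
  assumes b: "bilinear \<Omega>" and skew: "\<And>x y. \<Omega> x y = - \<Omega> y x"
    and r: "\<And>y. \<Omega> r y = 0" and rad: "\<And>x. (\<And>y. \<Omega> x y = 0) \<Longrightarrow> x \<in> span {r}"
    and n: "2 * n \<le> DIM('e) + (if r = 0 then 1 else 0)"
  shows "\<exists>x. symplectic_family \<Omega> n x \<and> x 0 = r"
  using n
proof (induction n)
  case 0
  have "\<Omega> r r = symplectic_unit 0 0" using r by (simp add: symplectic_unit_def)
  then show ?case by (intro exI[of _ "\<lambda>_. r"]) (simp add: symplectic_family_def)
next
  case (Suc k)
  then obtain x where x: "symplectic_family \<Omega> k x" "x 0 = r" by auto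
  have "dim (span (x ` {..2 * k})) < DIM('e)"
  proof (cases "r = 0")
    case True
    have "x ` {..2 * k} \<subseteq> insert 0 (x ` {1..2 * k})"
    proof
      fix y assume "y \<in> x ` {..2 * k}"
      then obtain i where i: "i \<le> 2 * k" "y = x i" by auto
      show "y \<in> insert 0 (x ` {1..2 * k})" using i x(2) True by (cases "i = 0") auto
    qed
    then have "span (x ` {..2 * k}) \<subseteq> span (x ` {1..2 * k})"
      using span_mono[of "x ` {..2 * k}" "insert 0 (x ` {1..2 * k})"] by (simp add: span_insert_0)
    then have "dim (span (x ` {..2 * k})) \<le> dim (span (x ` {1..2 * k}))" by (rule dim_subset)
    also have "\<dots> \<le> card (x ` {1..2 * k})" by (simp add: dim_le_card')
    also have "\<dots> \<le> 2 * k" using card_image_le[of "{1..2 * k}" x] by simp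
    finally show ?thesis using Suc.prems True by simp
  next
    case False
    have "dim (span (x ` {..2 * k})) \<le> card (x ` {..2 * k})" by (simp add: dim_le_card')
    also have "\<dots> \<le> 2 * k + 1" using card_image_le[of "{..2 * k}" x] by simp
    finally show ?thesis using Suc.prems False by simp
  qed
  then have "span (x ` {..2 * k}) \<noteq> UNIV" by (metis dim_UNIV less_irrefl)
  from symplectic_family_extend[OF b skew r rad x this] show ?case .
qed

text \<open>A nondegenerate form in dimension \<open>2 * n + 1\<close> would admit a symplectic family of \<open>2 * n + 2\<close>
  vectors; but these are linearly independent, since the pairing with the partner singles out each of them.\<close>

lemma skew_form_degenerate_odd:
  fixes \<Omega> :: "'e::euclidean_space \<Rightarrow> 'e \<Rightarrow> real"
  assumes b: "bilinear \<Omega>" and skew: "\<And>x y. \<Omega> x y = - \<Omega> y x" and n: "DIM('e) = 2 * n + 1"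
  shows "\<exists>x. x \<noteq> 0 \<and> (\<forall>y. \<Omega> x y = 0)"
proof (rule ccontr)
  assume "\<nexists>x. x \<noteq> 0 \<and> (\<forall>y. \<Omega> x y = 0)"
  then have rad: "x \<in> span {0}" if "\<And>y. \<Omega> x y = 0" for x using that by auto
  have "\<exists>x. symplectic_family \<Omega> (Suc n) x \<and> x 0 = 0"
    by (rule exists_symplectic_family[OF b skew bilinear_lzero[OF b] rad]) (use n in auto)
  then obtain x where x: "symplectic_family \<Omega> (Suc n) x" by blast
  let ?I = "{1..2 * Suc n}"
  have J: "\<Omega> (x i) (x j) = symplectic_unit i j" if "i \<in> ?I" "j \<in> ?I" for i j
    using x that by (simp add: symplectic_family_def)
  have dual: "\<Omega> (x i) (x (partner i)) \<noteq> 0" "j \<noteq> i \<Longrightarrow> \<Omega> (x j) (x (partner i)) = 0"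
    if i: "i \<in> ?I" "j \<in> ?I" for i j
  proof -
    have p: "partner i \<in> ?I" using partner_le[of i "Suc n"] i(1) by simp
    show "\<Omega> (x i) (x (partner i)) \<noteq> 0"
      using J[OF i(1) p] symplectic_unit_partner[of i "partner i"] i(1) by simp
    show "\<Omega> (x j) (x (partner i)) = 0" if ne: "j \<noteq> i"
    proof -
      have "partner i \<noteq> partner j"
        using partner_involution[of i] partner_involution[of j] i ne by force
      then show ?thesis using J[OF i(2) p] symplectic_unit_partner[of j "partner i"] by auto
    qed
  qed
  have inj: "inj_on x ?I"
  proof (rule inj_onI)
    fix i j assume ij: "i \<in> ?I" "j \<in> ?I" "x i = x j"
    then show "i = j" using dual(1)[OF ij(1,1)] dual(2)[OF ij(1,2)] by metis
  qed
  have "independent (x ` ?I)"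
    unfolding dependent_def
  proof (rule notI, elim bexE)
    fix a assume "a \<in> x ` ?I" and a: "a \<in> span (x ` ?I - {a})"
    then obtain i where i: "i \<in> ?I" "a = x i" by blast
    have "linear (\<lambda>u. \<Omega> u (x (partner i)))" using b by (simp add: bilinear_def)
    moreover have "\<Omega> u (x (partner i)) = 0" if u: "u \<in> x ` ?I - {a}" for u
    proof -
      obtain j where j: "j \<in> ?I" "u = x j" using u by blast
      then have "j \<noteq> i" using u i(2) by blast
      then show ?thesis using dual(2)[OF i(1) j(1)] j(2) by simp
    qed
    ultimately have "\<Omega> a (x (partner i)) = 0"
      by (rule linear_eq_0_on_span[OF _ _ a])
    then show False using dual(1)[OF i(1) i(1)] i(2) by simp
  qed
  from independent_bound[OF this] have "card (x ` ?I) \<le> DIM('e)" by blast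
  then have "2 * Suc n \<le> 2 * n + 1" unfolding card_image[OF inj] n by simp
  then show False by simp
qed

section \<open>Wedge products as alternating sums\<close>

definition shift_perm :: "nat \<Rightarrow> (nat \<Rightarrow> nat) \<Rightarrow> nat \<Rightarrow> nat" where
  "shift_perm k \<tau> i = (if i < k then i else k + \<tau> (i - k))"

lemma shift_perm:
  assumes "\<tau> permutes {..<N}"
  shows "shift_perm k \<tau> permutes {..<k + N} \<and> sign (shift_perm k \<tau>) = sign \<tau>"
  using assms finite_lessThan
proof (induction rule: permutes_induct)
  case id
  have "shift_perm k id = id" by (auto simp: shift_perm_def fun_eq_iff)
  then show ?case by (simp only: permutes_id simp_thms)
next
  case (swap a b p)
  have eq: "shift_perm k (Transposition.transpose a b \<circ> p)
      = Transposition.transpose (k + a) (k + b) \<circ> shift_perm k p"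
    by (auto simp: shift_perm_def fun_eq_iff Transposition.transpose_def)
  have t: "Transposition.transpose (k + a) (k + b) permutes {..<k + N}"
    by (rule permutes_swap_id) (use swap in auto)
  have p: "permutation (shift_perm k p)" "permutation p"
    using swap permutes_imp_permutation[OF finite_lessThan] by blast+
  have "shift_perm k (Transposition.transpose a b \<circ> p) permutes {..<k + N}"
    unfolding eq by (rule permutes_compose) (use swap t in auto)
  moreover have "sign (shift_perm k (Transposition.transpose a b \<circ> p)) = sign (Transposition.transpose a b \<circ> p)"
    unfolding eq using swap
    by (simp add: sign_compose[OF permutation_swap_id p(1)] sign_compose[OF permutation_swap_id p(2)] sign_swap_id)
  ultimately show ?case ..
qed

text \<open>For each \<open>\<tau>\<close> the substitution \<open>\<sigma> \<mapsto> \<sigma> \<circ> shift_perm k \<tau>\<close> removes \<open>\<tau>\<close> from the argument of \<open>H\<close>, does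
  not change that of \<open>G\<close>, and absorbs the sign of \<open>\<tau>\<close>. Nested alternating sums thus
  collapse to a single one.\<close>

lemma alternating_sum_collapse:
  fixes G H :: "(nat \<Rightarrow> 'a) \<Rightarrow> real"
  assumes G: "\<And>Y Y'. (\<And>i. i < k \<Longrightarrow> Y i = Y' i) \<Longrightarrow> G Y = G Y'"
  shows "(\<Sum>\<sigma> | \<sigma> permutes {..<k + N}. of_int (sign \<sigma>) * G (\<lambda>i. X (\<sigma> i)) *
      (\<Sum>\<tau> | \<tau> permutes {..<N}. of_int (sign \<tau>) * H (\<lambda>i. X (\<sigma> (k + \<tau> i)))))
    = fact N * (\<Sum>\<sigma> | \<sigma> permutes {..<k + N}. of_int (sign \<sigma>) * G (\<lambda>i. X (\<sigma> i)) * H (\<lambda>i. X (\<sigma> (k + i))))"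
    (is "?lhs = fact N * ?rhs")
proof -
  let ?P = "{\<sigma>. \<sigma> permutes {..<k + N}}" and ?PN = "{\<tau>. \<tau> permutes {..<N}}"
  have "?lhs = (\<Sum>\<tau>\<in>?PN. \<Sum>\<sigma>\<in>?P. of_int (sign \<sigma>) * G (\<lambda>i. X (\<sigma> i)) * (of_int (sign \<tau>) * H (\<lambda>i. X (\<sigma> (k + \<tau> i)))))"
    unfolding sum_distrib_left by (rule sum.swap)
  also have "\<dots> = (\<Sum>\<tau>\<in>?PN. ?rhs)"
  proof (rule sum.cong[OF refl])
    fix \<tau> assume "\<tau> \<in> ?PN"
    then have s: "shift_perm k \<tau> permutes {..<k + N}" "sign (shift_perm k \<tau>) = sign \<tau>"
      using shift_perm by blast+
    show "(\<Sum>\<sigma>\<in>?P. of_int (sign \<sigma>) * G (\<lambda>i. X (\<sigma> i)) * (of_int (sign \<tau>) * H (\<lambda>i. X (\<sigma> (k + \<tau> i))))) = ?rhs"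
      unfolding sum_permutations_compose_right[OF s(1), of "\<lambda>\<sigma>. of_int (sign \<sigma>) * G (\<lambda>i. X (\<sigma> i)) * H (\<lambda>i. X (\<sigma> (k + i)))"]
    proof (rule sum.cong[OF refl])
      fix \<sigma> assume \<sigma>: "\<sigma> \<in> ?P"
      then have p: "permutation \<sigma>" "permutation (shift_perm k \<tau>)"
        using s(1) permutes_imp_permutation[OF finite_lessThan] by blast+
      have "G (\<lambda>i. X ((\<sigma> \<circ> shift_perm k \<tau>) i)) = G (\<lambda>i. X (\<sigma> i))"
        by (rule G) (simp add: shift_perm_def)
      then show "of_int (sign \<sigma>) * G (\<lambda>i. X (\<sigma> i)) * (of_int (sign \<tau>) * H (\<lambda>i. X (\<sigma> (k + \<tau> i))))
        = of_int (sign (\<sigma> \<circ> shift_perm k \<tau>)) * G (\<lambda>i. X ((\<sigma> \<circ> shift_perm k \<tau>) i))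
          * H (\<lambda>i. X ((\<sigma> \<circ> shift_perm k \<tau>) (k + i)))"
        by (simp add: sign_compose[OF p] s(2)) (simp add: shift_perm_def)
    qed
  qed
  also have "\<dots> = fact N * ?rhs" by (simp add: card_permutations[of "{..<N}" N])
  finally show ?thesis .
qed

lemma wedge_alternating_sum:
  assumes \<alpha>: "\<And>Y Y' p. (\<And>i. i < k \<Longrightarrow> Y i = Y' i) \<Longrightarrow> \<alpha> Y p = \<alpha> Y' p"
    and \<beta>: "\<And>X p. \<beta> X p = c * (\<Sum>\<tau> | \<tau> permutes {..<N}. of_int (sign \<tau>) * H (\<lambda>i. X (\<tau> i)) p)"
  shows "wedge k N \<alpha> \<beta> X p = c * fact N / fact (k + N) *
    (\<Sum>\<sigma> | \<sigma> permutes {..<k + N}. of_int (sign \<sigma>) * \<alpha> (\<lambda>i. X (\<sigma> i)) p * H (\<lambda>i. X (\<sigma> (k + i))) p)"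
proof -
  have factor: "(\<Sum>\<sigma>\<in>S. u \<sigma> * (c * v \<sigma>)) = c * (\<Sum>\<sigma>\<in>S. u \<sigma> * v \<sigma>)"
    for S and u v :: "(nat \<Rightarrow> nat) \<Rightarrow> real"
    by (simp add: sum_distrib_left mult.left_commute)
  have "wedge k N \<alpha> \<beta> X p =
      c * (\<Sum>\<sigma> | \<sigma> permutes {..<k + N}. of_int (sign \<sigma>) * \<alpha> (\<lambda>i. X (\<sigma> i)) p *
        (\<Sum>\<tau> | \<tau> permutes {..<N}. of_int (sign \<tau>) * H (\<lambda>i. X (\<sigma> (k + \<tau> i))) p)) / fact (k + N)"
    by (simp only: wedge_def \<beta> factor)
  also have "(\<Sum>\<sigma> | \<sigma> permutes {..<k + N}. of_int (sign \<sigma>) * \<alpha> (\<lambda>i. X (\<sigma> i)) p *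
        (\<Sum>\<tau> | \<tau> permutes {..<N}. of_int (sign \<tau>) * H (\<lambda>i. X (\<sigma> (k + \<tau> i))) p))
      = fact N * (\<Sum>\<sigma> | \<sigma> permutes {..<k + N}.
          of_int (sign \<sigma>) * \<alpha> (\<lambda>i. X (\<sigma> i)) p * H (\<lambda>i. X (\<sigma> (k + i))) p)"
    by (rule alternating_sum_collapse[where G = "\<lambda>Y. \<alpha> Y p" and H = "\<lambda>Y. H Y p"]) (rule \<alpha>)
  finally show ?thesis by simp
qed

lemma wedge_power2_eq:
  "\<exists>c>0. \<forall>X p. wedge_power2 (\<lambda>X. W (X 0) (X 1)) j X p =
     c * (\<Sum>\<sigma> | \<sigma> permutes {..<2 * j}. of_int (sign \<sigma>) * (\<Prod>i<j. W (X (\<sigma> (2 * i))) (X (\<sigma> (2 * i + 1))) p))"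
proof (induction j)
  case 0
  have "{\<sigma>. \<sigma> permutes ({} :: nat set)} = {id}" by auto
  then show ?case by (intro exI[of _ 1]) simp
next
  case (Suc j)
  define H where "H Y p = (\<Prod>i<j. W (Y (2 * i)) (Y (2 * i + 1)) p)" for Y :: "nat \<Rightarrow> 'a vfield" and p
  obtain c where c: "c > 0" "\<And>X p. wedge_power2 (\<lambda>X. W (X 0) (X 1)) j X p =
     c * (\<Sum>\<sigma> | \<sigma> permutes {..<2 * j}. of_int (sign \<sigma>) * H (\<lambda>i. X (\<sigma> i)) p)"
    using Suc.IH unfolding H_def by blast
  have "wedge_power2 (\<lambda>X. W (X 0) (X 1)) (Suc j) X p = c * fact (2 * j) / fact (2 + 2 * j) *
     (\<Sum>\<sigma> | \<sigma> permutes {..<2 * Suc j}. of_int (sign \<sigma>) * (\<Prod>i<Suc j. W (X (\<sigma> (2 * i))) (X (\<sigma> (2 * i + 1))) p))"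
    for X p
    unfolding wedge_power2.simps prod.lessThan_Suc_shift
    by (subst wedge_alternating_sum[OF _ c(2)]) (simp_all add: H_def mult.assoc)
  moreover have "c * fact (2 * j) / fact (2 + 2 * j) > 0" using c(1) by simp
  ultimately show ?case by blast
qed

lemma wedge_1_power2_eq:
  "\<exists>c>0. \<forall>X p. wedge 1 (2 * n) (\<lambda>X. a (X 0)) (wedge_power2 (\<lambda>X. W (X 0) (X 1)) n) X p =
     c * (\<Sum>\<sigma> | \<sigma> permutes {..<Suc (2 * n)}. of_int (sign \<sigma>) * a (X (\<sigma> 0)) p *
       (\<Prod>i<n. W (X (\<sigma> (2 * i + 1))) (X (\<sigma> (2 * i + 2))) p))"
proof -
  define H where "H Y p = (\<Prod>i<n. W (Y (2 * i)) (Y (2 * i + 1)) p)" for Y :: "nat \<Rightarrow> 'a vfield" and p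
  obtain c where c: "c > 0" "\<And>X p. wedge_power2 (\<lambda>X. W (X 0) (X 1)) n X p =
     c * (\<Sum>\<sigma> | \<sigma> permutes {..<2 * n}. of_int (sign \<sigma>) * H (\<lambda>i. X (\<sigma> i)) p)"
    using wedge_power2_eq[of W n] unfolding H_def by blast
  have "wedge 1 (2 * n) (\<lambda>X. a (X 0)) (wedge_power2 (\<lambda>X. W (X 0) (X 1)) n) X p =
     c * fact (2 * n) / fact (1 + 2 * n) * (\<Sum>\<sigma> | \<sigma> permutes {..<Suc (2 * n)}. of_int (sign \<sigma>) * a (X (\<sigma> 0)) p *
       (\<Prod>i<n. W (X (\<sigma> (2 * i + 1))) (X (\<sigma> (2 * i + 2))) p))" for X p
    by (subst wedge_alternating_sum[OF _ c(2)]) (simp_all add: H_def)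
  moreover have "c * fact (2 * n) / fact (1 + 2 * n) > 0" using c(1) by simp
  ultimately show ?thesis by blast
qed

lemma symplectic_unit_pair_swap:
  assumes "a \<noteq> 0" "b \<noteq> 0" "odd a" "odd b"
  defines "\<rho> \<equiv> Transposition.transpose a b \<circ> Transposition.transpose (Suc a) (Suc b)"
  shows "symplectic_unit (\<rho> i) (\<rho> j) = symplectic_unit i j"
proof -
  have ne: "a \<noteq> Suc b" "b \<noteq> Suc a" using assms(3,4) by auto
  have o: "\<rho> i = Transposition.transpose a b i \<and> \<rho> (Suc i) = Suc (Transposition.transpose a b i) \<and> odd (\<rho> i) \<and> odd (Transposition.transpose a b i)"
    if i: "odd i" for i
  proof -
    have "i \<noteq> Suc a" "i \<noteq> Suc b" "Suc i \<noteq> a" "Suc i \<noteq> b" using i assms(3,4) by auto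
    then show ?thesis
      using ne i assms(3,4) unfolding \<rho>_def by (simp add: Transposition.transpose_def)
  qed
  have par: "odd (\<rho> i) \<longleftrightarrow> odd i" for i
  proof (cases "odd i \<or> i = 0")
    case True
    have "\<rho> 0 = 0" using assms(1,2) by (simp add: \<rho>_def Transposition.transpose_def)
    then show ?thesis using True o[of i] by auto
  next
    case False
    then obtain m where "i = Suc m" "odd m" by (cases i) auto
    then show ?thesis using o[of m] by simp
  qed
  have inj: "\<rho> i = \<rho> j \<longleftrightarrow> i = j" for i j
    unfolding \<rho>_def comp_apply by (simp add: inj_eq[OF inj_transpose])
  have "odd (\<rho> i) \<and> \<rho> j = Suc (\<rho> i) \<longleftrightarrow> odd i \<and> j = Suc i" for i j
  proof (cases "odd i")
    case True
    then have "Suc (\<rho> i) = \<rho> (Suc i)" using o[of i] by simp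
    then show ?thesis using par[of i] inj[of j "Suc i"] by simp
  qed (simp add: par)
  then show ?thesis by (simp only: symplectic_unit_def)
qed

text \<open>In the expansion of \<open>\<eta> \<and> (d\<eta>)\<^sup>n\<close> on a symplectic basis no terms cancel: a permutation with
  nonzero term permutes the pairs and swaps some pairs internally. Permuting pairs is an even
  permutation, and each internal swap changes the sign of the permutation and of one factor.
  By these two kinds of moves the last pair is brought to its place, and induction applies.\<close>

lemma symplectic_permutation_term:
  assumes "\<sigma> permutes {..<Suc (2 * n)}"
    and "(\<Prod>i<n. symplectic_unit (\<sigma> (2 * i + 1)) (\<sigma> (2 * i + 2))) \<noteq> 0"
  shows "\<sigma> 0 = 0 \<and> of_int (sign \<sigma>) * (\<Prod>i<n. symplectic_unit (\<sigma> (2 * i + 1)) (\<sigma> (2 * i + 2))) = (1 :: real)"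
  using assms
proof (induction n arbitrary: \<sigma>)
  case 0
  then have "\<sigma> permutes {0}" by (simp add: lessThan_Suc)
  then have "\<sigma> = id" by simp
  then show ?case by simp
next
  case (Suc n)
  let ?J = symplectic_unit
  let ?S = "{..<Suc (2 * Suc n)}"
  define a where "a = 2 * n + 1"
  define P where "P \<sigma> = (\<Prod>i<n. ?J (\<sigma> (2 * i + 1)) (\<sigma> (2 * i + 2)))" for \<sigma> :: "nat \<Rightarrow> nat"
  have prod: "(\<Prod>i<Suc n. ?J (\<sigma> (2 * i + 1)) (\<sigma> (2 * i + 2))) = P \<sigma> * ?J (\<sigma> a) (\<sigma> (Suc a))" for \<sigma>
    by (simp add: P_def a_def)
  have aS: "a \<in> ?S" "Suc a \<in> ?S" "odd a" "a \<noteq> 0" by (auto simp: a_def)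
  have \<sigma>: "\<sigma> permutes ?S" "P \<sigma> \<noteq> 0" "?J (\<sigma> a) (\<sigma> (Suc a)) \<noteq> 0"
    using Suc.prems prod[of \<sigma>] by auto
  have perm: "permutation \<sigma>'" if "\<sigma>' permutes ?S" for \<sigma>'
    using that permutes_imp_permutation[OF finite_lessThan] by blast
  have base: "\<sigma>' 0 = 0 \<and> of_int (sign \<sigma>') * (P \<sigma>' * ?J (\<sigma>' a) (\<sigma>' (Suc a))) = (1 :: real)"
    if \<sigma>': "\<sigma>' permutes ?S" "P \<sigma>' \<noteq> 0" "\<sigma>' a = a" "\<sigma>' (Suc a) = Suc a" for \<sigma>'
  proof -
    have "\<sigma>' permutes {..<Suc (2 * n)}"
    proof (rule permutes_superset[OF \<sigma>'(1)])
      fix x assume "x \<in> ?S - {..<Suc (2 * n)}"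
      then have "x = a \<or> x = Suc a" by (auto simp: a_def)
      then show "\<sigma>' x = x" using \<sigma>'(3,4) by blast
    qed
    from Suc.IH[OF this] \<sigma>'(2) have "\<sigma>' 0 = 0 \<and> of_int (sign \<sigma>') * P \<sigma>' = (1::real)"
      unfolding P_def by blast
    moreover have "?J a (Suc a) = 1" using aS(3) by (simp add: symplectic_unit_def)
    ultimately show ?thesis using \<sigma>'(3,4) by simp
  qed
  \<comment> \<open>if the last pair is in place but reversed, reverse it\<close>
  have straight_or_swapped: "\<sigma>' 0 = 0 \<and> of_int (sign \<sigma>') * (P \<sigma>' * ?J (\<sigma>' a) (\<sigma>' (Suc a))) = (1 :: real)"
    if \<sigma>': "\<sigma>' permutes ?S" "P \<sigma>' \<noteq> 0" "\<sigma>' a = a \<and> \<sigma>' (Suc a) = Suc a \<or> \<sigma>' a = Suc a \<and> \<sigma>' (Suc a) = a" for \<sigma>'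
    using \<sigma>'(3)
  proof
    assume "\<sigma>' a = a \<and> \<sigma>' (Suc a) = Suc a"
    then show ?thesis using base[OF \<sigma>'(1,2)] by blast
  next
    assume sw: "\<sigma>' a = Suc a \<and> \<sigma>' (Suc a) = a"
    let ?t = "Transposition.transpose a (Suc a)"
    have tp: "?t \<circ> \<sigma>' permutes ?S"
      by (rule permutes_compose[OF \<sigma>'(1) permutes_swap_id[OF aS(1,2)]])
    have inj: "\<sigma>' i = \<sigma>' j \<longleftrightarrow> i = j" for i j using permutes_inj[OF \<sigma>'(1)] by (simp add: inj_eq)
    have t: "?t (\<sigma>' i) = \<sigma>' i" if "i \<noteq> a" "i \<noteq> Suc a" for i
      using that inj[of i a] inj[of i "Suc a"] sw by (simp add: Transposition.transpose_def)
    have P: "P (?t \<circ> \<sigma>') = P \<sigma>'"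
      unfolding P_def
    proof (rule prod.cong[OF refl])
      fix i assume "i \<in> {..<n}"
      then have "2 * i + 1 \<noteq> a" "2 * i + 1 \<noteq> Suc a" "2 * i + 2 \<noteq> a" "2 * i + 2 \<noteq> Suc a"
        by (auto simp: a_def)
      then show "?J ((?t \<circ> \<sigma>') (2 * i + 1)) ((?t \<circ> \<sigma>') (2 * i + 2)) = ?J (\<sigma>' (2 * i + 1)) (\<sigma>' (2 * i + 2))"
        using t[of "2 * i + 1"] t[of "2 * i + 2"] by simp
    qed
    have last: "(?t \<circ> \<sigma>') a = a" "(?t \<circ> \<sigma>') (Suc a) = Suc a" using sw by simp_all
    have b: "(?t \<circ> \<sigma>') 0 = 0 \<and> of_int (sign (?t \<circ> \<sigma>')) * (P \<sigma>' * ?J a (Suc a)) = (1 :: real)"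
      using base[OF tp _ last] \<sigma>'(2) unfolding P last by blast
    have "sign (?t \<circ> \<sigma>') = - sign \<sigma>'"
      using sign_compose[OF permutation_swap_id perm[OF \<sigma>'(1)], of a "Suc a"] by (simp add: sign_swap_id)
    moreover have "?J (Suc a) a = - ?J a (Suc a)" by (rule symplectic_unit_skew)
    ultimately have "of_int (sign \<sigma>') * (P \<sigma>' * ?J (\<sigma>' a) (\<sigma>' (Suc a))) = (1 :: real)"
      using b sw by simp
    moreover have "\<sigma>' 0 = 0"
    proof -
      have "?t (\<sigma>' 0) = \<sigma>' 0" by (rule t) (use aS(4) in auto)
      then show ?thesis using b by simp
    qed
    ultimately show ?thesis by blast
  qed
  obtain b where b: "odd b" "\<sigma> a = b \<and> \<sigma> (Suc a) = Suc b \<or> \<sigma> a = Suc b \<and> \<sigma> (Suc a) = b"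
    using \<sigma>(3) unfolding symplectic_unit_def by (metis (full_types))
  have \<sigma>S: "\<sigma> a \<in> ?S" "\<sigma> (Suc a) \<in> ?S" using aS permutes_in_image[OF \<sigma>(1)] by blast+
  then have bS: "b \<in> ?S" "Suc b \<in> ?S" "b \<noteq> 0" using b by (auto simp: odd_pos)
  \<comment> \<open>exchange the pair that occupies the last two positions with the last pair\<close>
  define \<rho> where "\<rho> = Transposition.transpose a b \<circ> Transposition.transpose (Suc a) (Suc b)"
  have ne: "a \<noteq> Suc b" "b \<noteq> Suc a" using b(1) aS(3) by auto
  have \<rho>b: "\<rho> b = a" "\<rho> (Suc b) = Suc a"
    using ne by (auto simp: \<rho>_def Transposition.transpose_def)
  have \<rho>J: "?J (\<rho> i) (\<rho> j) = ?J i j" for i j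
    unfolding \<rho>_def by (rule symplectic_unit_pair_swap[OF aS(4) bS(3) aS(3) b(1)])
  have \<rho>S: "\<rho> permutes ?S" unfolding \<rho>_def
    by (rule permutes_compose[OF permutes_swap_id[OF aS(2) bS(2)] permutes_swap_id[OF aS(1) bS(1)]])
  have "sign \<rho> = 1" unfolding \<rho>_def
    using sign_compose[OF permutation_swap_id permutation_swap_id, of a b "Suc a" "Suc b"]
    by (simp add: sign_swap_id split: if_splits)
  then have sgn: "sign (\<rho> \<circ> \<sigma>) = sign \<sigma>" using sign_compose[OF perm[OF \<rho>S] perm[OF \<sigma>(1)]] by simp
  have P: "P (\<rho> \<circ> \<sigma>) = P \<sigma>" by (simp add: P_def \<rho>J)
  have 1: "(\<rho> \<circ> \<sigma>) a = a \<and> (\<rho> \<circ> \<sigma>) (Suc a) = Suc a \<or> (\<rho> \<circ> \<sigma>) a = Suc a \<and> (\<rho> \<circ> \<sigma>) (Suc a) = a"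
    using b(2) \<rho>b by auto
  have 2: "P (\<rho> \<circ> \<sigma>) \<noteq> 0" using P \<sigma>(2) by simp
  from straight_or_swapped[OF permutes_compose[OF \<sigma>(1) \<rho>S] 2 1]
  have "\<rho> (\<sigma> 0) = 0 \<and> of_int (sign \<sigma>) * (P \<sigma> * ?J (\<sigma> a) (\<sigma> (Suc a))) = (1 :: real)"
    unfolding sgn P by (simp add: \<rho>J)
  moreover have "\<rho> 0 = 0" using aS(4) bS(3) by (simp add: \<rho>_def Transposition.transpose_def)
  ultimately show ?case
    unfolding prod using permutes_inj[OF \<rho>S] by (metis inj_eq)
qed

lemma wedge_nonzero_of_symplectic_frame:
  assumes "a (X 0) p = 1"
    and W: "\<And>i j. i \<le> 2 * n \<Longrightarrow> j \<le> 2 * n \<Longrightarrow> W (X i) (X j) p = symplectic_unit i j"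
  shows "wedge 1 (2 * n) (\<lambda>X. a (X 0)) (wedge_power2 (\<lambda>X. W (X 0) (X 1)) n) X p \<noteq> 0"
proof -
  obtain c where c: "c > 0" "\<And>X p. wedge 1 (2 * n) (\<lambda>X. a (X 0)) (wedge_power2 (\<lambda>X. W (X 0) (X 1)) n) X p =
     c * (\<Sum>\<sigma> | \<sigma> permutes {..<Suc (2 * n)}. of_int (sign \<sigma>) * a (X (\<sigma> 0)) p *
       (\<Prod>i<n. W (X (\<sigma> (2 * i + 1))) (X (\<sigma> (2 * i + 2))) p))"
    using wedge_1_power2_eq[of n a W] by blast
  let ?P = "{\<sigma>. \<sigma> permutes {..<Suc (2 * n)}}"
  define T where "T \<sigma> = of_int (sign \<sigma>) * a (X (\<sigma> 0)) p *
       (\<Prod>i<n. W (X (\<sigma> (2 * i + 1))) (X (\<sigma> (2 * i + 2))) p)" for \<sigma>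
  have T: "T \<sigma> \<ge> 0" if "\<sigma> \<in> ?P" for \<sigma>
  proof -
    have s: "\<sigma> permutes {..<Suc (2 * n)}" using that by simp
    have eq: "(\<Prod>i<n. W (X (\<sigma> (2 * i + 1))) (X (\<sigma> (2 * i + 2))) p)
        = (\<Prod>i<n. symplectic_unit (\<sigma> (2 * i + 1)) (\<sigma> (2 * i + 2)))"
    proof (rule prod.cong[OF refl], rule W)
      fix i assume "i \<in> {..<n}"
      then have i: "2 * i + 1 \<in> {..<Suc (2 * n)}" "2 * i + 2 \<in> {..<Suc (2 * n)}" by auto
      have "\<sigma> (2 * i + 1) \<in> {..<Suc (2 * n)}" "\<sigma> (2 * i + 2) \<in> {..<Suc (2 * n)}"
        unfolding permutes_in_image[OF s] by (rule i)+
      then show "\<sigma> (2 * i + 1) \<le> 2 * n" "\<sigma> (2 * i + 2) \<le> 2 * n"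
        by (simp_all only: lessThan_iff less_Suc_eq_le)
    qed
    show ?thesis
    proof (cases "(\<Prod>i<n. symplectic_unit (\<sigma> (2 * i + 1)) (\<sigma> (2 * i + 2))) = 0")
      case True
      then show ?thesis by (simp only: T_def eq mult_zero_right order_refl)
    next
      case False
      from symplectic_permutation_term[OF s False] assms(1) show ?thesis
        unfolding T_def eq by simp
    qed
  qed
  have id: "id \<in> ?P" by (simp add: permutes_id)
  have "T id = 1"
  proof -
    have "(\<Prod>i<n. W (X (2 * i + 1)) (X (2 * i + 2)) p) = (\<Prod>i<n. 1)"
      by (rule prod.cong[OF refl]) (subst W, auto simp: symplectic_unit_def)
    then show ?thesis by (simp add: T_def assms(1))
  qed
  have "0 < T id" using \<open>T id = 1\<close> by simp
  then have "0 < sum T ?P"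
    by (rule sum_pos2[OF finite_permutations[OF finite_lessThan] id]) (rule T)
  then show ?thesis unfolding c(2) T_def[symmetric] using c(1) by simp
qed

section \<open>Tensor calculus on vector fields\<close>

context smooth_atlas begin

lemma deriv_along_simps:
  assumes "X \<in> VF" "smooth u" "smooth w"
  shows "deriv_along X (u + w) = deriv_along X u + deriv_along X w"
    "deriv_along X (u - w) = deriv_along X u - deriv_along X w"
    "deriv_along X (- u) = - deriv_along X u"
    "deriv_along X (c *\<^sub>R u) = c *\<^sub>R deriv_along X u"
    "deriv_along X (u * w) = u * deriv_along X w + w * deriv_along X u"
  using tangent_add[OF VF_TM[OF assms(1)] assms(2,3)] tangent_diff[OF VF_TM[OF assms(1)] assms(2,3)]
    tangent_uminus[OF VF_TM[OF assms(1)] assms(2)] tangent_scaleR[OF VF_TM[OF assms(1)] assms(2)]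
    tangent_mult[OF VF_TM[OF assms(1)] assms(2,3)]
  by (auto simp: deriv_along_def)

lemma deriv_along_const:
  assumes "X \<in> VF" shows "deriv_along X 0 = 0" "deriv_along X 1 = 0"
  using tangent_zero[OF VF_TM[OF assms]] tangent_one[OF VF_TM[OF assms]]
  by (auto simp: deriv_along_def)

lemma deriv_along_field_simps:
  "deriv_along (X + Y) u = deriv_along X u + deriv_along Y u"
  "deriv_along (X - Y) u = deriv_along X u - deriv_along Y u"
  "deriv_along (fscale w X) u = w * deriv_along X u"
  by (auto simp: deriv_along_def fscale_def)

lemma deriv_along_lie_bracket:
  "deriv_along (lie_bracket X Y) u = deriv_along X (deriv_along Y u) - deriv_along Y (deriv_along X u)"
  by (auto simp: deriv_along_def lie_bracket_def)

text \<open>Both sides are compared on all functions, including those that are not smooth, on which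
  every tangent vector vanishes.\<close>

lemma lie_bracket_Jacobi:
  assumes "X \<in> VF" "Y \<in> VF" "Z \<in> VF"
  shows "lie_bracket (lie_bracket X Y) Z + lie_bracket (lie_bracket Y Z) X + lie_bracket (lie_bracket Z X) Y = 0"
proof (intro ext)
  fix p u
  have ns: "deriv_along X u = 0" if "X \<in> VF" "\<not> smooth u" for X
    using tangent_not_smooth[OF VF_TM[OF that(1)] that(2)] by (auto simp: deriv_along_def)
  have double: "lie_bracket (lie_bracket X Y) Z p u =
      X p (deriv_along Y (deriv_along Z u)) - Y p (deriv_along X (deriv_along Z u))
      - (Z p (deriv_along X (deriv_along Y u)) - Z p (deriv_along Y (deriv_along X u)))"
    if "X \<in> VF" "Y \<in> VF" "Z \<in> VF" for X Y Z
  proof -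
    have "Z p (deriv_along X (deriv_along Y u) - deriv_along Y (deriv_along X u))
        = Z p (deriv_along X (deriv_along Y u)) - Z p (deriv_along Y (deriv_along X u))"
    proof (cases "smooth u")
      case True
      show ?thesis by (rule tangent_diff[OF VF_TM[OF that(3)]]) (simp_all only: VF_smooth that True)
    next
      case False
      have z: "deriv_along W 0 = 0" if "W \<in> VF" for W
        using tangent_zero[OF VF_TM[OF that]] by (auto simp: deriv_along_def)
      show ?thesis
        by (simp only: ns[OF that(1) False] ns[OF that(2) False] z[OF that(1)] z[OF that(2)]
          tangent_zero[OF VF_TM[OF that(3)]] diff_0_right)
    qed
    moreover have "lie_bracket (lie_bracket X Y) Z p u = lie_bracket X Y p (deriv_along Z u)
        - Z p (deriv_along (lie_bracket X Y) u)"
      by (simp only: lie_bracket_def[of "lie_bracket X Y"])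
    ultimately show ?thesis
      by (simp only: deriv_along_lie_bracket) (simp only: lie_bracket_def[of X Y])
  qed
  show "(lie_bracket (lie_bracket X Y) Z + lie_bracket (lie_bracket Y Z) X + lie_bracket (lie_bracket Z X) Y) p u = 0 p u"
    unfolding plus_fun_apply zero_fun_apply double[OF assms] double[OF assms(2,3,1)] double[OF assms(3,1,2)]
    by simp
qed

lemma fscale_simps:
  "fscale u (X + Y) = fscale u X + fscale u Y"
  "fscale u (X - Y) = fscale u X - fscale u Y"
  "fscale (u + w) X = fscale u X + fscale w X"
  "fscale (u - w) X = fscale u X - fscale w X"
  "fscale 0 X = 0" "fscale 1 X = X" "fscale u 0 = 0" "fscale u (fscale w X) = fscale (u * w) X"
  "fscale (- u) X = - fscale u X" "fscale u (- X) = - fscale u X"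
  by (auto simp: fscale_def algebra_simps)

lemma scaleR_eq_fscale: "c *\<^sub>R X = fscale (\<lambda>p. c) X"
  by (auto simp: fscale_def)

context
  fixes F assumes F: "tensor11 A F"
begin

lemma tensor11_VF: "X \<in> VF \<Longrightarrow> app11 F X \<in> VF"
  and tensor11_TM: "v \<in> TM p \<Longrightarrow> F p v \<in> TM p"
  and tensor11_add_at: "v \<in> TM p \<Longrightarrow> w \<in> TM p \<Longrightarrow> F p (v + w) = F p v + F p w"
  and tensor11_scaleR_at: "v \<in> TM p \<Longrightarrow> F p (c *\<^sub>R v) = c *\<^sub>R F p v"
  using F unfolding tensor11_def by blast+

lemma tensor11_add: "X \<in> VF \<Longrightarrow> Y \<in> VF \<Longrightarrow> app11 F (X + Y) = app11 F X + app11 F Y"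
  by (intro ext) (simp add: app11_def tensor11_add_at VF_TM)

lemma tensor11_fscale: "X \<in> VF \<Longrightarrow> app11 F (fscale u X) = fscale u (app11 F X)"
  by (intro ext) (simp add: app11_def fscale_def tensor11_scaleR_at VF_TM)

lemma tensor11_scaleR: "X \<in> VF \<Longrightarrow> app11 F (c *\<^sub>R X) = c *\<^sub>R app11 F X"
  using tensor11_fscale unfolding scaleR_eq_fscale .

lemma tensor11_uminus: "X \<in> VF \<Longrightarrow> app11 F (- X) = - app11 F X"
  using tensor11_scaleR[of X "-1"] by simp

lemma tensor11_diff: "X \<in> VF \<Longrightarrow> Y \<in> VF \<Longrightarrow> app11 F (X - Y) = app11 F X - app11 F Y"
  using tensor11_add[of X "- Y"] by (simp add: tensor11_uminus)

lemma tensor11_zero_at: "F p 0 = 0"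
  using tensor11_scaleR_at[OF TM_zero, of p 0] by simp

lemma tensor11_zero: "app11 F 0 = 0"
  by (intro ext) (simp add: app11_def tensor11_zero_at)

end

context
  fixes \<eta> assumes eta: "one_form A \<eta>"
begin

lemma one_form_smooth: "X \<in> VF \<Longrightarrow> smooth (app1 \<eta> X)"
  and one_form_add_at: "v \<in> TM p \<Longrightarrow> w \<in> TM p \<Longrightarrow> \<eta> p (v + w) = \<eta> p v + \<eta> p w"
  and one_form_scaleR_at: "v \<in> TM p \<Longrightarrow> \<eta> p (c *\<^sub>R v) = c * \<eta> p v"
  using eta unfolding one_form_def by blast+

lemma one_form_add: "X \<in> VF \<Longrightarrow> Y \<in> VF \<Longrightarrow> app1 \<eta> (X + Y) = app1 \<eta> X + app1 \<eta> Y"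
  by (rule ext) (simp add: app1_def one_form_add_at VF_TM)

lemma one_form_fscale: "X \<in> VF \<Longrightarrow> app1 \<eta> (fscale u X) = u * app1 \<eta> X"
  by (rule ext) (simp add: app1_def fscale_def one_form_scaleR_at VF_TM)

lemma one_form_uminus: "X \<in> VF \<Longrightarrow> app1 \<eta> (- X) = - app1 \<eta> X"
  using one_form_fscale[of X "-1"] by (simp add: fscale_simps)

lemma one_form_diff: "X \<in> VF \<Longrightarrow> Y \<in> VF \<Longrightarrow> app1 \<eta> (X - Y) = app1 \<eta> X - app1 \<eta> Y"
  using one_form_add[of X "- Y"] by (simp add: one_form_uminus)

lemma one_form_zero: "app1 \<eta> 0 = 0"
  using one_form_fscale[of 0 0] by (simp add: fscale_simps)

end

context
  fixes g assumes g: "riemannian_metric A g"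
begin

lemma metric_smooth: "X \<in> VF \<Longrightarrow> Y \<in> VF \<Longrightarrow> smooth (app2 g X Y)"
  and metric_add_at: "v \<in> TM p \<Longrightarrow> w \<in> TM p \<Longrightarrow> z \<in> TM p \<Longrightarrow> g p (v + w) z = g p v z + g p w z"
  and metric_scaleR_at: "v \<in> TM p \<Longrightarrow> w \<in> TM p \<Longrightarrow> g p (c *\<^sub>R v) w = c * g p v w"
  and metric_sym_at: "v \<in> TM p \<Longrightarrow> w \<in> TM p \<Longrightarrow> g p v w = g p w v"
  and metric_pos_at: "v \<in> TM p \<Longrightarrow> v \<noteq> 0 \<Longrightarrow> g p v v > 0"
  using g unfolding riemannian_metric_def by blast+

lemma metric_sym: "X \<in> VF \<Longrightarrow> Y \<in> VF \<Longrightarrow> app2 g X Y = app2 g Y X"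
  by (rule ext, unfold app2_def, rule metric_sym_at) (simp_all add: VF_TM)

lemma metric_add_left:
  "X \<in> VF \<Longrightarrow> Y \<in> VF \<Longrightarrow> Z \<in> VF \<Longrightarrow> app2 g (X + Y) Z = app2 g X Z + app2 g Y Z"
  by (rule ext) (simp add: app2_def metric_add_at VF_TM)

lemma metric_fscale_left: "X \<in> VF \<Longrightarrow> Y \<in> VF \<Longrightarrow> app2 g (fscale u X) Y = u * app2 g X Y"
  by (rule ext) (simp add: app2_def fscale_def metric_scaleR_at VF_TM)

lemma metric_scaleR_left: "X \<in> VF \<Longrightarrow> Y \<in> VF \<Longrightarrow> app2 g (c *\<^sub>R X) Y = c *\<^sub>R app2 g X Y"
  using metric_fscale_left[of X Y "\<lambda>p. c"] unfolding scaleR_eq_fscale by (simp add: fun_eq_iff)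

lemma metric_uminus_left: "X \<in> VF \<Longrightarrow> Y \<in> VF \<Longrightarrow> app2 g (- X) Y = - app2 g X Y"
  using metric_fscale_left[of X Y "-1"] by (simp add: fscale_simps)

lemma metric_diff_left:
  "X \<in> VF \<Longrightarrow> Y \<in> VF \<Longrightarrow> Z \<in> VF \<Longrightarrow> app2 g (X - Y) Z = app2 g X Z - app2 g Y Z"
  using metric_add_left[of X "- Y" Z] by (simp add: metric_uminus_left)

lemma metric_zero_left: "X \<in> VF \<Longrightarrow> app2 g 0 X = 0"
  using metric_scaleR_left[of 0 X 0] by simp

lemma metric_right:
  assumes "X \<in> VF" "Y \<in> VF" "Z \<in> VF"
  shows "app2 g Z (X + Y) = app2 g Z X + app2 g Z Y"
    "app2 g Z (X - Y) = app2 g Z X - app2 g Z Y"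
    "app2 g Z (- X) = - app2 g Z X"
    "app2 g Z (c *\<^sub>R X) = c *\<^sub>R app2 g Z X"
    "app2 g Z 0 = 0"
  using assms by (simp_all add: metric_sym[OF assms(3)] metric_add_left metric_diff_left
      metric_uminus_left metric_scaleR_left metric_zero_left)

lemma metric_fscale_right:
  assumes "X \<in> VF" "Z \<in> VF" "smooth u"
  shows "app2 g Z (fscale u X) = u * app2 g Z X"
  using assms by (simp add: metric_sym[OF assms(2)] metric_fscale_left)

lemma metric_eq_zeroD: "v \<in> TM p \<Longrightarrow> g p v v = 0 \<Longrightarrow> v = 0"
  using metric_pos_at by fastforce

end

context
  fixes D assumes D: "affine_connection A D"
begin

lemma connection_VF: "X \<in> VF \<Longrightarrow> Y \<in> VF \<Longrightarrow> D X Y \<in> VF"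
  and connection_add_left: "X \<in> VF \<Longrightarrow> Y \<in> VF \<Longrightarrow> Z \<in> VF \<Longrightarrow> D (X + Y) Z = D X Z + D Y Z"
  and connection_add_right: "X \<in> VF \<Longrightarrow> Y \<in> VF \<Longrightarrow> Z \<in> VF \<Longrightarrow> D X (Y + Z) = D X Y + D X Z"
  and connection_fscale_left: "X \<in> VF \<Longrightarrow> Y \<in> VF \<Longrightarrow> smooth u \<Longrightarrow> D (fscale u X) Y = fscale u (D X Y)"
  and connection_fscale_right: "X \<in> VF \<Longrightarrow> Y \<in> VF \<Longrightarrow> smooth u \<Longrightarrow>
    D X (fscale u Y) = fscale (deriv_along X u) Y + fscale u (D X Y)"
  using D unfolding affine_connection_def by blast+

lemma connection_zero_left: "Y \<in> VF \<Longrightarrow> D 0 Y = 0"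
  using connection_add_left[of 0 0 Y] by simp

lemma connection_zero_right: "X \<in> VF \<Longrightarrow> D X 0 = 0"
  using connection_add_right[of X 0 0] by simp

lemma connection_uminus_left: "X \<in> VF \<Longrightarrow> Y \<in> VF \<Longrightarrow> D (- X) Y = - D X Y"
  using connection_add_left[of X "- X" Y] by (simp add: connection_zero_left eq_neg_iff_add_eq_0 add.commute)

lemma connection_diff_left: "X \<in> VF \<Longrightarrow> Y \<in> VF \<Longrightarrow> Z \<in> VF \<Longrightarrow> D (X - Y) Z = D X Z - D Y Z"
  using connection_add_left[of X "- Y" Z] by (simp add: connection_uminus_left)

end

end

section \<open>Weak quasi-contact metric manifolds\<close>

context smooth_atlas begin

text \<open>A linear parametrisation \<open>L\<close> of a tangent space, with inverse \<open>K\<close>. It transports tensors at \<open>p\<close> to the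
  Euclidean space, where maps are linear without side conditions.\<close>

lemma tangent_coordinates:
  "\<exists>(L :: 'e \<Rightarrow> 'm tangent) K. linear L \<and> (\<forall>x. L x \<in> TM p) \<and> (\<forall>v\<in>TM p. L (K v) = v) \<and> (\<forall>x. K (L x) = x)"
proof -
  obtain L :: "'e \<Rightarrow> 'm tangent" where L: "linear L" "bij_betw L UNIV (TM p)"
    using tangent_space_iso by blast
  have "(\<forall>x. L x \<in> TM p) \<and> (\<forall>v\<in>TM p. L (inv L v) = v) \<and> (\<forall>x. inv L (L x) = x)"
    using L(2) by (auto simp: bij_betw_def f_inv_into_f)
  then show ?thesis using L(1) by blast
qed

lemma pullback_linear:
  assumes L: "linear L" "\<And>x. L x \<in> TM p" "\<And>v. v \<in> TM p \<Longrightarrow> L (K v) = v" "\<And>x. K (L x) = x"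
    and F: "tensor11 A F"
  shows "linear (\<lambda>x. K (F p (L x)))"
proof (rule linearI)
  note t = tensor11_TM[OF F L(2)]
  show "K (F p (L (x + y))) = K (F p (L x)) + K (F p (L y))" for x y
  proof -
    have "F p (L (x + y)) = L (K (F p (L x)) + K (F p (L y)))"
      by (simp only: linear_add[OF L(1)] tensor11_add_at[OF F L(2) L(2)] L(3)[OF t])
    then show ?thesis by (simp only: L(4))
  qed
  show "K (F p (L (c *\<^sub>R x))) = c *\<^sub>R K (F p (L x))" for c x
  proof -
    have "F p (L (c *\<^sub>R x)) = L (c *\<^sub>R K (F p (L x)))"
      by (simp only: linear_cmul[OF L(1)] tensor11_scaleR_at[OF F L(2)] L(3)[OF t])
    then show ?thesis by (simp only: L(4))
  qed
qed

lemma pullback_inner_form: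
  assumes L: "linear L" "\<And>x. L x \<in> TM p" "\<And>x. K (L x) = x" and g: "riemannian_metric A g"
  shows "inner_form (\<lambda>x y. g p (L x) (L y))"
  unfolding inner_form_def
proof (intro conjI allI impI)
  show sym: "g p (L x) (L y) = g p (L y) (L x)" for x y by (rule metric_sym_at[OF g L(2) L(2)])
  have lin: "linear (\<lambda>x. g p (L x) (L y))" for y
    by (rule linearI)
      (simp_all only: linear_add[OF L(1)] linear_cmul[OF L(1)] metric_add_at[OF g L(2) L(2) L(2)]
        metric_scaleR_at[OF g L(2) L(2)] real_scaleR_def)
  show "bilinear (\<lambda>x y. g p (L x) (L y))"
    unfolding bilinear_def
  proof (intro conjI allI)
    show "linear (\<lambda>x. g p (L x) (L y))" for y by (rule lin)
    have "(\<lambda>y. g p (L x) (L y)) = (\<lambda>y. g p (L y) (L x))" for x using sym by (intro ext)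
    then show "linear (\<lambda>y. g p (L x) (L y))" for x using lin by simp
  qed
  show "0 < g p (L x) (L x)" if "x \<noteq> 0" for x
  proof (rule metric_pos_at[OF g L(2)])
    show "L x \<noteq> 0" using that L(3)[of x] L(3)[of 0] linear_0[OF L(1)] by metis
  qed
qed

end

text \<open>In this locale \<open>ip\<close>, \<open>F\<close>, \<open>QQ\<close>, \<open>H\<close>, \<open>et\<close> denote the actions of \<open>g\<close>, \<open>f\<close>, \<open>Q\<close>, \<open>h\<close>, \<open>\<eta>\<close>
  on vector fields.\<close>

locale weak_quasi_contact = smooth_atlas A
  for A :: "('m::{t2_space, second_countable_topology}, 'e::euclidean_space) atlas" +
  fixes n :: nat and f Q :: "'m tensor11" and \<xi> :: "'m vfield" and \<eta> :: "'m covector"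
    and g :: "'m tensor02" and D :: "'m connection"
  assumes odd_dimension: "DIM('e) = 2 * n + 1"
    and quasi_contact_structure: "weak_quasi_contact_metric A f Q \<xi> \<eta> g D"
begin

abbreviation ip where "ip \<equiv> app2 g"
abbreviation F where "F \<equiv> app11 f"
abbreviation QQ where "QQ \<equiv> app11 Q"
abbreviation H where "H \<equiv> tensor_h f \<xi>"
abbreviation et where "et \<equiv> app1 \<eta>"

lemma almost_contact: "weak_almost_contact_metric A f Q \<xi> \<eta> g" and D_levi_civita: "levi_civita A g D"
  using quasi_contact_structure unfolding weak_quasi_contact_metric_def by blast+

lemma f_tensor: "tensor11 A f" and Q_tensor: "tensor11 A Q" and Q_nonsingular: "nonsingular A Q"
  and xi_VF [simp]: "\<xi> \<in> VF" and eta_form: "one_form A \<eta>" and g_metric: "riemannian_metric A g"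
  and et_xi [simp]: "et \<xi> = 1"
  and F_F: "X \<in> VF \<Longrightarrow> F (F X) = - QQ X + fscale (et X) \<xi>"
  and ip_F_F: "X \<in> VF \<Longrightarrow> Y \<in> VF \<Longrightarrow> ip (F X) (F Y) = ip X (QQ Y) - et X * et Y"
  and et_ip: "X \<in> VF \<Longrightarrow> ip \<xi> X = et X"
  using almost_contact unfolding weak_almost_contact_metric_def by auto

lemma D_affine: "affine_connection A D"
  and torsion: "X \<in> VF \<Longrightarrow> Y \<in> VF \<Longrightarrow> lie_bracket X Y = D X Y - D Y X"
  and compat: "X \<in> VF \<Longrightarrow> Y \<in> VF \<Longrightarrow> Z \<in> VF \<Longrightarrow> deriv_along X (ip Y Z) = ip (D X Y) Z + ip Y (D X Z)"
  using D_levi_civita unfolding levi_civita_def by auto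

lemma quasi_contact_eq: "X \<in> VF \<Longrightarrow> Y \<in> VF \<Longrightarrow>
    cov_deriv11 D X f Y + cov_deriv11 D (F X) f (F Y)
        = fscale (2 * ip X Y) \<xi> - fscale (et Y) (X + H X + fscale (et X) \<xi>)"
  using quasi_contact_structure unfolding weak_quasi_contact_metric_def by blast

lemmas closure [simp] = tensor11_VF[OF f_tensor] tensor11_VF[OF Q_tensor] connection_VF[OF D_affine]
  one_form_smooth[OF eta_form] metric_smooth[OF g_metric]

lemma bracket_VF [simp]: "X \<in> VF \<Longrightarrow> Y \<in> VF \<Longrightarrow> lie_bracket X Y \<in> VF"
  by (simp add: torsion)

lemma H_VF [simp]: "X \<in> VF \<Longrightarrow> H X \<in> VF"
  by (simp add: tensor_h_def lie_deriv11_def)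

lemma cov_VF [simp]: "X \<in> VF \<Longrightarrow> Y \<in> VF \<Longrightarrow> cov_deriv11 D X f Y \<in> VF"
  by (simp add: cov_deriv11_def)

lemmas lin_simps =
  tensor11_add[OF f_tensor] tensor11_diff[OF f_tensor] tensor11_uminus[OF f_tensor] tensor11_fscale[OF f_tensor]
  tensor11_scaleR[OF f_tensor] tensor11_zero[OF f_tensor]
  tensor11_add[OF Q_tensor] tensor11_diff[OF Q_tensor] tensor11_uminus[OF Q_tensor] tensor11_fscale[OF Q_tensor]
  tensor11_scaleR[OF Q_tensor] tensor11_zero[OF Q_tensor]
  one_form_add[OF eta_form] one_form_diff[OF eta_form] one_form_uminus[OF eta_form] one_form_fscale[OF eta_form] one_form_zero[OF eta_form]
  metric_add_left[OF g_metric] metric_diff_left[OF g_metric] metric_uminus_left[OF g_metric] metric_fscale_left[OF g_metric]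
  metric_scaleR_left[OF g_metric] metric_zero_left[OF g_metric] metric_right[OF g_metric] metric_fscale_right[OF g_metric]
  connection_add_left[OF D_affine] connection_add_right[OF D_affine] connection_diff_left[OF D_affine]
  connection_uminus_left[OF D_affine] connection_zero_left[OF D_affine] connection_zero_right[OF D_affine]
  connection_fscale_left[OF D_affine] connection_fscale_right[OF D_affine]

lemma connection_zero_at:
  assumes "X \<in> VF" "Y \<in> VF" "X p = 0"
  shows "D X Y p = 0"
proof -
  have "ip (D X Y) (D X Y) p = 0"
    by (rule tensorial_zero[of "\<lambda>V. ip (D V Y) (D X Y) p" p X, OF _ _ assms(1,3)])
      (simp_all add: lin_simps assms(1,2))
  then have "g p (D X Y p) (D X Y p) = 0" by (simp only: app2_def)
  then show ?thesis by (rule metric_eq_zeroD[OF g_metric VF_TM[OF connection_VF[OF D_affine assms(1,2)]]])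
qed

text \<open>Combining the two compatibility axioms gives \<open>g(f v, f w) = - g(v, f (f w))\<close>, to which
  \<open>skew_of_norm_identity\<close> applies.\<close>

lemma skew_at:
  assumes "v \<in> TM p" "w \<in> TM p"
  shows "g p (f p v) w = - g p v (f p w)"
proof -
  obtain L :: "'e \<Rightarrow> 'm tangent" and K where L: "linear L" "\<And>x. L x \<in> TM p" "\<And>v. v \<in> TM p \<Longrightarrow> L (K v) = v" "\<And>x. K (L x) = x"
    using tangent_coordinates[of p] by blast
  note t = tensor11_TM[OF f_tensor L(2)]
  have gff': "g p (f p v) (f p w) = - g p v (f p (f p w))" if vw: "v \<in> TM p" "w \<in> TM p" for v w
  proof -
    obtain X Y where X: "X \<in> VF" "X p = v" and Y: "Y \<in> VF" "Y p = w"
      using tangent_extension[OF vw(1)] tangent_extension[OF vw(2)] by metis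
    have "ip (F X) (F Y) = - ip X (F (F Y))"
      using ip_F_F[OF X(1) Y(1)] F_F[OF Y(1)] X Y
      by (simp add: lin_simps metric_sym[OF g_metric X(1) xi_VF] et_ip)
    then have "ip (F X) (F Y) p = (- ip X (F (F Y))) p" by (rule fun_cong)
    then show ?thesis by (simp add: app2_def app11_def X(2) Y(2))
  qed
  define gh where "gh x y = g p (L x) (L y)" for x y
  define fh where "fh x = K (f p (L x))" for x
  have Lf: "L (fh x) = f p (L x)" for x unfolding fh_def by (rule L(3)[OF t])
  have "inner_form gh" unfolding gh_def[abs_def] by (rule pullback_inner_form[of L p K g, OF L(1,2,4) g_metric])
  moreover have "linear fh" unfolding fh_def[abs_def] by (rule pullback_linear[of L p K f, OF L f_tensor])
  moreover have "gh (fh x) (fh y) = - gh x (fh (fh y))" for x y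
    unfolding gh_def Lf by (rule gff'[OF L(2) L(2)])
  ultimately have "gh (fh (K v)) (K w) = - gh (K v) (fh (K w))"
    by (rule skew_of_norm_identity)
  then show ?thesis by (simp only: gh_def Lf L(3)[OF assms(1)] L(3)[OF assms(2)])
qed

lemma F_skew: "X \<in> VF \<Longrightarrow> Y \<in> VF \<Longrightarrow> ip (F X) Y = - ip X (F Y)"
  by (rule ext) (simp add: app2_def app11_def skew_at VF_TM)

lemma cov_F_skew:
  assumes "X \<in> VF" "Y \<in> VF" "Z \<in> VF"
  shows "ip (cov_deriv11 D X f Y) Z = - ip Y (cov_deriv11 D X f Z)"
proof -
  have "deriv_along X (ip (F Y) Z) = deriv_along X (- ip Y (F Z))"
    using F_skew[OF assms(2,3)] by (rule arg_cong)
  then have 1: "ip (D X (F Y)) Z + ip (F Y) (D X Z) = - (ip (D X Y) (F Z) + ip Y (D X (F Z)))"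
    using assms by (simp only: deriv_along_simps(3)[OF assms(1) metric_smooth[OF g_metric] smooth_const(2)] compat closure)
  have 2: "ip (F (D X Y)) Z = - ip (D X Y) (F Z)" "ip (F Y) (D X Z) = - ip Y (F (D X Z))"
    using assms by (simp_all add: F_skew)
  show ?thesis
  proof
    fix p
    have "ip (D X (F Y) - F (D X Y)) Z = ip (D X (F Y)) Z - ip (F (D X Y)) Z"
      "ip Y (D X (F Z) - F (D X Z)) = ip Y (D X (F Z)) - ip Y (F (D X Z))"
      using assms by (simp_all add: lin_simps)
    then show "ip (cov_deriv11 D X f Y) Z p = (- ip Y (cov_deriv11 D X f Z)) p"
      using fun_cong[OF 1, of p] fun_cong[OF 2(1), of p] fun_cong[OF 2(2), of p]
      by (simp add: cov_deriv11_def)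
  qed
qed

lemma cov_F_self:
  assumes "X \<in> VF" "Y \<in> VF" shows "ip (cov_deriv11 D X f Y) Y = 0"
proof -
  have "ip (cov_deriv11 D X f Y) Y p = - ip (cov_deriv11 D X f Y) Y p" for p
    using cov_F_skew[OF assms(1,2,2)] metric_sym[OF g_metric assms(2) cov_VF[OF assms]] by (metis uminus_apply)
  then show ?thesis by (simp add: fun_eq_iff)
qed

text \<open>The definition of \<open>h\<close> with Lie brackets expressed by the torsion-free connection.\<close>

lemma two_H:
  assumes "X \<in> VF"
  shows "H X + H X = cov_deriv11 D \<xi> f X - D (F X) \<xi> + F (D X \<xi>)"
proof -
  have "H X + H X = lie_deriv11 \<xi> f X"
    unfolding tensor_h_def by (simp flip: scaleR_2)
  also have "\<dots> = cov_deriv11 D \<xi> f X - D (F X) \<xi> + F (D X \<xi>)"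
    unfolding lie_deriv11_def cov_deriv11_def using assms
    by (simp add: torsion lin_simps)
  finally show ?thesis .
qed

end

section \<open>The characteristic vector field\<close>

lemma cancel_double:
  fixes b c d e :: "'a::ab_group_add"
  assumes "c + c = - b + (d + c - e)" shows "b = d - c - e"
proof -
  have "b + c + c = d + c - e" using assms by (simp add: algebra_simps)
  then have "b + c = d - e" by (simp add: algebra_simps)
  then show ?thesis by (simp add: algebra_simps)
qed

context weak_quasi_contact begin

lemma ff_at:
  assumes "v \<in> TM p" shows "f p (f p v) = - Q p v + \<eta> p v *\<^sub>R \<xi> p"
proof -
  obtain X where X: "X \<in> VF" "X p = v" by (rule tangent_extension[OF assms])
  have "F (F X) p = (- QQ X + fscale (et X) \<xi>) p" using F_F[OF X(1)] by (rule fun_cong)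
  then show ?thesis
    unfolding app11_def app1_def fscale_def X(2)[symmetric] by (simp only: plus_fun_apply uminus_apply)
qed

lemma Q_inj_at: "v \<in> TM p \<Longrightarrow> w \<in> TM p \<Longrightarrow> Q p v = Q p w \<Longrightarrow> v = w"
  using Q_nonsingular unfolding nonsingular_def bij_betw_def inj_on_def by blast

text \<open>A kernel vector \<open>v\<close> of \<open>f\<close> exists because the dimension is odd. It satisfies \<open>Q v = \<eta>(v) \<xi>\<close>, so that
  \<open>\<eta>(v) \<noteq> 0\<close> by injectivity of \<open>Q\<close>.\<close>

lemma kernel_f_at: "\<exists>v\<in>TM p. f p v = 0 \<and> \<eta> p v = 1"
proof -
  obtain L :: "'e \<Rightarrow> 'm tangent" and K where L: "linear L" "\<And>x. L x \<in> TM p" "\<And>v. v \<in> TM p \<Longrightarrow> L (K v) = v" "\<And>x. K (L x) = x"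
    using tangent_coordinates[of p] by blast
  define gh where "gh x y = g p (L x) (L y)" for x y
  define fh where "fh x = K (f p (L x))" for x
  note t = tensor11_TM[OF f_tensor L(2)]
  have Lf: "L (fh x) = f p (L x)" for x unfolding fh_def by (rule L(3)[OF t])
  have "inner_form gh" unfolding gh_def[abs_def] by (rule pullback_inner_form[of L p K g, OF L(1,2,4) g_metric])
  then have gh: "bilinear gh" "gh x y = gh y x" for x y by (simp_all add: inner_form_def)
  have lin: "linear fh" unfolding fh_def[abs_def] by (rule pullback_linear[of L p K f, OF L f_tensor])
  have sk: "gh (fh x) y = - gh x (fh y)" for x y
    unfolding gh_def Lf by (rule skew_at[OF L(2) L(2)])
  define Om where "Om x y = gh x (fh y)" for x y
  have "bilinear Om" unfolding bilinear_def Om_def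
  proof (intro conjI allI linearI)
  qed (simp_all only: linear_add[OF lin] linear_cmul[OF lin] bilinear_ladd[OF gh(1)] bilinear_radd[OF gh(1)]
      bilinear_lmul[OF gh(1)] bilinear_rmul[OF gh(1)])
  moreover have "Om x y = - Om y x" for x y
    unfolding Om_def using sk[of x y] gh(2)[of "fh x" y] by simp
  ultimately obtain x where x: "x \<noteq> 0" "\<And>y. Om x y = 0"
    using skew_form_degenerate_odd[OF _ _ odd_dimension, of Om] by metis
  define v where "v = L x"
  have v: "v \<in> TM p" unfolding v_def by (rule L(2))
  have "v \<noteq> 0" using x(1) L(4)[of x] L(4)[of 0] linear_0[OF L(1)] unfolding v_def by metis
  have "g p v (f p w) = 0" if "w \<in> TM p" for w
    using x(2)[of "K w"] unfolding Om_def gh_def Lf v_def L(3)[OF that] .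
  from this[OF tensor11_TM[OF f_tensor v]] have "g p (f p v) (f p v) = 0"
    using skew_at[OF v tensor11_TM[OF f_tensor v]] by simp
  then have fv: "f p v = 0" by (rule metric_eq_zeroD[OF g_metric tensor11_TM[OF f_tensor v]])
  have Qv: "Q p v = \<eta> p v *\<^sub>R \<xi> p"
  proof -
    have "\<eta> p v *\<^sub>R \<xi> p - Q p v = f p (f p v)" unfolding ff_at[OF v] by (simp only: uminus_add_conv_diff)
    also have "\<dots> = 0" by (simp only: fv tensor11_zero_at[OF f_tensor])
    finally show ?thesis by (simp only: right_minus_eq)
  qed
  have ne: "\<eta> p v \<noteq> 0"
  proof
    assume "\<eta> p v = 0"
    then have "Q p v = Q p 0" by (simp only: Qv tensor11_zero_at[OF Q_tensor] scaleR_zero_left)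
    then show False using Q_inj_at[OF v TM_zero] \<open>v \<noteq> 0\<close> by blast
  qed
  show ?thesis
  proof (intro bexI conjI)
    show "f p ((1 / \<eta> p v) *\<^sub>R v) = 0"
      by (simp only: tensor11_scaleR_at[OF f_tensor v] fv scaleR_zero_right)
    show "\<eta> p ((1 / \<eta> p v) *\<^sub>R v) = 1"
      using ne by (simp add: one_form_scaleR_at[OF eta_form v])
  qed (rule TM_scaleR[OF v])
qed

text \<open>The quasi-contact identity for \<open>X = Y = \<zeta>\<close>, paired with \<open>\<zeta>\<close>, where \<open>\<zeta>\<close> is a kernel
  vector of \<open>f\<close> at \<open>p\<close> with \<open>\<eta>(\<zeta>) = 1\<close>: the left-hand side and \<open>g(h \<zeta>, \<zeta>)\<close> vanish, and what
  remains is \<open>|\<zeta>|\<^sup>2 = 1\<close>. Then \<open>|\<zeta> - \<xi>|\<^sup>2 = 1 - 2 + 1 = 0\<close>.\<close>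

lemma F_xi [simp]: "F \<xi> = 0"
proof
  fix p
  obtain v where v: "v \<in> TM p" "f p v = 0" "\<eta> p v = 1" using kernel_f_at by blast
  obtain Z where Z: "Z \<in> VF" "Z p = v" by (rule tangent_extension[OF v(1)])
  have FZ: "F Z p = 0" by (simp only: app11_def Z(2) v(2))
  have etZ: "et Z p = 1" by (simp only: app1_def Z(2) v(3))
  \<comment> \<open>the second term of the identity is differentiated along \<open>f \<zeta>\<close>, which vanishes at \<open>p\<close>\<close>
  have z1: "ip (cov_deriv11 D (F Z) f (F Z)) Z p = 0"
  proof -
    have "cov_deriv11 D (F Z) f (F Z) p = D (F Z) (F (F Z)) p - f p (D (F Z) (F Z) p)"
      unfolding cov_deriv11_def app11_def[of f "D _ _"] by (simp only: minus_apply)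
    also have "\<dots> = 0"
      by (simp only: connection_zero_at[of "F Z", OF _ _ FZ] closure Z(1) tensor11_zero_at[OF f_tensor] diff_0_right)
    finally show ?thesis
      using metric_scaleR_at[OF g_metric TM_zero VF_TM[OF Z(1)], of p 0] by (simp add: app2_def)
  qed
  have hz: "ip (H Z) Z p = 0"
  proof -
    have "ip (H Z + H Z) Z = ip (cov_deriv11 D \<xi> f Z) Z - ip (D (F Z) \<xi>) Z + ip (F (D Z \<xi>)) Z"
      unfolding two_H[OF Z(1)] using Z(1) by (simp add: lin_simps)
    also have "\<dots> = - ip (D (F Z) \<xi>) Z - ip (D Z \<xi>) (F Z)"
      using Z(1) by (simp add: cov_F_self F_skew)
    finally have e: "ip (H Z + H Z) Z p = - ip (D (F Z) \<xi>) Z p - ip (D Z \<xi>) (F Z) p" by (simp only: minus_apply uminus_apply)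
    have "ip (D (F Z) \<xi>) Z p = 0"
      using connection_zero_at[of "F Z" \<xi>, OF _ _ FZ] Z(1) metric_scaleR_at[OF g_metric TM_zero VF_TM[OF Z(1)], of p 0]
      by (simp add: app2_def)
    moreover have "ip (D Z \<xi>) (F Z) p = 0"
    proof -
      have "ip (F Z) (D Z \<xi>) p = 0"
        using metric_scaleR_at[OF g_metric TM_zero VF_TM[of "D Z \<xi>" p], of 0] Z(1) FZ by (simp add: app2_def)
      then show ?thesis using metric_sym[OF g_metric, of "F Z" "D Z \<xi>"] Z(1) by simp
    qed
    moreover have "ip (H Z + H Z) Z p = ip (H Z) Z p + ip (H Z) Z p"
      by (simp only: metric_add_left[OF g_metric H_VF[OF Z(1)] H_VF[OF Z(1)] Z(1)] plus_fun_apply)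
    ultimately show ?thesis using e by linarith
  qed
  have "ip (cov_deriv11 D Z f Z + cov_deriv11 D (F Z) f (F Z)) Z
      = ip (fscale (2 * ip Z Z) \<xi> - fscale (et Z) (Z + H Z + fscale (et Z) \<xi>)) Z"
    by (simp only: quasi_contact_eq[OF Z(1) Z(1)])
  moreover have "ip (cov_deriv11 D Z f Z + cov_deriv11 D (F Z) f (F Z)) Z = ip (cov_deriv11 D (F Z) f (F Z)) Z"
    using Z(1) by (simp add: lin_simps cov_F_self)
  moreover have "smooth 2" using smooth_add[OF smooth_const(3) smooth_const(3)] by simp
  then have "ip (fscale (2 * ip Z Z) \<xi> - fscale (et Z) (Z + H Z + fscale (et Z) \<xi>)) Z
      = 2 * ip Z Z * et Z - et Z * (ip Z Z + ip (H Z) Z + et Z * et Z)"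
    using Z(1) by (simp add: lin_simps et_ip)
  ultimately have "ip (cov_deriv11 D (F Z) f (F Z)) Z p = (2 * ip Z Z * et Z - et Z * (ip Z Z + ip (H Z) Z + et Z * et Z)) p"
    by simp
  moreover have "(2 :: 'm \<Rightarrow> real) p = 2" unfolding one_add_one[symmetric] by simp
  ultimately have s: "ip Z Z p = 1" using z1 hz etZ by simp
  have "ip (Z - \<xi>) (Z - \<xi>) = ip Z Z - et Z - et Z + et \<xi>"
    using Z(1) metric_sym[OF g_metric Z(1) xi_VF] by (simp only: lin_simps VF_diff xi_VF et_ip diff_diff_eq2) (simp add: algebra_simps)
  then have "ip (Z - \<xi>) (Z - \<xi>) p = 0" by (simp add: s etZ)
  then have "g p ((Z - \<xi>) p) ((Z - \<xi>) p) = 0" by (simp only: app2_def)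
  then have "(Z - \<xi>) p = 0" by (rule metric_eq_zeroD[OF g_metric VF_TM[OF VF_diff[OF Z(1) xi_VF]]])
  then have "\<xi> p = v" using Z(2) by simp
  then show "F \<xi> p = 0 p" using v(2) by (simp add: app11_def)
qed

lemma et_F [simp]:
  assumes "X \<in> VF" shows "et (F X) = 0"
proof -
  have "ip (F \<xi>) X = - ip \<xi> (F X)" by (rule F_skew[OF xi_VF assms])
  then show ?thesis using assms by (simp add: lin_simps et_ip)
qed

lemma Q_xi [simp]: "QQ \<xi> = \<xi>"
  using F_F[OF xi_VF] by (simp add: lin_simps fscale_simps)

lemma Q_sym: "X \<in> VF \<Longrightarrow> Y \<in> VF \<Longrightarrow> ip (QQ X) Y = ip X (QQ Y)"
  using ip_F_F[of X Y] ip_F_F[of Y X] metric_sym[OF g_metric, of "F X" "F Y"] metric_sym[OF g_metric, of "QQ X" Y]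
  by (simp add: mult.commute)

lemma et_Q [simp]: "X \<in> VF \<Longrightarrow> et (QQ X) = et X"
  using Q_sym[of \<xi> X] by (simp add: et_ip)

lemma Q_inj:
  assumes "X \<in> VF" "QQ X = 0" shows "X = 0"
proof
  fix p
  have "Q p (X p) = QQ X p" by (simp only: app11_def)
  also have "\<dots> = Q p 0" by (simp only: assms(2) tensor11_zero_at[OF Q_tensor] zero_fun_apply)
  finally show "X p = 0 p" using Q_inj_at[OF VF_TM[OF assms(1)] TM_zero] by simp
qed

lemma H_xi [simp]: "H \<xi> = 0"
proof -
  have "H \<xi> + H \<xi> = 0"
    unfolding two_H[OF xi_VF] cov_deriv11_def by (simp add: lin_simps)
  then have "2 *\<^sub>R H \<xi> = 0" by (simp only: scaleR_2)
  then show ?thesis by simp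
qed

text \<open>The quasi-contact identity for \<open>X = \<xi>\<close>, where \<open>f \<xi> = 0\<close> and \<open>h \<xi> = 0\<close>.\<close>

lemma nabla_xi_f:
  assumes "Y \<in> VF" shows "cov_deriv11 D \<xi> f Y = 0"
proof -
  have "cov_deriv11 D 0 f 0 = 0" by (simp add: cov_deriv11_def lin_simps)
  moreover have "cov_deriv11 D (F \<xi>) f (F Y) = 0" using assms by (simp add: cov_deriv11_def lin_simps)
  ultimately have "cov_deriv11 D \<xi> f Y = fscale (et Y + et Y) \<xi> - fscale (et Y) (\<xi> + 0 + fscale 1 \<xi>)"
    using quasi_contact_eq[OF xi_VF assms] by (simp only: et_ip[OF assms] mult_2 H_xi et_xi add_0_right)
  then show ?thesis by (simp only: fscale_simps add_0_right diff_self)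
qed

lemma et_nabla_xi [simp]:
  assumes "X \<in> VF" shows "et (D X \<xi>) = 0"
proof
  fix p
  have "ip (D X \<xi>) \<xi> + ip \<xi> (D X \<xi>) = 0"
    using compat[OF assms xi_VF xi_VF] deriv_along_const[OF assms] by (simp add: et_ip)
  moreover have "ip (D X \<xi>) \<xi> = ip \<xi> (D X \<xi>)" by (rule metric_sym[OF g_metric]) (simp_all add: assms)
  ultimately have "et (D X \<xi>) p + et (D X \<xi>) p = 0"
    using assms by (simp add: et_ip fun_eq_iff)
  then show "et (D X \<xi>) p = 0 p" by simp
qed

lemma nabla_xi_xi [simp]: "D \<xi> \<xi> = 0"
proof (rule Q_inj)
  have "F (D \<xi> \<xi>) = 0" using nabla_xi_f[OF xi_VF] by (simp add: cov_deriv11_def lin_simps)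
  then have "F (F (D \<xi> \<xi>)) = 0" by (simp add: lin_simps)
  then show "QQ (D \<xi> \<xi>) = 0" by (simp add: F_F fscale_simps)
qed simp

text \<open>The quasi-contact identity for \<open>Y = \<xi>\<close>.\<close>

lemma F_nabla_xi:
  assumes "X \<in> VF" shows "F (D X \<xi>) = X + H X - fscale (et X) \<xi>"
proof -
  have "cov_deriv11 D X f \<xi> = - F (D X \<xi>)" using assms by (simp add: cov_deriv11_def lin_simps)
  moreover have "cov_deriv11 D (F X) f (F \<xi>) = 0" using assms by (simp add: cov_deriv11_def lin_simps)
  moreover have "ip X \<xi> = et X" using metric_sym[OF g_metric assms xi_VF] assms by (simp add: et_ip)
  ultimately have "- F (D X \<xi>) = fscale (et X) \<xi> + fscale (et X) \<xi> - (X + H X + fscale (et X) \<xi>)"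
    using quasi_contact_eq[OF assms xi_VF] by (simp only: add_0_right mult_2 fscale_simps et_xi mult_1_left)
  then have "F (D X \<xi>) = - (fscale (et X) \<xi> + fscale (et X) \<xi> - (X + H X + fscale (et X) \<xi>))"
    by (metis add.inverse_inverse)
  then show ?thesis by (simp only: minus_diff_eq) (simp add: algebra_simps)
qed

text \<open>The definition of \<open>h\<close>, solved for \<open>\<nabla>\<^sub>f\<^sub>X \<xi>\<close> by means of \<open>F_nabla_xi\<close>.\<close>

lemma nabla_F_xi:
  assumes "X \<in> VF" shows "D (F X) \<xi> = X - H X - fscale (et X) \<xi>"
proof -
  have "H X + H X = - D (F X) \<xi> + (X + H X - fscale (et X) \<xi>)"
    using two_H[OF assms] nabla_xi_f[OF assms] F_nabla_xi[OF assms] by (simp only: diff_0)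
  then show ?thesis by (rule cancel_double)
qed

text \<open>Both \<open>F_nabla_xi\<close> and \<open>nabla_F_xi\<close> compute \<open>f \<nabla>\<^sub>f\<^sub>X \<xi>\<close>.\<close>

lemma H_F:
  assumes "X \<in> VF" shows "H (F X) = - F (H X)"
proof -
  have "F (D (F X) \<xi>) = F X + H (F X)"
    using F_nabla_xi[of "F X"] assms by (simp add: fscale_simps)
  moreover have "F (D (F X) \<xi>) = F X - F (H X)"
    unfolding nabla_F_xi[OF assms] using assms by (simp add: lin_simps fscale_simps)
  ultimately show ?thesis by simp
qed

lemma Q_nabla_xi:
  assumes "X \<in> VF" shows "QQ (D X \<xi>) = - F X - F (H X)"
proof -
  have "F (F (D X \<xi>)) = - QQ (D X \<xi>)"
    using F_F[of "D X \<xi>"] assms by (simp add: fscale_simps)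
  moreover have "F (F (D X \<xi>)) = F X + F (H X)"
    unfolding F_nabla_xi[OF assms] using assms by (simp add: lin_simps fscale_simps)
  ultimately have "- QQ (D X \<xi>) = F X + F (H X)" by simp
  then have "QQ (D X \<xi>) = - (F X + F (H X))" by (metis add.inverse_inverse)
  then show ?thesis by simp
qed

text \<open>Together with \<open>Q_nabla_xi\<close>: the operator \<open>X \<mapsto> \<nabla>\<^sub>X \<xi>\<close> commutes with \<open>Q\<close>.\<close>

lemma nabla_Q_xi:
  assumes "X \<in> VF" shows "D (QQ X) \<xi> = - F X - F (H X)"
proof -
  have "D (F (F X)) \<xi> = F X + F (H X)"
    using nabla_F_xi[of "F X"] assms by (simp add: fscale_simps H_F)
  moreover have "D (F (F X)) \<xi> = - D (QQ X) \<xi>"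
    unfolding F_F[OF assms] using assms by (simp add: lin_simps fscale_simps)
  ultimately have "- D (QQ X) \<xi> = F X + F (H X)" by simp
  then have "D (QQ X) \<xi> = - (F X + F (H X))" by (metis add.inverse_inverse)
  then show ?thesis by simp
qed

lemma ext_deriv1_eta:
  assumes "X \<in> VF" "Y \<in> VF"
  shows "ext_deriv1 \<eta> X Y = (1/2) *\<^sub>R (ip (D X \<xi>) Y - ip (D Y \<xi>) X)"
proof -
  have "deriv_along X (et Y) = ip (D X \<xi>) Y + et (D X Y)"
    using compat[OF assms(1) xi_VF assms(2)] assms by (simp add: et_ip)
  moreover have "deriv_along Y (et X) = ip (D Y \<xi>) X + et (D Y X)"
    using compat[OF assms(2) xi_VF assms(1)] assms by (simp add: et_ip)
  moreover have "et (lie_bracket X Y) = et (D X Y) - et (D Y X)"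
    using assms by (simp add: torsion lin_simps)
  ultimately show ?thesis unfolding ext_deriv1_def by simp
qed

end

section \<open>The differential of the contact form\<close>

locale weak_quasi_contact_selfadjoint = weak_quasi_contact A n f Q \<xi> \<eta> g D
  for A :: "('m::{t2_space, second_countable_topology}, 'e::euclidean_space) atlas"
    and n :: nat and f Q :: "'m tensor11" and \<xi> :: "'m vfield" and \<eta> :: "'m covector"
    and g :: "'m tensor02" and D :: "'m connection" +
  assumes h_selfadjoint: "X \<in> vfields A \<Longrightarrow> Y \<in> vfields A \<Longrightarrow>
    app2 g (tensor_h f \<xi> X) Y = app2 g X (tensor_h f \<xi> Y)"
begin

text \<open>The part \<open>f h\<close> of \<open>Q (\<nabla> \<xi>) = - f - f h\<close> is symmetric, since \<open>h\<close> is self-adjoint and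
  anticommutes with the skew \<open>f\<close>; it drops out of the exterior derivative.\<close>

lemma ext_deriv1_eta_Q:
  assumes "X \<in> VF" "Y \<in> VF"
  shows "ext_deriv1 \<eta> X (QQ Y) = ip X (F Y)"
proof -
  have 1: "ip (D X \<xi>) (QQ Y) = ip X (F Y) + ip (H X) (F Y)"
  proof -
    have "ip (D X \<xi>) (QQ Y) = ip (QQ (D X \<xi>)) Y" using assms by (simp add: Q_sym)
    also have "\<dots> = - ip (F X) Y - ip (F (H X)) Y"
      unfolding Q_nabla_xi[OF assms(1)] using assms by (simp add: lin_simps)
    finally show ?thesis using assms by (simp add: F_skew)
  qed
  have 2: "ip (D (QQ Y) \<xi>) X = - ip X (F Y) + ip (H X) (F Y)"
  proof -
    have "ip (D (QQ Y) \<xi>) X = - ip (F Y) X - ip (F (H Y)) X"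
      unfolding nabla_Q_xi[OF assms(2)] using assms by (simp add: lin_simps)
    also have "ip (F Y) X = ip X (F Y)" using assms by (simp add: metric_sym[OF g_metric, of "F Y"])
    also have "F (H Y) = - H (F Y)" using H_F[OF assms(2)] by simp
    also have "ip (- H (F Y)) X = - ip (H (F Y)) X" using assms by (simp add: lin_simps)
    also have "ip (H (F Y)) X = ip (F Y) (H X)" using assms by (simp add: h_selfadjoint)
    also have "ip (F Y) (H X) = ip (H X) (F Y)" using assms by (simp add: metric_sym[OF g_metric, of "F Y"])
    finally show ?thesis by (simp only: diff_minus_eq_add)
  qed
  show ?thesis
  proof
    fix p
    show "ext_deriv1 \<eta> X (QQ Y) p = ip X (F Y) p"
      using ext_deriv1_eta[of X "QQ Y"] assms 1 2 by simp
  qed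
qed

end

section \<open>Covariant derivatives and exterior derivatives of 2-forms\<close>

context smooth_atlas begin

text \<open>Skew forms that are bilinear over the smooth functions. Only one argument is mentioned in
  the linearity conditions, as skewness carries them over to the other.\<close>

definition two_form :: "('m vfield \<Rightarrow> 'm vfield \<Rightarrow> 'm \<Rightarrow> real) \<Rightarrow> bool" where
  "two_form \<Phi> \<longleftrightarrow>
     (\<forall>X\<in>VF. \<forall>Y\<in>VF. smooth (\<Phi> X Y) \<and> \<Phi> X Y = - \<Phi> Y X) \<and>
     (\<forall>X\<in>VF. \<forall>Y\<in>VF. \<forall>Z\<in>VF. \<Phi> (X + Y) Z = \<Phi> X Z + \<Phi> Y Z) \<and>
     (\<forall>u. smooth u \<longrightarrow> (\<forall>X\<in>VF. \<forall>Y\<in>VF. \<Phi> (fscale u X) Y = u * \<Phi> X Y))"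

context
  fixes \<Phi> :: "'m vfield \<Rightarrow> 'm vfield \<Rightarrow> 'm \<Rightarrow> real"
  assumes Phi: "two_form \<Phi>"
begin

lemma two_form_smooth: "X \<in> VF \<Longrightarrow> Y \<in> VF \<Longrightarrow> smooth (\<Phi> X Y)"
  and two_form_skew: "X \<in> VF \<Longrightarrow> Y \<in> VF \<Longrightarrow> \<Phi> X Y = - \<Phi> Y X"
  and two_form_add: "X \<in> VF \<Longrightarrow> Y \<in> VF \<Longrightarrow> Z \<in> VF \<Longrightarrow> \<Phi> (X + Y) Z = \<Phi> X Z + \<Phi> Y Z"
  and two_form_fscale: "smooth u \<Longrightarrow> X \<in> VF \<Longrightarrow> Y \<in> VF \<Longrightarrow> \<Phi> (fscale u X) Y = u * \<Phi> X Y"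
  using Phi unfolding two_form_def by blast+

lemma two_form_add_right:
  assumes "X \<in> VF" "Y \<in> VF" "Z \<in> VF" shows "\<Phi> Z (X + Y) = \<Phi> Z X + \<Phi> Z Y"
  unfolding two_form_skew[OF assms(3,1)] two_form_skew[OF assms(3,2)]
    two_form_skew[OF assms(3) VF_add[OF assms(1,2)]] two_form_add[OF assms]
  by (rule minus_add_distrib)

lemma two_form_fscale_right:
  assumes "smooth u" "X \<in> VF" "Y \<in> VF" shows "\<Phi> Y (fscale u X) = u * \<Phi> Y X"
  unfolding two_form_skew[OF assms(3,2)] two_form_skew[OF assms(3) VF_fscale[OF assms(2,1)]]
    two_form_fscale[OF assms] by (rule minus_mult_right)

lemma two_form_diff:
  assumes "X \<in> VF" "Y \<in> VF" "Z \<in> VF" shows "\<Phi> (X - Y) Z = \<Phi> X Z - \<Phi> Y Z"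
  using two_form_add[OF VF_diff[OF assms(1,2)] assms(2,3)] by (simp only: diff_add_cancel eq_diff_eq)

lemma two_form_at:
  assumes "X \<in> VF" "X' \<in> VF" "Y \<in> VF" "Y' \<in> VF" "X p = X' p" "Y p = Y' p"
  shows "\<Phi> X Y p = \<Phi> X' Y' p"
proof -
  have "\<Phi> X Y p = \<Phi> X' Y p"
    by (rule tensorial_eq[of "\<lambda>X. \<Phi> X Y p" p, OF _ _ assms(1,2,5)])
      (simp_all only: two_form_add two_form_fscale assms(3) plus_fun_apply times_fun_apply)
  also have "\<dots> = \<Phi> X' Y' p"
    by (rule tensorial_eq[of "\<lambda>Y. \<Phi> X' Y p" p, OF _ _ assms(3,4,6)])
      (simp_all only: two_form_add_right two_form_fscale_right assms(2) plus_fun_apply times_fun_apply)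
  finally show ?thesis .
qed

end

definition cov_form2 :: "'m connection \<Rightarrow> ('m vfield \<Rightarrow> 'm vfield \<Rightarrow> 'm \<Rightarrow> real) \<Rightarrow> 'm vfield \<Rightarrow> 'm vfield \<Rightarrow> 'm vfield \<Rightarrow> 'm \<Rightarrow> real"
  where "cov_form2 D \<Phi> X Y Z = deriv_along X (\<Phi> Y Z) - \<Phi> (D X Y) Z - \<Phi> Y (D X Z)"

context
  fixes D \<Phi>
  assumes D: "affine_connection A D" and Phi: "two_form \<Phi>"
begin

lemma cov_form2_skew:
  assumes "X \<in> VF" "Y \<in> VF" "Z \<in> VF"
  shows "cov_form2 D \<Phi> X Y Z = - cov_form2 D \<Phi> X Z Y"
proof
  fix p
  have "deriv_along X (\<Phi> Y Z) = - deriv_along X (\<Phi> Z Y)"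
    unfolding two_form_skew[OF Phi assms(2,3)]
    by (rule deriv_along_simps(3)[OF assms(1) two_form_smooth[OF Phi assms(3,2)] smooth_const(2)])
  moreover have "\<Phi> (D X Y) Z = - \<Phi> Z (D X Y)" "\<Phi> Y (D X Z) = - \<Phi> (D X Z) Y"
    by (rule two_form_skew[OF Phi]; intro connection_VF[OF D] assms)+
  ultimately show "cov_form2 D \<Phi> X Y Z p = (- cov_form2 D \<Phi> X Z Y) p"
    by (simp add: cov_form2_def)
qed

lemma cov_form2_add1:
  assumes "X \<in> VF" "X' \<in> VF" "Y \<in> VF" "Z \<in> VF"
  shows "cov_form2 D \<Phi> (X + X') Y Z = cov_form2 D \<Phi> X Y Z + cov_form2 D \<Phi> X' Y Z"
proof
  fix p
  note c = connection_VF[OF D]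
  show "cov_form2 D \<Phi> (X + X') Y Z p = (cov_form2 D \<Phi> X Y Z + cov_form2 D \<Phi> X' Y Z) p"
    unfolding cov_form2_def deriv_along_field_simps connection_add_left[OF D assms(1-3)]
      connection_add_left[OF D assms(1,2,4)]
      two_form_add[OF Phi c[OF assms(1,3)] c[OF assms(2,3)] assms(4)]
      two_form_add_right[OF Phi c[OF assms(1,4)] c[OF assms(2,4)] assms(3)]
    by simp
qed

lemma cov_form2_fscale1:
  assumes "smooth u" "X \<in> VF" "Y \<in> VF" "Z \<in> VF"
  shows "cov_form2 D \<Phi> (fscale u X) Y Z = u * cov_form2 D \<Phi> X Y Z"
proof
  fix p
  note c = connection_VF[OF D]
  show "cov_form2 D \<Phi> (fscale u X) Y Z p = (u * cov_form2 D \<Phi> X Y Z) p"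
    unfolding cov_form2_def deriv_along_field_simps connection_fscale_left[OF D assms(2,3,1)]
      connection_fscale_left[OF D assms(2,4,1)]
      two_form_fscale[OF Phi assms(1) c[OF assms(2,3)] assms(4)]
      two_form_fscale_right[OF Phi assms(1) c[OF assms(2,4)] assms(3)]
    by (simp add: right_diff_distrib)
qed

lemma cov_form2_add2:
  assumes "X \<in> VF" "Y \<in> VF" "Y' \<in> VF" "Z \<in> VF"
  shows "cov_form2 D \<Phi> X (Y + Y') Z = cov_form2 D \<Phi> X Y Z + cov_form2 D \<Phi> X Y' Z"
proof
  fix p
  note c = connection_VF[OF D] and s = two_form_smooth[OF Phi]
  show "cov_form2 D \<Phi> X (Y + Y') Z p = (cov_form2 D \<Phi> X Y Z + cov_form2 D \<Phi> X Y' Z) p"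
    unfolding cov_form2_def connection_add_right[OF D assms(1-3)]
      two_form_add[OF Phi c[OF assms(1,2)] c[OF assms(1,3)] assms(4)]
      two_form_add[OF Phi assms(2,3,4)] two_form_add[OF Phi assms(2,3) c[OF assms(1,4)]]
      deriv_along_simps(1)[OF assms(1) s[OF assms(2,4)] s[OF assms(3,4)]]
    by simp
qed

lemma cov_form2_fscale2:
  assumes "smooth u" "X \<in> VF" "Y \<in> VF" "Z \<in> VF"
  shows "cov_form2 D \<Phi> X (fscale u Y) Z = u * cov_form2 D \<Phi> X Y Z"
proof
  fix p
  note c = connection_VF[OF D] and s = two_form_smooth[OF Phi]
  note d = VF_smooth[OF assms(2,1)]
  show "cov_form2 D \<Phi> X (fscale u Y) Z p = (u * cov_form2 D \<Phi> X Y Z) p"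
    unfolding cov_form2_def connection_fscale_right[OF D assms(2,3,1)]
      two_form_fscale[OF Phi assms(1,3,4)] two_form_fscale[OF Phi assms(1,3) c[OF assms(2,4)]]
      two_form_add[OF Phi VF_fscale[OF assms(3) d] VF_fscale[OF c[OF assms(2,3)] assms(1)] assms(4)]
      two_form_fscale[OF Phi assms(1) c[OF assms(2,3)] assms(4)] two_form_fscale[OF Phi d assms(3,4)]
      deriv_along_simps(5)[OF assms(2,1) s[OF assms(3,4)]]
    by (simp add: algebra_simps)
qed

lemma cov_form2_add3:
  assumes "X \<in> VF" "Y \<in> VF" "Z \<in> VF" "Z' \<in> VF"
  shows "cov_form2 D \<Phi> X Y (Z + Z') = cov_form2 D \<Phi> X Y Z + cov_form2 D \<Phi> X Y Z'"
  unfolding cov_form2_skew[OF assms(1,2) VF_add[OF assms(3,4)]] cov_form2_skew[OF assms(1-3)]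
    cov_form2_skew[OF assms(1,2,4)] cov_form2_add2[OF assms(1,3,4,2)]
  by (rule minus_add_distrib)

lemma cov_form2_fscale3:
  assumes "smooth u" "X \<in> VF" "Y \<in> VF" "Z \<in> VF"
  shows "cov_form2 D \<Phi> X Y (fscale u Z) = u * cov_form2 D \<Phi> X Y Z"
  unfolding cov_form2_skew[OF assms(2,3) VF_fscale[OF assms(4,1)]] cov_form2_skew[OF assms(2-4)]
    cov_form2_fscale2[OF assms(1,2,4,3)]
  by (rule minus_mult_right)

lemma cov_form2_at:
  assumes v: "X \<in> VF" "Y \<in> VF" "Z \<in> VF" "X' \<in> VF" "Y' \<in> VF" "Z' \<in> VF"
    and eq: "X p = X' p" "Y p = Y' p" "Z p = Z' p"
  shows "cov_form2 D \<Phi> X Y Z p = cov_form2 D \<Phi> X' Y' Z' p"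
proof -
  have "cov_form2 D \<Phi> X Y Z p = cov_form2 D \<Phi> X' Y Z p"
    by (rule tensorial_eq[of "\<lambda>X. cov_form2 D \<Phi> X Y Z p" p, OF _ _ v(1,4) eq(1)])
      (simp_all only: cov_form2_add1 cov_form2_fscale1 v plus_fun_apply times_fun_apply)
  also have "\<dots> = cov_form2 D \<Phi> X' Y' Z p"
    by (rule tensorial_eq[of "\<lambda>Y. cov_form2 D \<Phi> X' Y Z p" p, OF _ _ v(2,5) eq(2)])
      (simp_all only: cov_form2_add2 cov_form2_fscale2 v plus_fun_apply times_fun_apply)
  also have "\<dots> = cov_form2 D \<Phi> X' Y' Z' p"
    by (rule tensorial_eq[of "\<lambda>Z. cov_form2 D \<Phi> X' Y' Z p" p, OF _ _ v(3,6) eq(3)])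
      (simp_all only: cov_form2_add3 cov_form2_fscale3 v plus_fun_apply times_fun_apply)
  finally show ?thesis .
qed

text \<open>For a torsion-free connection the exterior derivative is the alternation of the covariant one; the
  factor \<open>1/3\<close> is that of the normalisation of \<open>ext_deriv2\<close>.\<close>

lemma ext_deriv2_cov:
  assumes "\<And>X Y. X \<in> VF \<Longrightarrow> Y \<in> VF \<Longrightarrow> lie_bracket X Y = D X Y - D Y X"
    and v: "X \<in> VF" "Y \<in> VF" "Z \<in> VF"
  shows "ext_deriv2 \<Phi> X Y Z p
    = (cov_form2 D \<Phi> X Y Z p + cov_form2 D \<Phi> Y Z X p + cov_form2 D \<Phi> Z X Y p) / 3"
proof -
  note c = connection_VF[OF D]
  have b: "\<Phi> (lie_bracket U V) W p = \<Phi> (D U V) W p + \<Phi> W (D V U) p" if "U \<in> VF" "V \<in> VF" "W \<in> VF" for U V W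
    unfolding assms(1)[OF that(1,2)] two_form_diff[OF Phi c[OF that(1,2)] c[OF that(2,1)] that(3)]
      two_form_skew[OF Phi c[OF that(2,1)] that(3)] by simp
  show ?thesis
    unfolding ext_deriv2_def cov_form2_def
    by (simp add: b[OF v] b[OF v(2,3,1)] b[OF v(3,1,2)])
qed

end

text \<open>Second derivatives of \<open>\<eta>(X), \<eta>(Y), \<eta>(Z)\<close> cancel by the definition of the Lie bracket, and
  the double brackets by the Jacobi identity.\<close>

lemma ext_deriv1_closed:
  assumes eta: "one_form A \<eta>" and br: "\<And>X Y. X \<in> VF \<Longrightarrow> Y \<in> VF \<Longrightarrow> lie_bracket X Y \<in> VF"
    and v: "X \<in> VF" "Y \<in> VF" "Z \<in> VF"
  shows "ext_deriv2 (ext_deriv1 \<eta>) X Y Z = 0"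
proof
  fix p
  let ?d = deriv_along and ?e = "app1 \<eta>" and ?b = lie_bracket
  have d: "?d U (ext_deriv1 \<eta> V W) p
      = (?d U (?d V (?e W)) p - ?d U (?d W (?e V)) p - ?d U (?e (?b V W)) p) / 2"
    if "U \<in> VF" "V \<in> VF" "W \<in> VF" for U V W
  proof -
    note s = VF_smooth[OF that(2) one_form_smooth[OF eta that(3)]] VF_smooth[OF that(3) one_form_smooth[OF eta that(2)]]
      one_form_smooth[OF eta br[OF that(2,3)]]
    show ?thesis
      unfolding ext_deriv1_def deriv_along_simps(4)[OF that(1) smooth_diff[OF smooth_diff[OF s(1,2)] s(3)] smooth_const(2)]
        deriv_along_simps(2)[OF that(1) smooth_diff[OF s(1,2)] s(3)] deriv_along_simps(2)[OF that(1) s(1,2)]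
      by simp
  qed
  have e: "ext_deriv1 \<eta> (?b U V) W p
      = (?d U (?d V (?e W)) p - ?d V (?d U (?e W)) p - ?d W (?e (?b U V)) p - ?e (?b (?b U V) W) p) / 2" for U V W
    by (simp add: ext_deriv1_def deriv_along_lie_bracket)
  have "?e (?b (?b X Y) Z + ?b (?b Y Z) X + ?b (?b Z X) Y) = ?e 0"
    by (simp only: lie_bracket_Jacobi[OF v])
  then have "?e (?b (?b X Y) Z) + ?e (?b (?b Y Z) X) + ?e (?b (?b Z X) Y) = 0"
    by (simp only: one_form_add[OF eta] one_form_zero[OF eta] br v VF_add)
  then have j: "?e (?b (?b X Y) Z) p + ?e (?b (?b Y Z) X) p + ?e (?b (?b Z X) Y) p = 0"
    by (metis plus_fun_apply zero_fun_apply)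
  show "ext_deriv2 (ext_deriv1 \<eta>) X Y Z p = 0 p"
    unfolding ext_deriv2_def
    using j by (simp add: d[OF v] d[OF v(2,3,1)] d[OF v(3,1,2)] e field_simps)
qed

end

section \<open>The contact condition\<close>

context weak_quasi_contact begin

definition field_through :: "'m \<Rightarrow> 'm tangent \<Rightarrow> 'm vfield" where
  "field_through p v = (SOME X. X \<in> VF \<and> X p = v)"

lemma field_through:
  assumes "v \<in> TM p" shows "field_through p v \<in> VF" "field_through p v p = v"
proof -
  have "\<exists>X. X \<in> VF \<and> X p = v" using tangent_extension[OF assms] by blast
  from someI_ex[OF this] show "field_through p v \<in> VF" "field_through p v p = v"
    unfolding field_through_def by blast+
qed

lemma two_form_deta: "two_form (ext_deriv1 \<eta>)"
  unfolding two_form_def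
proof (intro conjI ballI allI impI)
  fix X Y assume XY: "X \<in> VF" "Y \<in> VF"
  show "smooth (ext_deriv1 \<eta> X Y)" using XY by (simp add: ext_deriv1_eta)
  show "ext_deriv1 \<eta> X Y = - ext_deriv1 \<eta> Y X"
    by (rule ext) (simp add: ext_deriv1_eta XY field_simps)
  show "ext_deriv1 \<eta> (X + Y) Z = ext_deriv1 \<eta> X Z + ext_deriv1 \<eta> Y Z" if "Z \<in> VF" for Z
    by (rule ext) (simp add: ext_deriv1_eta XY that lin_simps field_simps)
  show "ext_deriv1 \<eta> (fscale u X) Y = u * ext_deriv1 \<eta> X Y" if "smooth u" for u
    by (rule ext) (simp add: ext_deriv1_eta XY that lin_simps field_simps)
qed

lemma two_form_fund: "two_form (fund_form f g)"
  unfolding two_form_def fund_form_def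
proof (intro conjI ballI allI impI)
  fix X Y assume XY: "X \<in> VF" "Y \<in> VF"
  show "smooth (ip X (F Y))" using XY by simp
  show "ip X (F Y) = - ip Y (F X)"
    using F_skew[OF XY(2,1)] metric_sym[OF g_metric XY(1), of "F Y"] XY by simp
  show "ip (X + Y) (F Z) = ip X (F Z) + ip Y (F Z)" if "Z \<in> VF" for Z
    by (rule metric_add_left[OF g_metric]) (simp_all add: XY that)
  show "ip (fscale u X) (F Y) = u * ip X (F Y)" if "smooth u" for u
    by (rule metric_fscale_left[OF g_metric]) (simp_all add: XY that)
qed

lemma et_at: "\<eta> p (X p) = et X p"
  by (simp only: app1_def)

end

context weak_quasi_contact_selfadjoint begin

text \<open>The values \<open>Y = Q f X\<close> suffice: there \<open>d\<eta>(X, Q f X) = g(X, f (f X)) = - |f X|\<^sup>2\<close>, so \<open>f X = 0\<close>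
  and \<open>Q X = \<eta>(X) \<xi> = Q (\<eta>(X) \<xi>)\<close>.\<close>

lemma deta_radical_at:
  assumes X: "X \<in> VF" and zero: "\<And>Y. Y \<in> VF \<Longrightarrow> ext_deriv1 \<eta> X Y p = 0"
  shows "X p = et X p *\<^sub>R \<xi> p"
proof -
  have "ip X (F (F X)) p = 0"
    using fun_cong[OF ext_deriv1_eta_Q[OF X, of "F X"], of p] zero[of "QQ (F X)"] X by simp
  then have "ip (F X) (F X) p = 0" using F_skew[OF X, of "F X"] X by simp
  then have "g p (F X p) (F X p) = 0" by (simp only: app2_def)
  then have "F X p = 0" by (rule metric_eq_zeroD[OF g_metric VF_TM[OF tensor11_VF[OF f_tensor X]]])
  then have fX: "f p (X p) = 0" by (simp only: app11_def)
  have "et X p *\<^sub>R \<xi> p - Q p (X p) = f p (f p (X p))"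
    unfolding ff_at[OF VF_TM[OF X]] et_at by (simp only: uminus_add_conv_diff)
  also have "\<dots> = 0" by (simp only: fX tensor11_zero_at[OF f_tensor])
  finally have "et X p *\<^sub>R \<xi> p = Q p (X p)" by (simp only: right_minus_eq)
  moreover have "Q p (\<xi> p) = \<xi> p" using fun_cong[OF Q_xi, of p] by (simp only: app11_def)
  then have "Q p (et X p *\<^sub>R \<xi> p) = et X p *\<^sub>R \<xi> p"
    by (simp only: tensor11_scaleR_at[OF Q_tensor VF_TM[OF xi_VF]])
  ultimately have "Q p (X p) = Q p (et X p *\<^sub>R \<xi> p)" by simp
  then show ?thesis by (rule Q_inj_at[OF VF_TM[OF X] TM_scaleR[OF VF_TM[OF xi_VF]]])
qed

text \<open>At each point \<open>d\<eta>\<close> is transported to the Euclidean space as \<open>Om\<close>. Its radical is spanned by the vector \<open>r\<close>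
  corresponding to \<open>\<xi>\<close>, so that \<open>r\<close> is completed by a symplectic family of \<open>2 * n\<close> vectors.\<close>

lemma eta_contact: "contact_form A n \<eta>"
  unfolding contact_form_def
proof (intro conjI allI)
  show "one_form A \<eta>" by (rule eta_form)
  fix p
  obtain L :: "'e \<Rightarrow> 'm tangent" and K where L: "linear L" "\<And>x. L x \<in> TM p" "\<And>v. v \<in> TM p \<Longrightarrow> L (K v) = v" "\<And>x. K (L x) = x"
    using tangent_coordinates[of p] by blast
  define E where "E x = field_through p (L x)" for x
  have E: "E x \<in> VF" "E x p = L x" for x
    unfolding E_def using field_through[OF L(2)] by blast+
  define Om where "Om x y = ext_deriv1 \<eta> (E x) (E y) p" for x y
  note at = two_form_at[OF two_form_deta]
  have Om_eq: "Om x y = ext_deriv1 \<eta> X Y p" if "X \<in> VF" "Y \<in> VF" "X p = L x" "Y p = L y" for x y X Y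
    unfolding Om_def by (rule at) (simp_all add: E that)
  have skew: "Om x y = - Om y x" for x y
    unfolding Om_def two_form_skew[OF two_form_deta E(1)[of x] E(1)[of y]] by simp
  have lin: "linear (\<lambda>x. Om x y)" for y
  proof (rule linearI)
    show "Om (x + x') y = Om x y + Om x' y" for x x'
    proof -
      have "Om (x + x') y = ext_deriv1 \<eta> (E x + E x') (E y) p"
        by (rule Om_eq) (simp_all only: E VF_add plus_fun_apply linear_add[OF L(1)])
      then show ?thesis
        by (simp only: two_form_add[OF two_form_deta E(1) E(1) E(1)] plus_fun_apply Om_def)
    qed
    show "Om (c *\<^sub>R x) y = c *\<^sub>R Om x y" for c x
    proof -
      have "Om (c *\<^sub>R x) y = ext_deriv1 \<eta> (fscale (\<lambda>_. c) (E x)) (E y) p"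
        by (rule Om_eq[OF VF_fscale[OF E(1) smooth_const(1)] E(1) _ E(2)])
          (simp only: fscale_def E(2) linear_cmul[OF L(1)])
      then show ?thesis
        by (simp only: two_form_fscale[OF two_form_deta smooth_const(1) E(1) E(1)] times_fun_apply Om_def real_scaleR_def)
    qed
  qed
  have bil: "bilinear Om"
    unfolding bilinear_def
  proof (intro conjI allI)
    show "linear (\<lambda>x. Om x y)" for y by (rule lin)
    have "(\<lambda>y. Om x y) = (\<lambda>y. - Om y x)" for x by (rule ext) (rule skew)
    then show "linear (\<lambda>y. Om x y)" for x
      by (rule ssubst) (rule linear_compose_neg[OF lin])
  qed
  define r where "r = K (\<xi> p)"
  have Lr: "L r = \<xi> p" unfolding r_def by (rule L(3)[OF VF_TM[OF xi_VF]])
  have r: "Om r y = 0" for y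
  proof -
    have "Om r y = ext_deriv1 \<eta> \<xi> (E y) p" by (rule Om_eq) (simp_all add: E Lr)
    also have "ext_deriv1 \<eta> \<xi> (E y) = 0"
      using metric_sym[OF g_metric, of "D (E y) \<xi>" \<xi>] by (simp add: ext_deriv1_eta E lin_simps et_ip)
    finally show ?thesis by simp
  qed
  have rad: "x \<in> span {r}" if x: "\<And>y. Om x y = 0" for x
  proof -
    have "E x p = et (E x) p *\<^sub>R \<xi> p"
    proof (rule deta_radical_at[OF E(1)])
      show "ext_deriv1 \<eta> (E x) Y p = 0" if "Y \<in> VF" for Y
        using Om_eq[OF E(1)[of x] that E(2)[of x] L(3)[OF VF_TM[OF that], symmetric]] x[of "K (Y p)"] by simp
    qed
    then have "L x = L (et (E x) p *\<^sub>R r)" by (simp only: E(2) linear_cmul[OF L(1)] Lr)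
    then have "x = et (E x) p *\<^sub>R r" using L(4) by metis
    then show ?thesis by (metis span_base span_scale singletonI)
  qed
  obtain x where x: "symplectic_family Om n x" "x 0 = r"
    using exists_symplectic_family[OF bil skew r rad, of n] odd_dimension by auto
  have "wedge 1 (2 * n) (\<lambda>X. et (X 0)) (wedge_power2 (\<lambda>X. ext_deriv1 \<eta> (X 0) (X 1)) n) (\<lambda>i. E (x i)) p \<noteq> 0"
  proof (rule wedge_nonzero_of_symplectic_frame)
    show "et (E (x 0)) p = 1"
      using fun_cong[OF et_xi, of p] by (simp add: app1_def E x(2) Lr)
    show "ext_deriv1 \<eta> (E (x i)) (E (x j)) p = symplectic_unit i j" if "i \<le> 2 * n" "j \<le> 2 * n" for i j
      using x(1) that by (simp add: symplectic_family_def Om_def)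
  qed
  then show "\<exists>X. (\<forall>i. X i \<in> VF) \<and>
      wedge 1 (2 * n) (\<lambda>X. et (X 0)) (wedge_power2 (\<lambda>X. ext_deriv1 \<eta> (X 0) (X 1)) n) X p \<noteq> 0"
    by (intro exI[of _ "\<lambda>i. E (x i)"] conjI allI E(1))
qed

lemma fund_form_cov:
  assumes "X \<in> VF" "Y \<in> VF" "Z \<in> VF"
  shows "cov_form2 D (fund_form f g) X Y Z = ip Y (cov_deriv11 D X f Z)"
proof
  fix p
  have "ip Y (D X (F Z) - F (D X Z)) = ip Y (D X (F Z)) - ip Y (F (D X Z))"
    by (rule metric_right(2)[OF g_metric]) (simp_all add: assms)
  then show "cov_form2 D (fund_form f g) X Y Z p = ip Y (cov_deriv11 D X f Z) p"
    unfolding cov_form2_def fund_form_def cov_deriv11_def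
    by (simp add: compat assms)
qed

text \<open>By \<open>F_nabla_xi\<close>, \<open>(\<nabla>\<^sub>X \<Phi>)(Y, \<xi>) = - g(Y, X) - g(Y, h X) + \<eta>(X) \<eta>(Y)\<close>.\<close>

lemma cov_fund_form_xi_symmetric:
  assumes "X \<in> VF" "Y \<in> VF"
  shows "cov_form2 D (fund_form f g) X Y \<xi> = cov_form2 D (fund_form f g) Y X \<xi>"
proof
  fix p
  have e: "cov_form2 D (fund_form f g) X Y \<xi> p = - ip Y X p - ip Y (H X) p + et X p * et Y p"
    if "X \<in> VF" "Y \<in> VF" for X Y
  proof -
    have "cov_deriv11 D X f \<xi> = - (X + H X - fscale (et X) \<xi>)"
      using F_nabla_xi[OF that(1)] that by (simp add: cov_deriv11_def lin_simps)
    moreover have "ip Y (- (X + H X - fscale (et X) \<xi>)) = - (ip Y X + ip Y (H X) - et X * et Y)"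
      using that metric_sym[OF g_metric that(2) xi_VF] by (simp only: lin_simps VF_add VF_diff VF_fscale H_VF closure xi_VF et_ip)
    ultimately show ?thesis by (simp add: fund_form_cov that)
  qed
  show "cov_form2 D (fund_form f g) X Y \<xi> p = cov_form2 D (fund_form f g) Y X \<xi> p"
    using metric_sym[OF g_metric assms] h_selfadjoint[OF assms] metric_sym[OF g_metric H_VF[OF assms(1)] assms(2)]
    by (simp add: e assms)
qed

end

section \<open>Closedness of the fundamental form\<close>

locale weak_quasi_contact_parallel = weak_quasi_contact_selfadjoint A n f Q \<xi> \<eta> g D
  for A :: "('m::{t2_space, second_countable_topology}, 'e::euclidean_space) atlas"
    and n :: nat and f Q :: "'m tensor11" and \<xi> :: "'m vfield" and \<eta> :: "'m covector"
    and g :: "'m tensor02" and D :: "'m connection" +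
  assumes nabla_Q: "X \<in> vfields A \<Longrightarrow> Y \<in> vfields A \<Longrightarrow> app1 \<eta> X = 0 \<Longrightarrow> app1 \<eta> Y = 0 \<Longrightarrow>
    cov_deriv11 D X Q Y = 0"
begin

text \<open>Differentiate \<open>\<Phi>(Y, Z) = d\<eta>(Y, Q Z)\<close>; the term with \<open>\<nabla>\<^sub>X Q\<close> vanishes on \<open>ker \<eta>\<close>.\<close>

lemma cov_fund_form_deta:
  assumes v: "X \<in> VF" "Y \<in> VF" "Z \<in> VF" and k: "et X = 0" "et Z = 0"
  shows "cov_form2 D (fund_form f g) X Y Z = cov_form2 D (ext_deriv1 \<eta>) X Y (QQ Z)"
proof -
  have 1: "fund_form f g U W = ext_deriv1 \<eta> U (QQ W)" if "U \<in> VF" "W \<in> VF" for U W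
    using ext_deriv1_eta_Q[OF that] by (simp add: fund_form_def)
  have "D X (QQ Z) = QQ (D X Z)" using nabla_Q[OF v(1,3) k] by (simp add: cov_deriv11_def)
  then show ?thesis unfolding cov_form2_def by (simp add: 1 v)
qed

text \<open>In \<open>(\<nabla>\<^sub>X d\<eta>)(Y, Q Z) = (\<nabla>\<^sub>X \<Phi>)(Y, Z)\<close> the right-hand side is skew in \<open>Y\<close> and \<open>Z\<close>.\<close>

lemma cov_deta_Q:
  assumes v: "X \<in> VF" "Y \<in> VF" "Z \<in> VF" and k: "et X = 0" "et Y = 0" "et Z = 0"
  shows "cov_form2 D (ext_deriv1 \<eta>) X (QQ Y) Z = cov_form2 D (ext_deriv1 \<eta>) X Y (QQ Z)"
proof -
  have "cov_form2 D (ext_deriv1 \<eta>) X (QQ Y) Z = - cov_form2 D (ext_deriv1 \<eta>) X Z (QQ Y)"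
    by (rule cov_form2_skew[OF D_affine two_form_deta]) (simp_all add: v)
  also have "\<dots> = - cov_form2 D (fund_form f g) X Z Y"
    by (simp add: cov_fund_form_deta[OF v(1,3,2) k(1,2)])
  also have "\<dots> = cov_form2 D (fund_form f g) X Y Z"
    using cov_form2_skew[OF D_affine two_form_fund v] by simp
  also have "\<dots> = cov_form2 D (ext_deriv1 \<eta>) X Y (QQ Z)"
    by (rule cov_fund_form_deta[OF v k(1,3)])
  finally show ?thesis .
qed

text \<open>\<open>trilinear_cyclic\<close> is applied to the form \<open>w\<close> that \<open>\<nabla> d\<eta>\<close> induces on the tangent space at \<open>p\<close>.
  As the properties of \<open>w\<close> hold on \<open>ker \<eta>\<close> only, its arguments are first projected to \<open>ker \<eta>\<close>
  along \<open>\<xi>\<close>; the projection \<open>P\<close> commutes with \<open>Q\<close> because \<open>Q \<xi> = \<xi>\<close> and \<open>\<eta> \<circ> Q = \<eta>\<close>.\<close>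

lemma cyclic_cov_fund_form_kernel:
  assumes v: "X \<in> VF" "Y \<in> VF" "Z \<in> VF" and k: "et X = 0" "et Y = 0" "et Z = 0"
  shows "cov_form2 D (fund_form f g) X Y Z p + cov_form2 D (fund_form f g) Y Z X p
    + cov_form2 D (fund_form f g) Z X Y p = 0"
proof -
  obtain L :: "'e \<Rightarrow> 'm tangent" and K where L: "linear L" "\<And>x. L x \<in> TM p" "\<And>v. v \<in> TM p \<Longrightarrow> L (K v) = v" "\<And>x. K (L x) = x"
    using tangent_coordinates[of p] by blast
  define gh where "gh x y = g p (L x) (L y)" for x y
  define q where "q x = K (Q p (L x))" for x
  have gh: "inner_form gh" unfolding gh_def[abs_def] by (rule pullback_inner_form[of L p K g, OF L(1,2,4) g_metric])
  have q: "linear q" unfolding q_def[abs_def] by (rule pullback_linear[of L p K Q, OF L Q_tensor])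
  have Lq: "L (q x) = Q p (L x)" for x unfolding q_def by (rule L(3)[OF tensor11_TM[OF Q_tensor L(2)]])
  define E where "E x = field_through p (L x)" for x
  have E: "E x \<in> VF" "E x p = L x" for x
    unfolding E_def using field_through[OF L(2)] by blast+
  define P where "P x = E x - fscale (et (E x)) \<xi>" for x
  have P: "P x \<in> VF" for x unfolding P_def by (simp add: E)
  have etP: "et (P x) = 0" for x unfolding P_def by (simp add: E lin_simps)
  have Pp: "P x p = L x - \<eta> p (L x) *\<^sub>R \<xi> p" for x
    by (simp only: P_def minus_apply fscale_def E(2) app1_def)
  have Padd: "P (x + y) p = (P x + P y) p" for x y
    by (simp only: Pp plus_fun_apply linear_add[OF L(1)] one_form_add_at[OF eta_form L(2) L(2)] scaleR_left_distrib)
      (simp only: add_diff_add)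
  have Pcmul: "P (c *\<^sub>R x) p = fscale (\<lambda>_. c) (P x) p" for c x
    by (simp only: Pp fscale_def linear_cmul[OF L(1)] one_form_scaleR_at[OF eta_form L(2)] scaleR_right_diff_distrib scaleR_scaleR)
  have Pq: "P (q x) p = QQ (P x) p" for x
  proof -
    have "\<eta> p (Q p (L x)) = \<eta> p (L x)"
      using fun_cong[OF et_Q[OF E(1)[of x]], of p] by (simp only: app1_def app11_def E(2))
    moreover have "QQ (E x) p = Q p (L x)" "et (E x) p = \<eta> p (L x)"
      by (simp_all only: app11_def app1_def E(2))
    moreover have "QQ (P x) = QQ (E x) - fscale (et (E x)) \<xi>"
      unfolding P_def by (simp add: E lin_simps)
    then have "QQ (P x) p = QQ (E x) p - et (E x) p *\<^sub>R \<xi> p"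
      by (simp only: minus_apply fscale_def)
    ultimately show ?thesis by (simp only: Pp Lq)
  qed
  let ?W = "cov_form2 D (ext_deriv1 \<eta>)"
  define w where "w x y z = ?W (P x) (P y) (P z) p" for x y z
  note at = cov_form2_at[OF D_affine two_form_deta]
  have w_eq: "w x y z = ?W U V W p" if "U \<in> VF" "V \<in> VF" "W \<in> VF" "P x p = U p" "P y p = V p" "P z p = W p"
    for x y z U V W
    unfolding w_def by (rule at) (simp_all only: P that)
  have bil: "bilinear (\<lambda>x y. w x y z)" for z
    unfolding bilinear_def
  proof (intro conjI allI linearI)
    fix x y y' and c :: real
    have "w x (y + y') z = ?W (P x) (P y + P y') (P z) p"
      by (rule w_eq) (simp_all only: P VF_add Padd)
    then show "w x (y + y') z = w x y z + w x y' z"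
      by (simp only: cov_form2_add2[OF D_affine two_form_deta P P P P] plus_fun_apply w_def)
    have "w x (c *\<^sub>R y) z = ?W (P x) (fscale (\<lambda>_. c) (P y)) (P z) p"
      by (rule w_eq) (simp_all only: P VF_fscale smooth_const Pcmul)
    then show "w x (c *\<^sub>R y) z = c *\<^sub>R w x y z"
      by (simp only: cov_form2_fscale2[OF D_affine two_form_deta smooth_const(1) P P P] times_fun_apply w_def real_scaleR_def)
    have "w (y + y') x z = ?W (P y + P y') (P x) (P z) p"
      by (rule w_eq) (simp_all only: P VF_add Padd)
    then show "w (y + y') x z = w y x z + w y' x z"
      by (simp only: cov_form2_add1[OF D_affine two_form_deta P P P P] plus_fun_apply w_def)
    have "w (c *\<^sub>R y) x z = ?W (fscale (\<lambda>_. c) (P y)) (P x) (P z) p"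
      by (rule w_eq) (simp_all only: P VF_fscale smooth_const Pcmul)
    then show "w (c *\<^sub>R y) x z = c *\<^sub>R w y x z"
      by (simp only: cov_form2_fscale1[OF D_affine two_form_deta smooth_const(1) P P P] times_fun_apply w_def real_scaleR_def)
  qed
  have qself: "gh (q x) y = gh x (q y)" for x y
    using fun_cong[OF Q_sym[OF E(1)[of x] E(1)[of y]], of p]
    by (simp only: gh_def Lq app2_def app11_def E(2))
  have wq: "w x (q y) z = ?W (P x) (QQ (P y)) (P z) p" "w x y (q z) = ?W (P x) (P y) (QQ (P z)) p" for x y z
    by (rule w_eq; simp only: P Pq tensor11_VF[OF Q_tensor])+
  have qmove: "w x (q y) z = w x y (q z)" for x y z
    unfolding wq cov_deta_Q[OF P P P etP etP etP] ..
  have cyc: "w x y z + w y z x + w z x y = 0" for x y z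
  proof -
    have "ext_deriv2 (ext_deriv1 \<eta>) (P x) (P y) (P z) p = (w x y z + w y z x + w z x y) / 3"
      unfolding w_def by (rule ext_deriv2_cov[OF D_affine two_form_deta torsion P P P])
    moreover have "ext_deriv2 (ext_deriv1 \<eta>) (P x) (P y) (P z) = 0"
      by (rule ext_deriv1_closed[OF eta_form bracket_VF P P P])
    ultimately show ?thesis by simp
  qed
  have PK: "P (K (U p)) p = U p" if "U \<in> VF" "et U = 0" for U
    using fun_cong[OF that(2), of p] L(3)[OF VF_TM[OF that(1)]] by (simp add: Pp et_at)
  have "cov_form2 D (fund_form f g) U V W p = w (K (U p)) (K (V p)) (q (K (W p)))"
    if "U \<in> VF" "V \<in> VF" "W \<in> VF" "et U = 0" "et V = 0" "et W = 0" for U V W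
  proof -
    have "P (q (K (W p))) p = QQ W p"
      using PK[OF that(3,6)] Pq[of "K (W p)"] by (simp only: app11_def)
    then have "w (K (U p)) (K (V p)) (q (K (W p))) = ?W U V (QQ W) p"
      using w_eq[OF that(1,2) tensor11_VF[OF Q_tensor that(3)] PK[OF that(1,4)] PK[OF that(2,5)]] by blast
    then show ?thesis by (simp only: cov_fund_form_deta[OF that(1,2,3,4,6)])
  qed
  then show ?thesis
    using trilinear_cyclic[where w = w, OF gh q qself bil qmove cyc, of "K (X p)" "K (Y p)" "K (Z p)"]
    by (simp add: v k)
qed

text \<open>The cyclic sum \<open>S\<close> is linear in each argument and vanishes when an argument is \<open>\<xi>\<close>, so all
  arguments may be projected to \<open>ker \<eta>\<close>, one after the other, by rotating \<open>S\<close>.\<close>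

lemma fund_form_closed:
  assumes v: "X \<in> VF" "Y \<in> VF" "Z \<in> VF"
  shows "ext_deriv2 (fund_form f g) X Y Z = 0"
proof
  fix p
  let ?N = "cov_form2 D (fund_form f g)"
  define S where "S X Y Z = ?N X Y Z p + ?N Y Z X p + ?N Z X Y p" for X Y Z
  \<comment> \<open>thus only the last argument needs attention below\<close>
  have rot: "S X Y Z = S Y Z X" for X Y Z by (simp add: S_def)
  have zero: "S X Y \<xi> = 0" if "X \<in> VF" "Y \<in> VF" for X Y
  proof -
    have "?N \<xi> X Y p = 0" using nabla_xi_f[OF that(2)] that by (simp add: fund_form_cov lin_simps)
    moreover have "?N Y \<xi> X = - ?N Y X \<xi>"
      by (rule cov_form2_skew[OF D_affine two_form_fund that(2) xi_VF that(1)])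
    ultimately show ?thesis
      unfolding S_def using cov_fund_form_xi_symmetric[OF that] by simp
  qed
  have drop: "S X Y Z = S X Y (Z - fscale (et Z) \<xi>)" if "X \<in> VF" "Y \<in> VF" "Z \<in> VF" for X Y Z
  proof -
    let ?Z = "Z - fscale (et Z) \<xi>" and ?s = "fscale (et Z) \<xi>"
    have Z: "?Z \<in> VF" "?s \<in> VF" "smooth (et Z)" using that by simp_all
    note t = D_affine two_form_fund
    have "S X Y (?Z + ?s) = S X Y ?Z + et Z p * S X Y \<xi>"
      unfolding S_def cov_form2_add3[OF t that(1,2) Z(1,2)] cov_form2_add2[OF t that(2) Z(1,2) that(1)]
        cov_form2_add1[OF t Z(1,2) that(1,2)] cov_form2_fscale3[OF t Z(3) that(1,2) xi_VF]
        cov_form2_fscale2[OF t Z(3) that(2) xi_VF that(1)] cov_form2_fscale1[OF t Z(3) xi_VF that(1,2)]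
      by (simp add: algebra_simps del: diff_add_cancel)
    then show ?thesis by (simp only: diff_add_cancel zero[OF that(1,2)] mult_zero_right add_0_right)
  qed
  define P where "P X = X - fscale (et X) \<xi>" for X
  have P: "P X \<in> VF" "et (P X) = 0" if "X \<in> VF" for X
    unfolding P_def using that by (simp_all add: lin_simps)
  have "S X Y Z = S X Y (P Z)" unfolding P_def by (rule drop[OF v])
  also have "\<dots> = S (P Z) X Y" using rot by simp
  also have "\<dots> = S (P Z) X (P Y)" unfolding P_def[of Y] by (rule drop[OF P(1)[OF v(3)] v(1,2)])
  also have "\<dots> = S (P Y) (P Z) X" using rot by simp
  also have "\<dots> = S (P Y) (P Z) (P X)"
    unfolding P_def[of X] by (rule drop[OF P(1)[OF v(2)] P(1)[OF v(3)] v(1)])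
  also have "\<dots> = 0"
    unfolding S_def
    by (rule cyclic_cov_fund_form_kernel[OF P(1)[OF v(2)] P(1)[OF v(3)] P(1)[OF v(1)] P(2)[OF v(2)] P(2)[OF v(3)] P(2)[OF v(1)]])
  finally have "S X Y Z = 0" .
  then show "ext_deriv2 (fund_form f g) X Y Z p = 0 p"
    using ext_deriv2_cov[OF D_affine two_form_fund torsion v, of p] by (simp add: S_def)
qed

end

theorem proposition4:
  fixes A :: "('m::{t2_space, second_countable_topology}, 'e::euclidean_space) atlas"
    and n :: nat
    and f Q :: "'m tensor11" and \<xi> :: "'m vfield" and \<eta> :: "'m covector"
    and g :: "'m tensor02" and D :: "'m connection"
  assumes "smooth_manifold A" and "DIM('e) = 2 * n + 1"
    and "weak_quasi_contact_metric A f Q \<xi> \<eta> g D"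
    and "\<forall>X\<in>vfields A. \<forall>Y\<in>vfields A. app1 \<eta> X = 0 \<longrightarrow> app1 \<eta> Y = 0 \<longrightarrow> cov_deriv11 D X Q Y = 0"
    and "\<forall>X\<in>vfields A. \<forall>Y\<in>vfields A. app2 g (tensor_h f \<xi> X) Y = app2 g X (tensor_h f \<xi> Y)"
  shows "contact_form A n \<eta> \<and>
    (\<forall>X\<in>vfields A. \<forall>Y\<in>vfields A. \<forall>Z\<in>vfields A. ext_deriv2 (fund_form f g) X Y Z = 0)"
proof -
  interpret weak_quasi_contact_parallel A n f Q \<xi> \<eta> g D
    by unfold_locales (use assms in blast)+
  show ?thesis using eta_contact fund_form_closed by blast
qed

end
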